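(* Let $X$ be a real random variable with $\mathsf E|X|<\infty$, $\mathsf E X=0$, $\mathsf P(X=0)<1$, and let $m:=\frac12\mathsf E|X|$. Suppose that one has a two-point zero-mean mixture representation of the distribution of $X$: $$\mathsf E g(X)=\int_S\mathsf E g(X_{y_+(s),y_-(s)})\,\nu(ds)$$ for all Borel functions $g\colon\mathbb R\to\mathbb R$ bounded from below or from above, where $\nu$ is a probability measure on a measurable space $(S,\Sigma)$, and $y_+\colon S\to(0,\infty)$ and $y_-\colon S\to(-\infty,0)$ are $\Sigma$-measurable functions. Then: (i) the equation $\tilde\nu(ds):=\frac1m\,\mathsf E\big(X_{y_+(s),y_-(s)}\big)^{+}\,\nu(ds)$ defines a probability measure $\tilde\nu$ on $(S,\Sigma)$, so that $y_+$ and $y_-$ can (and will) be considered as random variables on the probability space $(S,\Sigma,\tilde\nu)$; (ii) then $y_+\overset{\mathrm D}=Y_+$ and $y_-\overset{\mathrm D}=Y_-$ (equality in distribution); (iii) let $H$ be any random variable uniformly distributed on $[0,m]$, and suppose that a superadditive function $k$ is either [right-continuous and bounded from below on $[0,\infty)^2$] or [continuous and bounded from above on $(0,\infty)^2$]; then $$\mathsf E k(y_+,-y_-)\le\mathsf E k\big(x_+(H),-x_-(H)\big)=\mathsf E k\big(Y_+,-\mathsf r(Y_+,U)\big)=\mathsf E k\big(\mathsf r(Y_-,U),-Y_-\big),$$ and, in the case when the additional symmetry condition $k(x,-r)=k(r,-x)$ holds for all real $x$ and $r$ with $xr<0$ (with $k$ defined also on $(-\infty,0)^2$), these last expressions are also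 equal to $\mathsf E k\big(\mathsf r(Y,U),-Y\big)$. In particular, with $\|Z\|_p:=(\mathsf E|Z|^p)^{1/p}$, for any $p>0$ (and for both choices of the signs, upper or lower throughout) $$\Big\|\frac{y_\pm}{y_\mp}\Big\|_p\ge\Big\|\frac{x_\pm(H)}{x_\mp(H)}\Big\|_p=\Big\|\frac{Y_\pm}{\mathsf r(Y_\pm,U)}\Big\|_p=\Big\|\frac{\mathsf r(Y_\mp,U)}{Y_\mp}\Big\|_p,$$ $$\Big\|\frac{y_+}{y_-}\Big\|_p^p+\Big\|\frac{y_-}{y_+}\Big\|_p^p\ge\Big\|\frac{x_+(H)}{x_-(H)}\Big\|_p^p+\Big\|\frac{x_-(H)}{x_+(H)}\Big\|_p^p=\Big\|\frac{Y_+}{\mathsf r(Y_+,U)}\Big\|_p^p+\Big\|\frac{\mathsf r(Y_+,U)}{Y_+}\Big\|_p^p$$ $$=\Big\|\frac{\mathsf r(Y_-,U)}{Y_-}\Big\|_p^p+\Big\|\frac{Y_-}{\mathsf r(Y_-,U)}\Big\|_p^p=2\Big\|\frac{\mathsf r(Y,U)}{Y}\Big\|_p^p=2\Big\|\frac{Y}{\mathsf r(Y,U)}\Big\|_p^p;$$ for any $p\ge1$, $$\|y_++y_-\|_p\ge\|x_+(H)+x_-(H)\|_p=\|Y_++\mathsf r(Y_+,U)\|_p=\|\mathsf r(Y_-,U)+Y_-\|_p=\|\mathsf r(Y,U)+Y\|_p,$$ $$\|y_+-y_-\|_p\le\|x_+(H)-x_-(H)\|_p=\|Y_+-\mathsf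 r(Y_+,U)\|_p=\|\mathsf r(Y_-,U)-Y_-\|_p=\|\mathsf r(Y,U)-Y\|_p;$$ and for any $p\le0$, $$\mathsf E(y_+-y_-)^p\le\mathsf E\big(x_+(H)-x_-(H)\big)^p=\mathsf E\big(Y_+-\mathsf r(Y_+,U)\big)^p=\mathsf E\big(\mathsf r(Y_-,U)-Y_-\big)^p=\mathsf E\big|\mathsf r(Y,U)-Y\big|^p.$$
   Context: Superadditive: for intervals $I_1,I_2\subseteq\mathbb R$, a function $k\colon I_1\times I_2\to\mathbb R$ is superadditive if $k(a,c)+k(b,d)\ge k(a,d)+k(b,c)$ for all $a<b$ in $I_1$ and $c<d$ in $I_2$. Right-continuous means $k(y_1,y_2)\to k(a,b)$ as $(y_1,y_2)\to(a,b)$ with $y_1\ge a$, $y_2\ge b$. Notation: $x^+:=\max(0,x)$, $x^-:=\min(0,x)$. Expectations and norms involving $y_\pm$ are with respect to $\tilde\nu$. Both sides of the inequalities may be infinite. Two-point variables: for real $a,b$ with $ab<0$, $X_{a,b}$ is a zero-mean random variable with values in $\{a,b\}$: $\mathsf P(X_{a,b}=a)=\frac b{b-a}$, $\mathsf P(X_{a,b}=b)=\frac a{a-b}$. Functions $x_\pm$ and reciprocating function $\mathsf r$ of $X$: let $\mu$ be the distribution of $X$ (extended by $\mu(\{\pm\infty\})=0$). Define $G(x)=\int_{(0,x]}z\,\mu(dz)$ for $x\in[0,\infty]$ and $G(x)=\int_{[x,0)}(-z)\,\mu(dz)$ for $x\in[-\infty,0]$; $x_+(h)=\inf\{x\in[0,\infty]\colon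 G(x)\ge h\}$, $x_-(h)=\sup\{x\in[-\infty,0]\colon G(x)\ge h\}$ (with $\inf\emptyset=\infty$, $\sup\emptyset=-\infty$). For $u\in[0,1]$ let $\tilde G(x,u)=G(x-)+(G(x)-G(x-))u$ if $x\in[0,\infty]$ and $\tilde G(x,u)=G(x+)+(G(x)-G(x+))u$ if $x\in[-\infty,0]$ (one-sided limits; $G$ is continuous at $0$). Then $\mathsf r(x,u)=x_-(\tilde G(x,u))$ if $x\in[0,\infty]$ and $\mathsf r(x,u)=x_+(\tilde G(x,u))$ if $x\in[-\infty,0]$. Random variables $Y,Y_\pm$: $U$ is uniform on $[0,1]$, and $Y,Y_+,Y_-$ are any random variables independent of $U$ with distributions $\mathsf P(Y\in A)=\mathsf E|X|\mathrm I\{X\in A\}/\mathsf E|X|$ and $\mathsf P(Y_\pm\in A)=\mathsf E|X^\pm|\mathrm I\{X\in A\}/\mathsf E|X^\pm|$ for Borel $A\subseteq\mathbb R$. (All of $Y,Y_\pm$ and $\mathsf r(Y,U),\mathsf r(Y_\pm,U)$ are a.s. finite and nonzero.) *)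

theory Defs
  imports "HOL-Probability.Probability"
begin

text \<open>
  Expectation with values in the extended reals. The difference is a genuine (possibly infinite)
  expectation whenever one of the two terms is finite, in particular if \<open>f\<close> is almost surely
  bounded from below or from above and \<open>M\<close> is a probability space. It is meant for such \<open>f\<close> only.
\<close>
definition ext_expectation :: "'a measure \<Rightarrow> ('a \<Rightarrow> real) \<Rightarrow> ereal" where
  "ext_expectation M f =
     enn2ereal (\<integral>\<^sup>+ \<omega>. ennreal (f \<omega>) \<partial>M) - enn2ereal (\<integral>\<^sup>+ \<omega>. ennreal (- f \<omega>) \<partial>M)"

text \<open>Meant for exponents \<open>a > 0\<close> only.\<close>
definition ennreal_powr :: "ennreal \<Rightarrow> real \<Rightarrow> ennreal" where
  "ennreal_powr x a = (if x = \<infinity> then \<infinity> else ennreal (enn2real x powr a))"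

definition lp_norm :: "'a measure \<Rightarrow> real \<Rightarrow> ('a \<Rightarrow> real) \<Rightarrow> ennreal" where
  "lp_norm M p Z = ennreal_powr (\<integral>\<^sup>+ \<omega>. ennreal (\<bar>Z \<omega>\<bar> powr p) \<partial>M) (1 / p)"

definition superadditive_on :: "real set \<Rightarrow> real set \<Rightarrow> (real \<Rightarrow> real \<Rightarrow> real) \<Rightarrow> bool" where
  "superadditive_on I1 I2 k \<longleftrightarrow>
     (\<forall>a\<in>I1. \<forall>b\<in>I1. \<forall>c\<in>I2. \<forall>d\<in>I2. a < b \<longrightarrow> c < d \<longrightarrow> k a c + k b d \<ge> k a d + k b c)"

definition right_continuous_on2 :: "real set \<Rightarrow> real set \<Rightarrow> (real \<Rightarrow> real \<Rightarrow> real) \<Rightarrow> bool" where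
  "right_continuous_on2 I1 I2 k \<longleftrightarrow>
     (\<forall>a\<in>I1. \<forall>b\<in>I2. ((\<lambda>(y1, y2). k y1 y2) \<longlongrightarrow> k a b)
        (at (a, b) within (I1 \<inter> {a..}) \<times> (I2 \<inter> {b..})))"

text \<open>Law of the zero-mean variable \<open>X\<^bsub>a,b\<^esub>\<close> with values in \<open>{a, b}\<close>, for \<open>a * b < 0\<close>.\<close>
definition two_point :: "real \<Rightarrow> real \<Rightarrow> real pmf" where
  "two_point a b = map_pmf (\<lambda>t. if t then a else b) (bernoulli_pmf (b / (b - a)))"

text \<open>
  In the next definitions \<open>\<mu>\<close> is the law of \<open>X\<close> on the real line. Since its extension to the
  extended line charges neither infinity, only real \<open>z\<close> contribute to the integrals.
\<close>
definition G_fun :: "real measure \<Rightarrow> ereal \<Rightarrow> real" where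
  "G_fun \<mu> x =
     (if 0 \<le> x then (LINT z:{z. 0 < z \<and> ereal z \<le> x}|\<mu>. z)
      else (LINT z:{z. x \<le> ereal z \<and> z < 0}|\<mu>. - z))"

definition x_plus :: "real measure \<Rightarrow> real \<Rightarrow> ereal" where
  "x_plus \<mu> h = Inf {x. 0 \<le> x \<and> G_fun \<mu> x \<ge> h}"

definition x_minus :: "real measure \<Rightarrow> real \<Rightarrow> ereal" where
  "x_minus \<mu> h = Sup {x. x \<le> 0 \<and> G_fun \<mu> x \<ge> h}"

text \<open>
  The one-sided limits are taken on the extended line, so that \<open>at_left \<infinity>\<close> and
  \<open>at_right (-\<infinity>)\<close> are proper filters. The two clauses agree at \<open>x = 0\<close>.
\<close>
definition G_tilde :: "real measure \<Rightarrow> ereal \<Rightarrow> real \<Rightarrow> real" where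
  "G_tilde \<mu> x u =
     (if 0 \<le> x
      then Lim (at_left x) (G_fun \<mu>) + (G_fun \<mu> x - Lim (at_left x) (G_fun \<mu>)) * u
      else Lim (at_right x) (G_fun \<mu>) + (G_fun \<mu> x - Lim (at_right x) (G_fun \<mu>)) * u)"

definition reciprocating :: "real measure \<Rightarrow> ereal \<Rightarrow> real \<Rightarrow> ereal" where
  "reciprocating \<mu> x u =
     (if 0 \<le> x then x_minus \<mu> (G_tilde \<mu> x u) else x_plus \<mu> (G_tilde \<mu> x u))"

text \<open>
  \<open>has_weighted_law M X w N Y\<close>: on \<open>N\<close>, the variable \<open>Y\<close> has the law
  \<open>A \<mapsto> E |w X| I{X \<in> A} / E |w X|\<close>.
\<close>
definition has_weighted_law ::
  "'a measure \<Rightarrow> ('a \<Rightarrow> real) \<Rightarrow> (real \<Rightarrow> real) \<Rightarrow> 'b measure \<Rightarrow> ('b \<Rightarrow> real) \<Rightarrow> bool" where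
  "has_weighted_law M X w N Y \<longleftrightarrow>
     Y \<in> borel_measurable N \<and>
     (\<forall>A\<in>sets borel. measure N {\<omega>\<in>space N. Y \<omega> \<in> A} =
        (\<integral>\<omega>. \<bar>w (X \<omega>)\<bar> * indicator A (X \<omega>) \<partial>M) / (\<integral>\<omega>. \<bar>w (X \<omega>)\<bar> \<partial>M))"

definition nu_tilde :: "'s measure \<Rightarrow> real \<Rightarrow> ('s \<Rightarrow> real) \<Rightarrow> ('s \<Rightarrow> real) \<Rightarrow> 's measure" where
  "nu_tilde \<nu> m yp ym =
     density \<nu> (\<lambda>s. ennreal (1 / m * measure_pmf.expectation (two_point (yp s) (ym s)) (\<lambda>x. max 0 x)))"

end

theory Submission
  imports Defs
begin

text \<open>
  Let \<open>F\<^sub>+\<close> and \<open>F\<^sub>-\<close> be the measures with densities \<open>x\<^sup>+\<close> and \<open>x\<^sup>-\<close> (reflected to the positive axis)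
  with respect to the law of \<open>X\<close>. Both have mass \<open>m\<close>, the function \<open>G\<close> consists of their distribution
  functions, and \<open>x\<^sub>+\<close>, \<open>- x\<^sub>-\<close> are their quantile functions. Testing the mixture representation on
  \<open>x\<^sup>+\<close> and \<open>x\<^sup>-\<close> restricted to Borel sets shows that \<open>(y\<^sub>+, - y\<^sub>-)\<close> is a coupling of \<open>F\<^sub>+ / m\<close> and
  \<open>F\<^sub>- / m\<close>, whereas \<open>(x\<^sub>+ (H), - x\<^sub>- (H))\<close> is their comonotone coupling, which maximises the expectation
  of superadditive functions. The function \<open>G_tilde\<close> is the distributional transform, so it maps
  \<open>(Y\<^sub>+, U)\<close>, \<open>(Y\<^sub>-, U)\<close> and \<open>(Y, U)\<close> to uniform variables on \<open>[0, m]\<close>, which identifies the reciprocated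
  pairs with the comonotone coupling.
\<close>

section \<open>Superadditive functions and the concordance order\<close>

text \<open>The inequality rests on the upper Frechet-Hoeffding bound: under the comonotone coupling
  an upper quadrant has the smaller of its two marginal masses, the most that any coupling allows,
  and superadditive functions are mixtures of such quadrants up to functions of one variable. What
  shapes the proof is integrability. All expectations may be infinite, so comparisons are made
  between nonnegative integrals and only finite quantities are ever cancelled. On the closed
  quadrant, removing the values on the axes leaves a nonnegative monotone function. On the open
  quadrant \<open>k\<close> may tend to minus infinity at the boundary and there is nothing to
  remove; the measure is cut to compact boxes instead, which is why couplings are treated for
  arbitrary finite mass. Measurability is the second obstacle: \<open>k\<close> is arbitrary off its
  quadrant, and the reciprocated variables are tied to quantiles only almost everywhere, so laws and
  integrands are handled up to null sets.\<close>

type_synonym plane_measure = "(real \<times> real) measure"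

text \<open>Plane measures carry \<open>borel\<close> of the product type, which equals
  \<open>borel \<Otimes>\<^sub>M borel\<close> but is a different term; continuity of the projection
  gives the rule directly.\<close>

lemma measurable_fst_borel [measurable (raw)]:
  fixes f :: "'a \<Rightarrow> real \<times> real"
  shows "f \<in> borel_measurable M \<Longrightarrow> (\<lambda>x. fst (f x)) \<in> borel_measurable M"
  by (rule measurable_compose[where N = borel])
    (auto intro!: borel_measurable_continuous_onI continuous_intros)

lemma measurable_snd_borel [measurable (raw)]:
  fixes f :: "'a \<Rightarrow> real \<times> real"
  shows "f \<in> borel_measurable M \<Longrightarrow> (\<lambda>x. snd (f x)) \<in> borel_measurable M"
  by (rule measurable_compose[where N = borel])
    (auto intro!: borel_measurable_continuous_onI continuous_intros)

declare borel_measurable_Pair [measurable (raw)]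

text \<open>In the degenerate cases \<open>a = b\<close> or \<open>c = d\<close> the two sides
  coincide, so weak inequalities are allowed. This is what makes composition with clamps, which are
  only weakly monotone, possible.\<close>

lemma superadditive_onD:
  assumes "superadditive_on I1 I2 k" "a \<in> I1" "b \<in> I1" "c \<in> I2" "d \<in> I2" "a \<le> b" "c \<le> d"
  shows "k a d + k b c \<le> k a c + k b d"
proof (cases "a = b \<or> c = d")
  case False
  then show ?thesis using assms unfolding superadditive_on_def by fastforce
qed auto

text \<open>The target sets are arbitrary because \<open>f\<close> and \<open>g\<close> map the
  whole line into \<open>I1\<close> and \<open>I2\<close>; a clamp thus carries a function on the
  open quadrant over to the closed one.\<close>

lemma superadditive_on_compose:
  assumes "superadditive_on I1 I2 k" "mono f" "mono g" "range f \<subseteq> I1" "range g \<subseteq> I2"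
  shows "superadditive_on J1 J2 (\<lambda>x y. k (f x) (g y))"
  unfolding superadditive_on_def
proof (intro ballI impI)
  fix a b c d :: real assume "a < b" "c < d"
  then have "f a \<le> f b" "g c \<le> g d" using assms(2,3) by (auto simp: monoD)
  then show "k (f a) (g d) + k (f b) (g c) \<le> k (f a) (g c) + k (f b) (g d)"
    using assms(4,5) by (intro superadditive_onD[OF assms(1)]) auto
qed

lemma right_continuous_on2_seq:
  assumes k: "right_continuous_on2 I1 I2 k" and ab: "a \<in> I1" "b \<in> I2"
    and u: "u \<longlonglongrightarrow> a" "\<And>n. u n \<ge> a" "\<And>n. u n \<in> I1"
    and v: "v \<longlonglongrightarrow> b" "\<And>n. v n \<ge> b" "\<And>n. v n \<in> I2"
  shows "(\<lambda>n. k (u n) (v n)) \<longlonglongrightarrow> k a b"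
proof -
  let ?S = "(I1 \<inter> {a..}) \<times> (I2 \<inter> {b..})"
  have "continuous (at (a, b) within ?S) (\<lambda>(x, y). k x y)"
    using k ab unfolding right_continuous_on2_def continuous_within by auto
  moreover have "(u n, v n) \<in> ?S" for n using u v by auto
  moreover have "(\<lambda>n. (u n, v n)) \<longlonglongrightarrow> (a, b)" using u v by (intro tendsto_Pair)
  ultimately show ?thesis
    using continuous_within_tendsto_compose'[of "(a, b)" ?S "\<lambda>(x, y). k x y" "\<lambda>n. (u n, v n)" sequentially]
    by simp
qed

text \<open>Rounding goes upwards because right-continuity controls only approach from above. With
  the floor plus one instead of the ceiling, the set where a given grid point is exceeded is a
  closed half-line \<open>{a..}\<close>, matching the closed quadrants in
  \<open>conc\<close>.\<close>

definition grid_up :: "nat \<Rightarrow> real \<Rightarrow> real" where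
  "grid_up n x = (real_of_int \<lfloor>x * Suc n\<rfloor> + 1) / Suc n"

lemma grid_up_ge: "x \<le> grid_up n x"
proof -
  have "x * Suc n \<le> \<lfloor>x * Suc n\<rfloor> + 1" by linarith
  then show ?thesis unfolding grid_up_def by (simp add: pos_le_divide_eq del: of_nat_Suc)
qed

lemma grid_up_tendsto: "(\<lambda>n. grid_up n x) \<longlonglongrightarrow> x"
proof (rule real_tendsto_sandwich)
  show "\<forall>\<^sub>F n in sequentially. x \<le> grid_up n x" by (simp add: grid_up_ge)
  have "grid_up n x \<le> x + 1 / Suc n" for n
  proof -
    have "grid_up n x \<le> (x * Suc n + 1) / Suc n"
      unfolding grid_up_def by (intro divide_right_mono) auto
    then show ?thesis by (simp add: add_divide_distrib del: of_nat_Suc)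
  qed
  then show "\<forall>\<^sub>F n in sequentially. grid_up n x \<le> x + 1 / Suc n" by simp
  show "(\<lambda>n. x + 1 / real (Suc n)) \<longlonglongrightarrow> x"
    using tendsto_add[OF tendsto_const LIMSEQ_inverse_real_of_nat, of x] by (simp add: inverse_eq_divide)
qed simp

text \<open>The function is the pointwise limit of its values at grid points above the argument, and
  each approximation depends on the argument only through two integers. Nothing is known about
  \<open>k\<close> off the closed quadrant, hence the \<open>max 0\<close>.\<close>

lemma measurable_right_continuous:
  assumes k: "right_continuous_on2 {0..} {0..} k"
  shows "(\<lambda>z. k (max 0 (fst z)) (max 0 (snd z))) \<in> borel_measurable (borel :: plane_measure)"
proof (rule borel_measurable_LIMSEQ_real)
  fix z :: "real \<times> real"
  obtain x y where z: "z = (x, y)" by force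
  have "(\<lambda>n. k (max 0 (grid_up n x)) (max 0 (grid_up n y))) \<longlonglongrightarrow> k (max 0 x) (max 0 y)"
    by (intro right_continuous_on2_seq[OF k] tendsto_intros grid_up_tendsto max.mono grid_up_ge) auto
  then show "(\<lambda>n. k (max 0 (grid_up n (fst z))) (max 0 (grid_up n (snd z))))
      \<longlonglongrightarrow> k (max 0 (fst z)) (max 0 (snd z))"
    using z by simp
next
  fix n
  let ?g = "\<lambda>i j :: int. k (max 0 ((real_of_int i + 1) / Suc n)) (max 0 ((real_of_int j + 1) / Suc n))"
  have 1: "(\<lambda>z. \<lfloor>snd z * Suc n\<rfloor>) \<in> (borel :: plane_measure) \<rightarrow>\<^sub>M count_space UNIV"
    by measurable
  have 2: "(\<lambda>z. \<lfloor>fst z * Suc n\<rfloor>) \<in> (borel :: plane_measure) \<rightarrow>\<^sub>M count_space UNIV"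
    by measurable
  have "(\<lambda>z. ?g i \<lfloor>snd z * Suc n\<rfloor>) \<in> borel_measurable (borel :: plane_measure)" for i
    by (rule measurable_compose_countable[OF _ 1]) simp
  then have "(\<lambda>z. ?g \<lfloor>fst z * Suc n\<rfloor> \<lfloor>snd z * Suc n\<rfloor>) \<in> borel_measurable (borel :: plane_measure)"
    by (rule measurable_compose_countable[OF _ 2])
  then show "(\<lambda>z. k (max 0 (grid_up n (fst z))) (max 0 (grid_up n (snd z)))) \<in> borel_measurable borel"
    unfolding grid_up_def .
qed

text \<open>Discrete form of the fact that a bivariate distribution function gives each rectangle
  its mixed difference: the cell masses add up, by telescoping in each coordinate.\<close>

lemma sum_rectangle_telescope:
  fixes k :: "'a \<Rightarrow> 'b \<Rightarrow> real"
  shows "(\<Sum>i<p. \<Sum>j<q. k (f (Suc i)) (g (Suc j)) - k (f i) (g (Suc j)) - k (f (Suc i)) (g j) + k (f i) (g j))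
    = k (f p) (g q) - k (f 0) (g q) - k (f p) (g 0) + k (f 0) (g 0)"
proof (induction p)
  case (Suc p)
  have "(\<Sum>j<q. k (f (Suc p)) (g (Suc j)) - k (f p) (g (Suc j)) - k (f (Suc p)) (g j) + k (f p) (g j))
    = (\<Sum>j<q. (k (f (Suc p)) (g (Suc j)) - k (f p) (g (Suc j))) - (k (f (Suc p)) (g j) - k (f p) (g j)))"
    by (intro sum.cong) auto
  also have "\<dots> = (k (f (Suc p)) (g q) - k (f p) (g q)) - (k (f (Suc p)) (g 0) - k (f p) (g 0))"
    by (rule sum_lessThan_telescope)
  finally show ?case using Suc.IH by simp
qed simp

text \<open>\<open>K x y\<close> is the mass that \<open>k\<close> induces on the rectangle spanned
  by the origin and \<open>(x, y)\<close>. Superadditivity says that rectangles have nonnegative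
  mass, so \<open>K\<close> grows with the rectangle.\<close>

lemma superadditive_grounded_mono:
  fixes k :: "real \<Rightarrow> real \<Rightarrow> real"
  defines "K \<equiv> \<lambda>x y. k x y - k 0 y - k x 0 + k 0 0"
  assumes k: "superadditive_on {0..} {0..} k" and "0 \<le> x" "x \<le> x'" "0 \<le> y" "y \<le> y'"
  shows "0 \<le> K x y" "K x y \<le> K x' y'"
proof -
  show "0 \<le> K x y"
    using superadditive_onD[OF k, of 0 x 0 y] assms by simp
  have "K x y \<le> K x' y"
    using superadditive_onD[OF k, of x x' 0 y] assms by simp
  also have "\<dots> \<le> K x' y'"
    using superadditive_onD[OF k, of 0 x' y y'] assms by simp
  finally show "K x y \<le> K x' y'" .
qed

lemma right_continuous_on2_grounded:
  fixes k :: "real \<Rightarrow> real \<Rightarrow> real"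
  assumes k: "right_continuous_on2 {0..} {0..} k"
    and "0 \<le> a" "0 \<le> b" "u \<longlonglongrightarrow> a" "\<And>n. u n \<ge> a" "v \<longlonglongrightarrow> b" "\<And>n. v n \<ge> b"
  shows "(\<lambda>n. k (u n) (v n) - k 0 (v n) - k (u n) 0 + k 0 0) \<longlonglongrightarrow> k a b - k 0 b - k a 0 + k 0 0"
proof -
  have "0 \<le> u n" "0 \<le> v n" for n using assms(2,3) order_trans[OF _ assms(5)] order_trans[OF _ assms(7)] by auto
  then show ?thesis
    using assms by (intro tendsto_intros right_continuous_on2_seq[OF k]) auto
qed

text \<open>Only the masses of upper quadrants are compared here. Equality of the marginals enters
  in \<open>nn_integral_superadditive_le\<close>, where the functions of one variable have to be
  matched.\<close>

locale concordance =
  fixes P Q :: "plane_measure"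
  assumes sets [measurable_cong]: "sets P = sets borel" "sets Q = sets borel"
    and fin: "finite_measure P" "finite_measure Q"
    and pos: "AE z in P. 0 \<le> fst z \<and> 0 \<le> snd z" "AE z in Q. 0 \<le> fst z \<and> 0 \<le> snd z"
    and conc: "\<And>s t. emeasure P ({s..} \<times> {t..}) \<le> emeasure Q ({s..} \<times> {t..})"
begin

text \<open>
  A superadditive function is, up to functions of one variable, the integral of indicators of
  upper quadrants against a positive measure. The measure is replaced by its values on the cells of
  a grid, so that only finite sums occur.
\<close>
lemma nn_integral_grid_le:
  fixes k :: "real \<Rightarrow> real \<Rightarrow> real" and n R :: nat
  defines "t \<equiv> \<lambda>x. min (real R) (grid_up n x)"
  defines "K \<equiv> \<lambda>x y. k x y - k 0 y - k x 0 + k 0 0"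
  assumes k: "superadditive_on {0..} {0..} k"
  shows "(\<integral>\<^sup>+ (x, y). ennreal (K (t x) (t y)) \<partial>P) \<le> (\<integral>\<^sup>+ (x, y). ennreal (K (t x) (t y)) \<partial>Q)"
proof -
  let ?a = "\<lambda>i::nat. real i / Suc n"
  define N where "N = R * Suc n"
  define D where "D i j = k (?a (Suc i)) (?a (Suc j)) - k (?a i) (?a (Suc j))
      - k (?a (Suc i)) (?a j) + k (?a i) (?a j)" for i j
  have D: "D i j \<ge> 0" for i j
    unfolding D_def
    using superadditive_onD[OF k, of "?a i" "?a (Suc i)" "?a j" "?a (Suc j)"] by (simp add: field_simps)
  \<comment> \<open>\<open>\<phi> x\<close> counts the indices \<open>i < N\<close> with
    \<open>?a i \<le> x\<close>, and \<open>t x\<close> is the grid point with this index. Since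
    \<open>?a 0 = 0\<close>, the cells with indices below \<open>\<phi> x\<close> and
    \<open>\<phi> y\<close> make up exactly the rectangle measured by
    \<open>K (t x) (t y)\<close>.\<close>
  define \<phi> where "\<phi> x = min N (nat (\<lfloor>x * Suc n\<rfloor> + 1))" for x :: real
  have t: "t x = ?a (\<phi> x)" if "x \<ge> 0" for x
  proof -
    have "\<lfloor>x * Suc n\<rfloor> \<ge> 0" using that by simp
    then have "real (\<phi> x) = min (real N) (real_of_int \<lfloor>x * Suc n\<rfloor> + 1)"
      unfolding \<phi>_def of_nat_min by (simp add: of_nat_nat del: of_nat_Suc)
    also have "\<dots> / Suc n = min (real N / Suc n) (grid_up n x)"
      unfolding grid_up_def by (simp add: min_def divide_le_cancel del: of_nat_Suc)
    also have "real N / Suc n = R" unfolding N_def of_nat_mult by (rule nonzero_mult_div_cancel_right) simp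
    finally show ?thesis unfolding t_def by simp
  qed
  have \<phi>: "i < \<phi> x \<longleftrightarrow> i < N \<and> ?a i \<le> x" if "x \<ge> 0" for i x
  proof -
    have "i < nat (\<lfloor>x * Suc n\<rfloor> + 1) \<longleftrightarrow> int i \<le> \<lfloor>x * Suc n\<rfloor>" by linarith
    also have "\<dots> \<longleftrightarrow> ?a i \<le> x" by (simp add: le_floor_iff pos_divide_le_eq del: of_nat_Suc)
    finally show ?thesis unfolding \<phi>_def by auto
  qed
  have less: "{..<\<phi> x} = {i \<in> {..<N}. ?a i \<le> x}" if "x \<ge> 0" for x
    using \<phi>[OF that] by blast
  have K: "ennreal (K (t x) (t y))
      = (\<Sum>i<N. \<Sum>j<N. ennreal (D i j) * indicator ({?a i..} \<times> {?a j..}) (x, y))"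
    if "0 \<le> x" "0 \<le> y" for x y
  proof -
    have "(\<Sum>i<\<phi> x. \<Sum>j<\<phi> y. D i j) = K (?a (\<phi> x)) (?a (\<phi> y))"
      unfolding D_def sum_rectangle_telescope[of k ?a ?a] K_def by simp
    then have "K (t x) (t y) = (\<Sum>i<\<phi> x. \<Sum>j<\<phi> y. D i j)"
      by (simp only: t[OF that(1)] t[OF that(2)])
    also have "\<dots> = (\<Sum>i<\<phi> x. \<Sum>j<N. if ?a j \<le> y then D i j else 0)"
      unfolding less[OF that(2)] by (simp only: sum.inter_filter[OF finite_lessThan])
    also have "\<dots> = (\<Sum>i<N. if ?a i \<le> x then \<Sum>j<N. if ?a j \<le> y then D i j else 0 else 0)"
      unfolding less[OF that(1)] by (simp only: sum.inter_filter[OF finite_lessThan])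
    also have "\<dots> = (\<Sum>i<N. \<Sum>j<N. D i j * indicator ({?a i..} \<times> {?a j..}) (x, y))"
    proof (intro sum.cong refl)
      fix i
      show "(if ?a i \<le> x then \<Sum>j<N. if ?a j \<le> y then D i j else 0 else 0)
          = (\<Sum>j<N. D i j * indicator ({?a i..} \<times> {?a j..}) (x, y))"
        by (cases "?a i \<le> x") (simp_all only: if_True if_False, (rule sum.cong sum.neutral[symmetric]; simp add: indicator_def)+)
    qed
    finally have "ennreal (K (t x) (t y))
        = (\<Sum>i<N. \<Sum>j<N. ennreal (D i j * indicator ({?a i..} \<times> {?a j..}) (x, y)))"
      by (simp only: sum_ennreal sum_nonneg mult_nonneg_nonneg D indicator_pos_le)
    then show ?thesis
      by (simp only: ennreal_mult' D ennreal_indicator)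
  qed
  have int: "(\<integral>\<^sup>+ (x, y). ennreal (K (t x) (t y)) \<partial>M)
      = (\<Sum>i<N. \<Sum>j<N. ennreal (D i j) * emeasure M ({?a i..} \<times> {?a j..}))"
    if M[measurable_cong]: "sets M = sets borel" and "AE z in M. 0 \<le> fst z \<and> 0 \<le> snd z"
    for M :: "plane_measure"
  proof -
    have [measurable]: "{a..} \<times> {b..} \<in> sets M" for a b :: real
      unfolding M by (simp add: borel_prod[symmetric])
    have "(\<integral>\<^sup>+ (x, y). ennreal (K (t x) (t y)) \<partial>M)
      = (\<integral>\<^sup>+ z. (\<Sum>i<N. \<Sum>j<N. ennreal (D i j) * indicator ({?a i..} \<times> {?a j..}) z) \<partial>M)"
      using that(2) by (intro nn_integral_cong_AE) (auto simp: K)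
    also have "\<dots> = (\<Sum>i<N. \<Sum>j<N. ennreal (D i j) * emeasure M ({?a i..} \<times> {?a j..}))"
      by (simp add: nn_integral_sum nn_integral_cmult_indicator del: Indicator_Function.sum_mult_indicator Bochner_Integration.sum_mult_indicator)
    finally show ?thesis .
  qed
  show ?thesis
    unfolding int[OF sets(1) pos(1)] int[OF sets(2) pos(2)]
    by (intro sum_mono mult_left_mono conc) auto
qed

text \<open>Two limits are taken. With coordinates truncated at \<open>R\<close>, the constant
  \<open>K R R\<close> dominates and the grid can be refined. When \<open>R\<close> grows, Fatou's
  lemma serves for \<open>P\<close>, while for \<open>Q\<close> monotonicity of \<open>K\<close>
  already bounds every truncated integral by the full one.\<close>

lemma nn_integral_grounded_le:
  fixes k :: "real \<Rightarrow> real \<Rightarrow> real"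
  defines "K \<equiv> \<lambda>x y. k x y - k 0 y - k x 0 + k 0 0"
  assumes k: "superadditive_on {0..} {0..} k" "right_continuous_on2 {0..} {0..} k"
  shows "(\<integral>\<^sup>+ (x, y). ennreal (K x y) \<partial>P) \<le> (\<integral>\<^sup>+ (x, y). ennreal (K x y) \<partial>Q)"
proof -
  interpret P: finite_measure P by (rule fin)
  interpret Q: finite_measure Q by (rule fin)
  have Kmono: "0 \<le> K x y" "K x y \<le> K x' y'" if "0 \<le> x" "x \<le> x'" "0 \<le> y" "y \<le> y'" for x x' y y'
    unfolding K_def by (rule superadditive_grounded_mono[OF k(1) that])+
  note kcm[measurable] = measurable_right_continuous[OF k(2)]
  \<comment> \<open>Extending \<open>K\<close> constantly across the axes makes it Borel on the
    whole plane and changes it only on a null set of \<open>P\<close> and \<open>Q\<close>.\<close>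
  define Kc where "Kc z = K (max 0 (fst z)) (max 0 (snd z))" for z :: "real \<times> real"
  have Kcm[measurable]: "Kc \<in> borel_measurable borel"
  proof -
    have 1: "(\<lambda>z. (0::real, snd z)) \<in> (borel :: plane_measure) \<rightarrow>\<^sub>M borel"
      by measurable
    have 2: "(\<lambda>z. (fst z, 0::real)) \<in> (borel :: plane_measure) \<rightarrow>\<^sub>M borel"
      by measurable
    show ?thesis
      using measurable_compose[OF 1 kcm] measurable_compose[OF 2 kcm]
      unfolding Kc_def K_def by simp
  qed
  let ?T = "\<lambda>R::nat. \<lambda>z :: real \<times> real. (min (real R) (fst z), min (real R) (snd z))"
  have Kct[measurable]: "(\<lambda>z. Kc (?T R z)) \<in> borel_measurable borel" for R
  proof -
    have "(\<lambda>z :: real \<times> real. (min (real R) (fst z), min (real R) (snd z))) \<in> borel \<rightarrow>\<^sub>M borel \<Otimes>\<^sub>M borel"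
      by measurable
    then show ?thesis by (intro measurable_compose[OF _ Kcm]) (simp add: borel_prod)
  qed
  have trunc: "(\<integral>\<^sup>+ z. ennreal (Kc (?T R z)) \<partial>P)
      \<le> (\<integral>\<^sup>+ z. ennreal (Kc (?T R z)) \<partial>Q)" for R :: nat
  proof -
    define g where "g n z = Kc (min (real R) (grid_up n (fst z)), min (real R) (grid_up n (snd z)))" for n z
    have gm[measurable]: "g n \<in> borel_measurable borel" for n
    proof -
      have "(\<lambda>z :: real \<times> real. (min (real R) (grid_up n (fst z)), min (real R) (grid_up n (snd z))))
          \<in> borel \<rightarrow>\<^sub>M borel \<Otimes>\<^sub>M borel"
        unfolding grid_up_def by measurable
      then show ?thesis unfolding g_def by (intro measurable_compose[OF _ Kcm]) (simp add: borel_prod)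
    qed
    have lim: "(\<lambda>n. g n z) \<longlonglongrightarrow> Kc (?T R z)" for z
      unfolding g_def Kc_def K_def fst_conv snd_conv
      by (intro right_continuous_on2_grounded[OF k(2)] tendsto_intros grid_up_tendsto)
        (simp_all only: max.cobounded1, (rule max.mono min.mono order_refl grid_up_ge)+)
    have bound: "0 \<le> g n z" "g n z \<le> K R R" for n z
    proof -
      have *: "0 \<le> max 0 (min (real R) x)" "max 0 (min (real R) x) \<le> R" for x by auto
      show "0 \<le> g n z" "g n z \<le> K R R"
        unfolding g_def Kc_def fst_conv snd_conv
        by (rule Kmono(1)[OF *(1) order_refl *(1) order_refl] Kmono(2)[OF *(1) *(2) *(1) *(2)])+
    qed
    have conv: "(\<lambda>n. \<integral>\<^sup>+ z. ennreal (g n z) \<partial>M)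
        \<longlonglongrightarrow> (\<integral>\<^sup>+ z. ennreal (Kc (?T R z)) \<partial>M)"
      if "finite_measure M" and M[measurable_cong]: "sets M = sets borel" for M
    proof (rule nn_integral_dominated_convergence[where w = "\<lambda>_. ennreal (K R R)"])
      interpret finite_measure M by fact
      show "(\<integral>\<^sup>+ z. ennreal (K R R) \<partial>M) < \<infinity>"
        by (simp add: ennreal_mult_eq_top_iff less_top[symmetric])
      show "AE z in M. (\<lambda>n. ennreal (g n z)) \<longlonglongrightarrow> ennreal (Kc (?T R z))"
        using lim by (intro always_eventually allI tendsto_ennrealI)
      show "(\<lambda>z. ennreal (Kc (?T R z))) \<in> borel_measurable M"
        by measurable
    qed (use bound in \<open>auto intro!: ennreal_leI\<close>)
    have le: "(\<integral>\<^sup>+ z. ennreal (g n z) \<partial>P) \<le> (\<integral>\<^sup>+ z. ennreal (g n z) \<partial>Q)" for n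
    proof -
      have *: "(\<integral>\<^sup>+ z. ennreal (g n z) \<partial>M) = (\<integral>\<^sup>+ (x, y). ennreal (K (min (real R) (grid_up n x)) (min (real R) (grid_up n y))) \<partial>M)"
        if "AE z in M. 0 \<le> fst z \<and> 0 \<le> snd z" for M
        using that
      proof (intro nn_integral_cong_AE, elim eventually_mono)
        fix z :: "real \<times> real" assume z: "0 \<le> fst z \<and> 0 \<le> snd z"
        then have "0 \<le> grid_up n (fst z)" "0 \<le> grid_up n (snd z)"
          using order_trans[OF _ grid_up_ge] by auto
        then show "ennreal (g n z) = (case z of (x, y) \<Rightarrow> ennreal (K (min (real R) (grid_up n x)) (min (real R) (grid_up n y))))"
          unfolding g_def Kc_def by (simp add: case_prod_beta' max_def)
      qed
      show ?thesis unfolding *[OF pos(1)] *[OF pos(2)]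
        unfolding K_def by (rule nn_integral_grid_le[OF k(1)])
    qed
    show ?thesis by (rule LIMSEQ_le[OF conv[OF fin(1) sets(1)] conv[OF fin(2) sets(2)]]) (use le in auto)
  qed
  have lim: "(\<lambda>R. ennreal (Kc (?T R z))) \<longlonglongrightarrow> ennreal (Kc z)" for z
  proof (rule tendsto_eventually)
    obtain R0 :: nat where "max (fst z) (snd z) \<le> R0" using real_arch_simple by blast
    show "\<forall>\<^sub>F R :: nat in sequentially. ennreal (Kc (?T R z)) = ennreal (Kc z)"
    proof (intro eventually_sequentiallyI[of R0])
      fix R assume "R0 \<le> R"
      then have "fst z \<le> R" "snd z \<le> R" using \<open>max (fst z) (snd z) \<le> R0\<close> by auto
      then show "ennreal (Kc (?T R z)) = ennreal (Kc z)"
        by (simp add: min_absorb2)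
    qed
  qed
  have "(\<integral>\<^sup>+ z. ennreal (Kc z) \<partial>P)
      = (\<integral>\<^sup>+ z. liminf (\<lambda>R. ennreal (Kc (?T R z))) \<partial>P)"
    by (intro nn_integral_cong lim_imp_Liminf[symmetric] lim) simp
  also have "\<dots> \<le> liminf (\<lambda>R. \<integral>\<^sup>+ z. ennreal (Kc (?T R z)) \<partial>P)"
    by (rule nn_integral_liminf) measurable
  also have "\<dots> \<le> liminf (\<lambda>R. \<integral>\<^sup>+ z. ennreal (Kc z) \<partial>Q)"
  proof (intro Liminf_mono always_eventually allI)
    fix R
    have "(\<integral>\<^sup>+ z. ennreal (Kc (?T R z)) \<partial>Q) \<le> (\<integral>\<^sup>+ z. ennreal (Kc z) \<partial>Q)"
      unfolding Kc_def fst_conv snd_conv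
      by (intro nn_integral_mono ennreal_leI Kmono(2) max.cobounded1 max.mono order_refl min.cobounded2)
    then show "(\<integral>\<^sup>+ z. ennreal (Kc (?T R z)) \<partial>P) \<le> (\<integral>\<^sup>+ z. ennreal (Kc z) \<partial>Q)"
      using trunc[of R] by (rule order_trans[rotated])
  qed
  also have "\<dots> = (\<integral>\<^sup>+ z. ennreal (Kc z) \<partial>Q)" by (simp add: Liminf_const)
  finally have "(\<integral>\<^sup>+ z. ennreal (Kc z) \<partial>P) \<le> (\<integral>\<^sup>+ z. ennreal (Kc z) \<partial>Q)" .
  moreover have "(\<integral>\<^sup>+ z. ennreal (Kc z) \<partial>M) = (\<integral>\<^sup>+ (x, y). ennreal (K x y) \<partial>M)"
    if "AE z in M. 0 \<le> fst z \<and> 0 \<le> snd z" for M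
    using that by (intro nn_integral_cong_AE) (auto simp: Kc_def max_def)
  ultimately show ?thesis using pos by simp
qed

text \<open>In \<open>k x y + k 0 0 = k x 0 + k 0 y + K x y\<close> every term is nonnegative, so
  integrals can be added even when infinite. The one-variable terms agree by the marginals,
  \<open>K\<close> is compared above, and only the finite contribution of \<open>k 0 0\<close> has
  to be cancelled.\<close>

theorem nn_integral_superadditive_le:
  fixes k :: "real \<Rightarrow> real \<Rightarrow> real"
  assumes marg: "distr P borel fst = distr Q borel fst" "distr P borel snd = distr Q borel snd"
    and k: "superadditive_on {0..} {0..} k" "right_continuous_on2 {0..} {0..} k"
    and k0: "\<And>x y. 0 \<le> x \<Longrightarrow> 0 \<le> y \<Longrightarrow> 0 \<le> k x y"
  shows "(\<integral>\<^sup>+ (x, y). ennreal (k x y) \<partial>P) \<le> (\<integral>\<^sup>+ (x, y). ennreal (k x y) \<partial>Q)"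
proof -
  interpret P: finite_measure P by (rule fin)
  interpret Q: finite_measure Q by (rule fin)
  define K where "K x y = k x y - k 0 y - k x 0 + k 0 0" for x y
  note kcm[measurable] = measurable_right_continuous[OF k(2)]
  have [measurable]: "(\<lambda>y. k 0 (max 0 y)) \<in> borel_measurable borel" "(\<lambda>x. k (max 0 x) 0) \<in> borel_measurable borel"
  proof -
    have 1: "(\<lambda>y. (0::real, y::real)) \<in> borel \<rightarrow>\<^sub>M (borel :: plane_measure)"
      and 2: "(\<lambda>y. (y::real, 0::real)) \<in> borel \<rightarrow>\<^sub>M (borel :: plane_measure)"
      by (simp_all add: borel_prod[symmetric])
    show "(\<lambda>y. k 0 (max 0 y)) \<in> borel_measurable borel" "(\<lambda>x. k (max 0 x) 0) \<in> borel_measurable borel"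
      using measurable_compose[OF 1 kcm] measurable_compose[OF 2 kcm] by simp_all
  qed
  let ?I = "\<lambda>M f. \<integral>\<^sup>+ z. ennreal (f (max 0 (fst z)) (max 0 (snd z))) \<partial>(M :: plane_measure)"
  have I: "(\<integral>\<^sup>+ (x, y). ennreal (f x y) \<partial>M) = ?I M f"
    if "AE z in M. 0 \<le> fst z \<and> 0 \<le> snd z" for M and f :: "real \<Rightarrow> real \<Rightarrow> real"
    using that by (intro nn_integral_cong_AE) (auto simp: max_def)
  have split: "?I M k + ennreal (k 0 0) * emeasure M UNIV
      = (\<integral>\<^sup>+ x. ennreal (k (max 0 x) 0) \<partial>distr M borel fst)
      + (\<integral>\<^sup>+ y. ennreal (k 0 (max 0 y)) \<partial>distr M borel snd) + ?I M K"
    if M[measurable_cong]: "sets M = sets borel" for M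
  proof -
    have sp: "space M = UNIV" using sets_eq_imp_space_eq[OF M] by simp
    have [measurable]: "(\<lambda>z. K (max 0 (fst z)) (max 0 (snd z))) \<in> borel_measurable M"
      "(\<lambda>z. k (max 0 (fst z)) (max 0 (snd z))) \<in> borel_measurable M"
      unfolding K_def by measurable
    have "?I M k + ennreal (k 0 0) * emeasure M UNIV
        = (\<integral>\<^sup>+ z. ennreal (k (max 0 (fst z)) (max 0 (snd z))) + ennreal (k 0 0) \<partial>M)"
      by (subst nn_integral_add) (auto simp: sp)
    also have "\<dots> = (\<integral>\<^sup>+ z. ennreal (k (max 0 (fst z)) 0) + ennreal (k 0 (max 0 (snd z)))
        + ennreal (K (max 0 (fst z)) (max 0 (snd z))) \<partial>M)"
    proof (intro nn_integral_cong)
      fix z :: "real \<times> real"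
      let ?x = "max 0 (fst z)" and ?y = "max 0 (snd z)"
      have "0 \<le> K ?x ?y"
        unfolding K_def using superadditive_grounded_mono(1)[OF k(1), of ?x ?x ?y ?y] by simp
      then have "ennreal (k ?x 0) + ennreal (k 0 ?y) + ennreal (K ?x ?y)
          = ennreal (k ?x 0 + k 0 ?y + K ?x ?y)"
        by (simp add: k0)
      also have "k ?x 0 + k 0 ?y + K ?x ?y = k ?x ?y + k 0 0"
        unfolding K_def by simp
      finally show "ennreal (k ?x ?y) + ennreal (k 0 0)
          = ennreal (k ?x 0) + ennreal (k 0 ?y) + ennreal (K ?x ?y)"
        by (simp add: k0)
    qed
    also have "\<dots> = (\<integral>\<^sup>+ z. ennreal (k (max 0 (fst z)) 0) \<partial>M) + (\<integral>\<^sup>+ z. ennreal (k 0 (max 0 (snd z))) \<partial>M)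
        + ?I M K"
      by (simp add: nn_integral_add)
    finally show ?thesis by (simp add: nn_integral_distr)
  qed
  have mass: "emeasure P UNIV = emeasure Q UNIV"
    using arg_cong[OF marg(1), of "\<lambda>M. emeasure M UNIV"] sets_eq_imp_space_eq[OF sets(1)] sets_eq_imp_space_eq[OF sets(2)]
    by (simp add: emeasure_distr)
  have "?I P K \<le> ?I Q K"
    using nn_integral_grounded_le[OF k]
    unfolding K_def[symmetric] I[OF pos(1), of K] I[OF pos(2), of K] .
  then have "?I P k + ennreal (k 0 0) * emeasure P UNIV \<le> ?I Q k + ennreal (k 0 0) * emeasure Q UNIV"
    unfolding split[OF sets(1)] split[OF sets(2)] marg by (rule add_left_mono)
  then have "?I P k + ennreal (k 0 0) * emeasure P UNIV \<le> ?I Q k + ennreal (k 0 0) * emeasure P UNIV"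
    unfolding mass .
  moreover have "ennreal (k 0 0) * emeasure P UNIV < \<infinity>"
    by (simp add: ennreal_mult_eq_top_iff less_top[symmetric])
  ultimately have "?I P k \<le> ?I Q k"
    by (auto simp: add.commute[of _ "ennreal (k 0 0) * emeasure P UNIV"] ennreal_add_left_cancel_le)
  then show ?thesis unfolding I[OF pos(1), of k] I[OF pos(2), of k] .
qed

end

section \<open>Quantile functions and comonotone rearrangement\<close>

definition leb_upto :: "real \<Rightarrow> real measure" where
  "leb_upto c = density lborel (indicator {0<..<c})"

lemma sets_leb_upto [simp, measurable_cong]: "sets (leb_upto c) = sets borel"
  and space_leb_upto [simp]: "space (leb_upto c) = UNIV"
  by (auto simp: leb_upto_def)

lemma nn_integral_leb_upto:
  "f \<in> borel_measurable borel \<Longrightarrow> (\<integral>\<^sup>+ h. f h \<partial>leb_upto c) = (\<integral>\<^sup>+ h. indicator {0<..<c} h * f h \<partial>lborel)"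
  unfolding leb_upto_def by (rule nn_integral_density) auto

lemma emeasure_leb_upto: "A \<in> sets borel \<Longrightarrow> emeasure (leb_upto c) A = emeasure lborel ({0<..<c} \<inter> A)"
  unfolding leb_upto_def
  by (subst emeasure_density) (auto simp: indicator_inter_arith[symmetric] nn_integral_indicator)

lemma emeasure_leb_upto_UNIV: "0 \<le> c \<Longrightarrow> emeasure (leb_upto c) UNIV = ennreal c"
  by (subst emeasure_leb_upto) auto

lemma finite_measure_leb_upto: "finite_measure (leb_upto c)"
  by (rule finite_measureI) (cases "0 \<le> c"; simp add: emeasure_leb_upto)

lemma AE_leb_upto: "AE h in leb_upto c. 0 < h \<and> h < c"
  unfolding leb_upto_def by (subst AE_density) (auto split: split_indicator)

text \<open>At level 0 the set is the whole line, and at the full mass it may be empty, so the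
  infimum means nothing there. The default 0 is never seen by \<open>leb_upto\<close>, which charges
  only the open interval.\<close>

definition quantile :: "real measure \<Rightarrow> real \<Rightarrow> real" where
  "quantile \<rho> h = (if 0 < h \<and> h < measure \<rho> UNIV then Inf {x. h \<le> cdf \<rho> x} else 0)"

section \<open>Quantiles as generalised inverses of distribution functions\<close>

context finite_borel_measure
begin

lemma right_continuous_mono_cdf: "right_continuous_mono (cdf M) 0 (measure M UNIV)"
proof
  show "(cdf M \<longlongrightarrow> measure M UNIV) at_top"
    using cdf_lim_at_top by (simp add: borel_UNIV)
qed (auto intro: cdf_nondecreasing cdf_is_right_cont cdf_lim_at_bot monoI)

text \<open>This Galois connection holds across jumps and flat pieces of the distribution function
  alike; monotonicity, measurability and the law of the quantile function all come from it.\<close>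

lemma quantile_le_iff:
  assumes "0 < h" "h < measure M UNIV"
  shows "quantile M h \<le> x \<longleftrightarrow> h \<le> cdf M x"
proof -
  have "quantile M h = Inf {x. h \<le> cdf M x}" using assms by (simp add: quantile_def)
  then show ?thesis
    using right_continuous_mono.pseudoinverse[OF right_continuous_mono_cdf assms, of x] by (simp only:)
qed

lemma quantile_mono:
  assumes "0 < h" "h \<le> h'" "h' < measure M UNIV"
  shows "quantile M h \<le> quantile M h'"
proof -
  have "h' \<le> cdf M (quantile M h')"
    using assms quantile_le_iff[of h' "quantile M h'"] by simp
  then show ?thesis using assms quantile_le_iff[of h] by simp
qed

lemma measurable_quantile [measurable]: "quantile M \<in> borel_measurable borel"
proof (rule borel_measurableI_le)
  fix x
  have "{h. quantile M h \<le> x} = {h. 0 < h \<and> h < measure M UNIV \<and> h \<le> cdf M x}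
      \<union> {h. \<not> (0 < h \<and> h < measure M UNIV) \<and> 0 \<le> x}"
  proof (rule set_eqI)
    fix h
    show "h \<in> {h. quantile M h \<le> x} \<longleftrightarrow> h \<in> {h. 0 < h \<and> h < measure M UNIV \<and> h \<le> cdf M x}
      \<union> {h. \<not> (0 < h \<and> h < measure M UNIV) \<and> 0 \<le> x}"
      by (cases "0 < h \<and> h < measure M UNIV") (auto simp: quantile_le_iff, auto simp: quantile_def)
  qed
  then show "{h \<in> space borel. quantile M h \<le> x} \<in> sets borel" by simp
qed

text \<open>Inverse transform sampling: by \<open>quantile_le_iff\<close> the preimage of
  \<open>{x<..}\<close> is the interval from \<open>cdf M x\<close> to the full mass, whose length
  is the mass of \<open>{x<..}\<close>.\<close>

lemma distr_quantile: "distr (leb_upto (measure M UNIV)) borel (quantile M) = M"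
proof (rule measure_eqI_lessThan)
  let ?c = "measure M UNIV"
  interpret L: finite_measure "leb_upto ?c" by (rule finite_measure_leb_upto)
  fix x
  have cdf: "0 \<le> cdf M x" "cdf M x \<le> ?c"
    using cdf_nonneg cdf_bounded by (auto simp: borel_UNIV)
  have "emeasure (distr (leb_upto ?c) borel (quantile M)) {x<..}
      = emeasure lborel ({0<..<?c} \<inter> quantile M -` {x<..})"
    using measurable_sets[OF measurable_quantile, of "{x<..}"]
    by (subst emeasure_distr) (auto simp: emeasure_leb_upto)
  also have "{0<..<?c} \<inter> quantile M -` {x<..} = {cdf M x<..<?c}"
    using cdf quantile_le_iff by (auto simp: not_le[symmetric])
  also have "emeasure lborel \<dots> = ennreal (?c - cdf M x)" using cdf by simp
  also have "?c - cdf M x = measure M {x<..}"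
    using finite_measure_compl[of "{..x}"] M_is_borel by (simp add: cdf_def borel_UNIV Compl_eq_Diff_UNIV[symmetric])
  finally show "emeasure (distr (leb_upto ?c) borel (quantile M)) {x<..} = emeasure M {x<..}"
    by (simp add: emeasure_eq_measure)
  then show "emeasure (distr (leb_upto ?c) borel (quantile M)) {x<..} < \<infinity>"
    by (simp add: emeasure_eq_measure)
qed (auto simp: M_is_borel)

end

section \<open>The comonotone coupling of a finite plane measure\<close>

lemma finite_borel_measure_distr:
  assumes "finite_measure P" "f \<in> borel_measurable P"
  shows "finite_borel_measure (distr P borel f)"
  using assms by (simp add: finite_borel_measure_def finite_borel_measure_axioms_def finite_measure.finite_measure_distr)

text \<open>Not normalised, because \<open>comonotone_minimal_cost\<close> is proved by truncation to subprobabilities.\<close>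
definition comonotone :: "plane_measure \<Rightarrow> plane_measure" where
  "comonotone P = distr (leb_upto (measure P UNIV)) borel
     (\<lambda>h. (quantile (distr P borel fst) h, quantile (distr P borel snd) h))"

locale finite_plane_measure = finite_measure P for P :: "plane_measure" +
  assumes sets_P [measurable_cong]: "sets P = sets borel"
begin

lemma space_P: "space P = UNIV"
  using sets_eq_imp_space_eq[OF sets_P] by simp

abbreviation "P1 \<equiv> distr P borel fst"
abbreviation "P2 \<equiv> distr P borel snd"

sublocale P1: finite_borel_measure P1
  by (rule finite_borel_measure_distr[OF finite_measure_axioms]) measurable

sublocale P2: finite_borel_measure P2
  by (rule finite_borel_measure_distr[OF finite_measure_axioms]) measurable

lemma mass_P1: "measure P1 UNIV = measure P UNIV" and mass_P2: "measure P2 UNIV = measure P UNIV"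
  by (auto simp: measure_distr space_P)

lemma sets_comonotone [simp, measurable_cong]: "sets (comonotone P) = sets borel"
  and space_comonotone [simp]: "space (comonotone P) = UNIV"
  by (auto simp: comonotone_def)

lemma finite_measure_comonotone: "finite_measure (comonotone P)"
  unfolding comonotone_def
  by (intro finite_measure.finite_measure_distr finite_measure_leb_upto) measurable

lemma distr_comonotone:
  "distr (comonotone P) borel fst = P1" "distr (comonotone P) borel snd = P2"
  using P1.distr_quantile P2.distr_quantile
  unfolding comonotone_def mass_P1 mass_P2
  by (subst distr_distr; simp add: comp_def borel_measurable_Pair)+

text \<open>Each of the two conditions concerns one coordinate, and the rearrangement keeps both
  marginals; a condition on the pair would not transfer.\<close>

lemma AE_comonotone:
  assumes "AE z in P. fst z \<in> A \<and> snd z \<in> B" and [measurable]: "A \<in> sets borel" "B \<in> sets borel"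
  shows "AE z in comonotone P. fst z \<in> A \<and> snd z \<in> B"
proof -
  have "AE x in P1. x \<in> A" "AE x in P2. x \<in> B"
    using assms(1) by (auto simp: AE_distr_iff)
  then have "AE x in distr (comonotone P) borel fst. x \<in> A" "AE x in distr (comonotone P) borel snd. x \<in> B"
    unfolding distr_comonotone .
  then show ?thesis by (auto simp: AE_distr_iff)
qed

text \<open>The Frechet-Hoeffding bound. Both quantile functions increase in the same variable
  \<open>h\<close>, so the level sets \<open>?A\<close> and \<open>?B\<close> are nested and the
  quadrant gets the mass of the smaller one. That is a marginal mass, which bounds the quadrant
  under \<open>P\<close> as well.\<close>

lemma emeasure_comonotone_ge:
  "emeasure P ({s..} \<times> {t..}) \<le> emeasure (comonotone P) ({s..} \<times> {t..})"
proof -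
  let ?c = "measure P UNIV"
  let ?q1 = "quantile P1" and ?q2 = "quantile P2"
  have [measurable]: "{a..} \<times> {b..} \<in> sets borel" for a b :: real
    by (simp add: borel_prod[symmetric])
  have m: "?q1 -` {s..} \<in> sets borel" "?q2 -` {t..} \<in> sets borel"
    using measurable_sets[OF P1.measurable_quantile, of "{s..}"]
      measurable_sets[OF P2.measurable_quantile, of "{t..}"] by auto
  have "emeasure (comonotone P) ({s..} \<times> {t..})
      = emeasure (leb_upto ?c) (?q1 -` {s..} \<inter> ?q2 -` {t..})"
    unfolding comonotone_def
    by (subst emeasure_distr) (auto intro!: arg_cong2[where f = emeasure])
  also have "\<dots> = emeasure lborel (({0<..<?c} \<inter> ?q1 -` {s..}) \<inter> ({0<..<?c} \<inter> ?q2 -` {t..}))"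
    using m by (subst emeasure_leb_upto) (auto intro!: arg_cong2[where f = emeasure])
  finally have eq: "emeasure (comonotone P) ({s..} \<times> {t..})
      = emeasure lborel (({0<..<?c} \<inter> ?q1 -` {s..}) \<inter> ({0<..<?c} \<inter> ?q2 -` {t..}))" .
  have 1: "emeasure lborel ({0<..<?c} \<inter> ?q1 -` {s..}) = emeasure P1 {s..}"
    using arg_cong[OF P1.distr_quantile, of "\<lambda>M. emeasure M {s..}"] m(1)
    by (simp add: emeasure_distr emeasure_leb_upto mass_P1)
  have 2: "emeasure lborel ({0<..<?c} \<inter> ?q2 -` {t..}) = emeasure P2 {t..}"
    using arg_cong[OF P2.distr_quantile, of "\<lambda>M. emeasure M {t..}"] m(2)
    by (simp add: emeasure_distr emeasure_leb_upto mass_P2)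
  let ?A = "{0<..<?c} \<inter> ?q1 -` {s..}" and ?B = "{0<..<?c} \<inter> ?q2 -` {t..}"
  have "?A \<subseteq> ?B \<or> ?B \<subseteq> ?A"
  proof (rule ccontr)
    assume "\<not> (?A \<subseteq> ?B \<or> ?B \<subseteq> ?A)"
    then obtain h h' where "h \<in> ?A" "h \<notin> ?B" "h' \<in> ?B" "h' \<notin> ?A"
      by blast
    then have h: "0 < h" "h < ?c" "s \<le> ?q1 h" "\<not> t \<le> ?q2 h"
      and h': "0 < h'" "h' < ?c" "t \<le> ?q2 h'" "\<not> s \<le> ?q1 h'"
      by auto
    show False
      using P1.quantile_mono[of h h'] P2.quantile_mono[of h' h] h h' mass_P1 mass_P2 by linarith
  qed
  then show ?thesis
  proof
    assume "?A \<subseteq> ?B"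
    then have "emeasure (comonotone P) ({s..} \<times> {t..}) = emeasure P1 {s..}"
      unfolding eq by (simp only: Int_absorb2 1)
    also have "\<dots> = emeasure P (fst -` {s..})" by (simp add: emeasure_distr space_P)
    also have "\<dots> \<ge> emeasure P ({s..} \<times> {t..})"
      by (intro emeasure_mono) (auto simp: sets_P intro!: measurable_sets_borel[of fst borel])
    finally show ?thesis .
  next
    assume "?B \<subseteq> ?A"
    then have "emeasure (comonotone P) ({s..} \<times> {t..}) = emeasure P2 {t..}"
      unfolding eq by (simp only: Int_absorb1 2)
    also have "\<dots> = emeasure P (snd -` {t..})" by (simp add: emeasure_distr space_P)
    also have "\<dots> \<ge> emeasure P ({s..} \<times> {t..})"
      by (intro emeasure_mono) (auto simp: sets_P intro!: measurable_sets_borel[of snd borel])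
    finally show ?thesis .
  qed
qed

theorem comonotone_maximal:
  assumes pos: "AE z in P. 0 \<le> fst z \<and> 0 \<le> snd z"
    and k: "superadditive_on {0..} {0..} k" "right_continuous_on2 {0..} {0..} k"
    and k0: "\<And>x y. 0 \<le> x \<Longrightarrow> 0 \<le> y \<Longrightarrow> 0 \<le> k x y"
  shows "(\<integral>\<^sup>+ (x, y). ennreal (k x y) \<partial>P) \<le> (\<integral>\<^sup>+ (x, y). ennreal (k x y) \<partial>comonotone P)"
proof -
  have "AE z in P. fst z \<in> {0..} \<and> snd z \<in> {0..}"
    using pos by eventually_elim simp
  from AE_comonotone[OF this] have pos': "AE z in comonotone P. 0 \<le> fst z \<and> 0 \<le> snd z"
    by simp
  interpret concordance P "comonotone P"
    by (rule concordance.intro[OF sets_P sets_comonotone finite_measure_axioms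
        finite_measure_comonotone pos pos' emeasure_comonotone_ge])
  show ?thesis
    by (rule nn_integral_superadditive_le[OF distr_comonotone(1)[symmetric] distr_comonotone(2)[symmetric] k])
      (rule k0)
qed

end

text \<open>Convergence can fail only where \<open>quantile M\<close> jumps, and a monotone function
  has countably many jumps.\<close>

lemma quantile_tendsto_AE:
  fixes M :: "real measure"
  assumes "finite_borel_measure M" "\<And>n. finite_borel_measure (N n)"
    and le: "\<And>n x. cdf (N n) x \<le> cdf M x" "\<And>n. measure (N n) UNIV \<le> measure M UNIV"
    and lim: "\<And>x. (\<lambda>n. cdf (N n) x) \<longlonglongrightarrow> cdf M x" "(\<lambda>n. measure (N n) UNIV) \<longlonglongrightarrow> measure M UNIV"
  shows "AE h in leb_upto (measure M UNIV). (\<lambda>n. quantile (N n) h) \<longlonglongrightarrow> quantile M h"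
proof -
  interpret M: finite_borel_measure M by fact
  interpret N: finite_borel_measure "N n" for n by fact
  let ?c = "measure M UNIV"
  define D where "D = {h \<in> {0<..<?c}. \<not> isCont (quantile M) h}"
  have "countable D"
    unfolding D_def by (rule mono_on_ctble_discont_open) (auto intro!: mono_onI M.quantile_mono)
  then have "AE h in lborel. h \<notin> D"
    by (intro AE_not_in countable_imp_null_set_lborel)
  then have "AE h in leb_upto ?c. h \<notin> D"
    unfolding leb_upto_def by (subst AE_density) auto
  then show ?thesis using AE_leb_upto[of ?c]
  proof eventually_elim
    case (elim h)
    then have h: "0 < h" "h < ?c" and cont: "isCont (quantile M) h" by (auto simp: D_def)
    have ev: "\<forall>\<^sub>F n in sequentially. h < measure (N n) UNIV"
      using order_tendstoD(1)[OF lim(2) h(2)] .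
    \<comment> \<open>This half holds without any limit: \<open>N n\<close> puts no more mass to the
      left of a point than \<open>M\<close>, so it reaches the level \<open>h\<close> no
      earlier.\<close>
    have lower: "quantile M h \<le> quantile (N n) h" if "h < measure (N n) UNIV" for n
    proof -
      have "h \<le> cdf (N n) (quantile (N n) h)"
        using N.quantile_le_iff[of h n "quantile (N n) h"] h that by simp
      also have "\<dots> \<le> cdf M (quantile (N n) h)" by (rule le)
      finally show ?thesis using M.quantile_le_iff[OF h] by simp
    qed
    show ?case
    proof (rule LIMSEQ_I)
      fix e :: real assume "0 < e"
      \<comment> \<open>Continuity at \<open>h\<close> provides a level \<open>h'\<close> strictly
        above \<open>h\<close> whose quantile is still within \<open>e / 2\<close>. The gap between
        \<open>h\<close> and \<open>h'\<close> gives a strict inequality for \<open>cdf M\<close>,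
        which then passes to \<open>cdf (N n)\<close> for large \<open>n\<close>.\<close>
      have "(quantile M \<longlongrightarrow> quantile M h) (at_right h)"
        using cont by (auto simp: continuous_within intro: tendsto_within_subset)
      then have "\<forall>\<^sub>F h' in at_right h. quantile M h' < quantile M h + e / 2"
        by (rule order_tendstoD) (use \<open>0 < e\<close> in simp)
      moreover have "\<forall>\<^sub>F h' in at_right h. h' < ?c \<and> h < h'"
        using h(2) by (simp add: eventually_at_right_field) blast
      ultimately have "\<forall>\<^sub>F h' in at_right h. quantile M h' < quantile M h + e / 2 \<and> h' < ?c \<and> h < h'"
        by eventually_elim auto
      then obtain h' where h': "quantile M h' < quantile M h + e / 2" "h' < ?c" "h < h'"
        using eventually_happens'[OF trivial_limit_at_right_real] by blast
      have "h' \<le> cdf M (quantile M h + e / 2)"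
        using h' h M.quantile_le_iff[of h' "quantile M h + e / 2"] by simp
      then have "h < cdf M (quantile M h + e / 2)" using h' by simp
      then have "\<forall>\<^sub>F n in sequentially. h < cdf (N n) (quantile M h + e / 2)"
        by (rule order_tendstoD(1)[OF lim(1)])
      with ev have "\<forall>\<^sub>F n in sequentially. norm (quantile (N n) h - quantile M h) < e"
      proof eventually_elim
        case (elim n)
        then have "quantile (N n) h \<le> quantile M h + e / 2"
          using N.quantile_le_iff[of h n] h by simp
        with lower[OF elim(1)] show ?case using \<open>0 < e\<close> by simp
      qed
      then show "\<exists>no. \<forall>n\<ge>no. norm (quantile (N n) h - quantile M h) < e"
        by (simp add: eventually_sequentially)
    qed
  qed
qed

section \<open>Costs on the open quadrant\<close>

text \<open>A monotone continuous retraction of the line onto \<open>box_set n\<close>. The squares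
  of these intervals are compact and exhaust the open quadrant.\<close>

definition clamp_real :: "nat \<Rightarrow> real \<Rightarrow> real" where
  "clamp_real n x = max (1 / Suc n) (min (real (Suc n)) x)"

definition box_set :: "nat \<Rightarrow> real set" where
  "box_set n = {1 / Suc n..real (Suc n)}"

abbreviation in_box :: "nat \<Rightarrow> real \<times> real \<Rightarrow> bool" where
  "in_box n z \<equiv> fst z \<in> box_set n \<and> snd z \<in> box_set n"

lemma box_set_ends: "1 / real (Suc n) \<le> real (Suc n)"
  by (rule order_trans[of _ 1]) simp_all

lemma clamp_real_box: "clamp_real n x \<in> box_set n"
  using box_set_ends[of n] by (simp add: clamp_real_def box_set_def del: of_nat_Suc)

lemma clamp_real_id: "x \<in> box_set n \<Longrightarrow> clamp_real n x = x"
  by (simp add: clamp_real_def box_set_def del: of_nat_Suc)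

lemma box_set_pos: "box_set n \<subseteq> {0<..}"
proof
  fix x assume "x \<in> box_set n"
  then have "1 / real (Suc n) \<le> x" by (simp add: box_set_def)
  then show "x \<in> {0<..}" by (simp add: less_le_trans[of 0 "1 / real (Suc n)"] del: of_nat_Suc)
qed

lemma continuous_clamp_real: "continuous_on S (clamp_real n)"
  unfolding clamp_real_def by (intro continuous_intros)

lemma mono_clamp_real: "mono (clamp_real n)"
  unfolding clamp_real_def by (intro monoI max.mono min.mono order_refl)

lemma eventually_box_set: "0 < x \<Longrightarrow> \<forall>\<^sub>F n in sequentially. x \<in> box_set n"
proof -
  assume x: "0 < x"
  obtain n0 :: nat where n0: "max x (1 / x) \<le> n0" using real_arch_simple by blast
  show ?thesis
  proof (rule eventually_sequentiallyI)
    fix n assume "n0 \<le> n"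
    then have "max x (1 / x) \<le> real (Suc n)" using n0 by linarith
    then have "x \<le> real (Suc n)" "1 / x \<le> real (Suc n)" by auto
    then show "x \<in> box_set n"
      using x unfolding box_set_def by (auto simp: field_simps simp del: of_nat_Suc)
  qed
qed

lemma box_set_mono: "n \<le> n' \<Longrightarrow> box_set n \<subseteq> box_set n'"
  unfolding box_set_def by (auto simp: frac_le intro: order_trans)

lemma right_continuous_on2_continuous:
  assumes "continuous_on (I1 \<times> I2) (\<lambda>(x, y). k x y)"
  shows "right_continuous_on2 I1 I2 k"
  unfolding right_continuous_on2_def
proof (intro ballI)
  fix a b assume ab: "a \<in> I1" "b \<in> I2"
  then have "((\<lambda>(x, y). k x y) \<longlongrightarrow> k a b) (at (a, b) within I1 \<times> I2)"
    using assms by (auto simp: continuous_on_def)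
  then show "((\<lambda>(x, y). k x y) \<longlongrightarrow> k a b) (at (a, b) within (I1 \<inter> {a..}) \<times> (I2 \<inter> {b..}))"
    by (rule tendsto_within_subset) auto
qed

lemma open_quadrant: "open ({0<..} \<times> {0<..} :: (real \<times> real) set)"
  by (intro open_Times) auto

lemma sets_quadrant [measurable]: "({0<..} \<times> {0<..} :: (real \<times> real) set) \<in> sets borel"
  by (intro borel_open open_quadrant)

lemma measurable_continuous_quadrant:
  fixes k :: "real \<Rightarrow> real \<Rightarrow> real"
  assumes "continuous_on ({0<..} \<times> {0<..}) (\<lambda>(x, y). k x y)"
  shows "(\<lambda>z. indicator ({0<..} \<times> {0<..}) z * k (fst z) (snd z)) \<in> borel_measurable borel"
  using borel_measurable_continuous_on_indicator[OF sets_quadrant assms]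
  by (simp add: case_prod_beta')

section \<open>Minimal cost of the comonotone coupling\<close>

context finite_plane_measure
begin

text \<open>Both measures have the same mass, so \<open>comonotone_maximal\<close> for \<open>B + k\<close> gives the bound for \<open>- k\<close>.\<close>
lemma comonotone_bounded_cost:
  fixes k :: "real \<Rightarrow> real \<Rightarrow> real"
  assumes AE: "AE z in P. in_box n z"
    and k: "superadditive_on {0<..} {0<..} k" "continuous_on ({0<..} \<times> {0<..}) (\<lambda>(x, y). k x y)"
    and neg: "\<And>x y. 0 < x \<Longrightarrow> 0 < y \<Longrightarrow> k x y \<le> 0"
  shows "(\<integral>\<^sup>+ (x, y). ennreal (- k x y) \<partial>comonotone P) \<le> (\<integral>\<^sup>+ (x, y). ennreal (- k x y) \<partial>P)"
proof -
  let ?S = "box_set n \<times> box_set n"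
  have "?S \<subseteq> {0<..} \<times> {0<..}" using box_set_pos by blast
  then have "compact ((\<lambda>(x, y). k x y) ` ?S)"
    by (intro compact_continuous_image continuous_on_subset[OF k(2)] compact_Times)
      (auto simp: box_set_def)
  then obtain B where "\<forall>t \<in> (\<lambda>(x, y). k x y) ` ?S. \<bar>t\<bar> \<le> B"
    using compact_imp_bounded bounded_real by blast
  then have B: "\<bar>k x y\<bar> \<le> B" if "x \<in> box_set n" "y \<in> box_set n" for x y
    using that by blast
  \<comment> \<open>Clamping leaves \<open>k\<close> unchanged on the box that carries
    \<open>P\<close> and makes it superadditive and continuous up to the axes, as
    \<open>comonotone_maximal\<close> requires.\<close>
  let ?c = "clamp_real n"
  let ?k = "\<lambda>z. k (?c (fst z)) (?c (snd z))"
  define k' where "k' x y = k (?c x) (?c y) + B" for x y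
  let ?K' = "\<lambda>M. \<integral>\<^sup>+ (x, y). ennreal (k' x y) \<partial>M"
  have sup: "superadditive_on {0..} {0..} k'"
  proof -
    have "superadditive_on {0..} {0..} (\<lambda>x y. k (?c x) (?c y))"
      by (rule superadditive_on_compose[OF k(1) mono_clamp_real mono_clamp_real])
        (use clamp_real_box box_set_pos in blast)+
    then show ?thesis unfolding superadditive_on_def k'_def by auto
  qed
  have cont': "continuous_on UNIV (\<lambda>z. ?k z)"
  proof -
    have "continuous_on UNIV (\<lambda>z. (?c (fst z), ?c (snd z)))"
      by (intro continuous_on_Pair continuous_on_compose2[OF continuous_clamp_real[of UNIV]] continuous_intros) auto
    then have "continuous_on UNIV (\<lambda>z. (\<lambda>(x, y). k x y) (?c (fst z), ?c (snd z)))"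
      by (rule continuous_on_compose2[OF k(2)]) (use clamp_real_box box_set_pos in blast)
    then show ?thesis by simp
  qed
  have cont: "right_continuous_on2 {0..} {0..} k'"
  proof (rule right_continuous_on2_continuous)
    show "continuous_on ({0..} \<times> {0..}) (\<lambda>(x, y). k' x y)"
      unfolding k'_def case_prod_beta'
      by (intro continuous_intros continuous_on_subset[OF cont']) auto
  qed
  have [measurable]: "(\<lambda>z. ?k z) \<in> borel_measurable borel"
    by (rule borel_measurable_continuous_onI[OF cont'])
  have bd: "0 \<le> - k (?c x) (?c y)" "- k (?c x) (?c y) \<le> B" for x y
  proof -
    have "0 < ?c x" "0 < ?c y" using clamp_real_box box_set_pos by blast+
    then show "0 \<le> - k (?c x) (?c y)" using neg by simp
    show "- k (?c x) (?c y) \<le> B"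
      using B[OF clamp_real_box clamp_real_box, of x y] by linarith
  qed
  have pos: "AE z in P. 0 \<le> fst z \<and> 0 \<le> snd z"
    using AE
  proof eventually_elim
    case (elim z)
    then have "fst z \<in> {0<..}" "snd z \<in> {0<..}" using box_set_pos by blast+
    then show ?case by simp
  qed
  have le: "?K' P \<le> ?K' (comonotone P)"
  proof (rule comonotone_maximal[OF pos sup cont])
    show "0 \<le> k' x y" for x y using bd(2)[of x y] unfolding k'_def by linarith
  qed
  have split: "(\<integral>\<^sup>+ z. ennreal (- ?k z) \<partial>M) + ?K' M
      = ennreal B * emeasure M UNIV" if M[measurable_cong]: "sets M = sets borel" for M
  proof -
    have sp: "space M = UNIV" using sets_eq_imp_space_eq[OF M] by simp
    have "(\<integral>\<^sup>+ z. ennreal (- ?k z) \<partial>M) + ?K' M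
      = (\<integral>\<^sup>+ z. ennreal (- ?k z) + ennreal (?k z + B) \<partial>M)"
      unfolding k'_def case_prod_beta' by (subst nn_integral_add) auto
    also have "\<dots> = (\<integral>\<^sup>+ z. ennreal B \<partial>M)"
    proof (rule nn_integral_cong)
      fix z
      show "ennreal (- ?k z) + ennreal (?k z + B) = ennreal B"
        using bd[of "fst z" "snd z"] by (subst ennreal_plus[symmetric]) auto
    qed
    finally show ?thesis by (simp add: sp)
  qed
  have mass: "emeasure (comonotone P) UNIV = emeasure P UNIV"
    using arg_cong[OF distr_comonotone(1), of "\<lambda>M. emeasure M UNIV"]
    by (simp add: emeasure_distr space_P)
  let ?K = "\<lambda>M. \<integral>\<^sup>+ z. ennreal (- ?k z) \<partial>M"
  have fin: "?K' P \<noteq> \<infinity>"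
  proof -
    have "?K' P \<le> ennreal B * emeasure P UNIV"
      unfolding split[OF sets_P, symmetric] by (rule add_increasing) simp_all
    also have "\<dots> < \<infinity>" by (simp add: ennreal_mult_eq_top_iff less_top[symmetric])
    finally show ?thesis by simp
  qed
  have "?K' P + ?K (comonotone P)
      \<le> ?K' (comonotone P) + ?K (comonotone P)"
    using le by (rule add_right_mono)
  also have "\<dots> = ?K' P + ?K P"
    using split[OF sets_P] split[OF sets_comonotone] mass by (simp add: add.commute)
  finally have "?K (comonotone P) \<le> ?K P"
    using fin by (simp add: ennreal_add_left_cancel_le)
  moreover have "(\<integral>\<^sup>+ (x, y). ennreal (- k x y) \<partial>M) = ?K M"
    if "AE z in M. in_box n z" for M
    using that by (intro nn_integral_cong_AE) (auto simp: clamp_real_id)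
  moreover have "AE z in comonotone P. in_box n z"
    by (rule AE_comonotone[OF AE]) (auto simp: box_set_def)
  ultimately show ?thesis using AE by simp
qed

text \<open>
  Truncating \<open>k\<close> would lose domination under \<open>P\<close>. Restricting \<open>P\<close> to boxes instead makes the cost
  increase to its limit, and the quantile functions of the restrictions converge almost everywhere.
\<close>
theorem comonotone_minimal_cost:
  fixes k :: "real \<Rightarrow> real \<Rightarrow> real"
  assumes pos: "AE z in P. 0 < fst z \<and> 0 < snd z"
    and k: "superadditive_on {0<..} {0<..} k" "continuous_on ({0<..} \<times> {0<..}) (\<lambda>(x, y). k x y)"
    and neg: "\<And>x y. 0 < x \<Longrightarrow> 0 < y \<Longrightarrow> k x y \<le> 0"
  shows "(\<integral>\<^sup>+ (x, y). ennreal (- k x y) \<partial>comonotone P) \<le> (\<integral>\<^sup>+ (x, y). ennreal (- k x y) \<partial>P)"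
proof -
  let ?D = "{0<..} \<times> {0<..} :: (real \<times> real) set"
  define f where "f z = ennreal (- (indicator ?D z * k (fst z) (snd z)))" for z
  have [measurable]: "f \<in> borel_measurable borel"
    unfolding f_def using measurable_continuous_quadrant[OF k(2)] by measurable
  have f: "f z = (case z of (x, y) \<Rightarrow> ennreal (- k x y))" if "z \<in> ?D" for z
    using that by (auto simp: f_def)
  \<comment> \<open>The limits of the quantile pairs lie almost surely in the open quadrant, where
    \<open>k\<close> is continuous; on the boundary the cut-off \<open>f\<close> may jump.\<close>
  have f_lim: "(\<lambda>n. f (z n)) \<longlonglongrightarrow> f z0" if "z \<longlonglongrightarrow> z0" "z0 \<in> ?D" for z z0
  proof -
    have "isCont (\<lambda>(x, y). k x y) z0"
      using k(2) that(2) continuous_on_eq_continuous_at[OF open_quadrant] by blast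
    then have "(\<lambda>n. (\<lambda>(x, y). k x y) (z n)) \<longlonglongrightarrow> (\<lambda>(x, y). k x y) z0"
      using that(1) by (rule isCont_tendsto_compose)
    then have "(\<lambda>n. ennreal (- (\<lambda>(x, y). k x y) (z n))) \<longlonglongrightarrow> ennreal (- (\<lambda>(x, y). k x y) z0)"
      by (intro tendsto_ennrealI tendsto_minus)
    moreover have "\<forall>\<^sub>F n in sequentially. z n \<in> ?D"
      by (rule topological_tendstoD[OF that(1) open_quadrant that(2)])
    then have "\<forall>\<^sub>F n in sequentially. f (z n) = ennreal (- (\<lambda>(x, y). k x y) (z n))"
      by eventually_elim (auto simp: f)
    moreover have "f z0 = ennreal (- (\<lambda>(x, y). k x y) z0)" using that(2) by (auto simp: f)
    ultimately show ?thesis by (simp add: tendsto_cong)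
  qed
  define E where "E n = box_set n \<times> box_set n" for n
  have [measurable]: "E n \<in> sets borel" for n
    unfolding E_def box_set_def by (simp add: borel_prod[symmetric])
  \<comment> \<open>Restricted and not conditioned: without renormalisation the mass of every set
    increases to its mass under \<open>P\<close>, which yields the domination and the convergence
    asked for by \<open>quantile_tendsto_AE\<close>.\<close>
  define Q where "Q n = density P (indicator (E n))" for n
  have Q: "finite_plane_measure (Q n)" for n
    unfolding finite_plane_measure_def finite_plane_measure_axioms_def
  proof
    have "emeasure (Q n) (space (Q n)) \<le> emeasure P UNIV"
      unfolding Q_def by (subst emeasure_density) (auto simp: space_P sets_P intro!: emeasure_mono)
    then show "finite_measure (Q n)"
      using emeasure_finite[of UNIV] by (intro finite_measureI) (auto simp: top_unique)
  qed (simp add: Q_def sets_P)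
  interpret Q: finite_plane_measure "Q n" for n by (rule Q)
  have Q_eq: "measure (Q n) A = measure P (E n \<inter> A)" if "A \<in> sets borel" for n A
    unfolding Q_def by (rule measure_restricted) (use that in \<open>simp_all add: sets_P\<close>)
  have Q_lim: "(\<lambda>n. measure (Q n) A) \<longlonglongrightarrow> measure P A" if [measurable]: "A \<in> sets borel" for A
  proof -
    have "(\<lambda>n. measure P (E n \<inter> A)) \<longlonglongrightarrow> measure P (\<Union>n. E n \<inter> A)"
    proof (rule finite_Lim_measure_incseq)
      show "incseq (\<lambda>n. E n \<inter> A)"
        unfolding E_def by (intro monoI Int_mono Sigma_mono box_set_mono order_refl) simp_all
    qed (auto simp: sets_P)
    also have "measure P (\<Union>n. E n \<inter> A) = measure P A"
    proof (rule measure_eq_AE)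
      show "AE z in P. (z \<in> (\<Union>n. E n \<inter> A)) = (z \<in> A)"
        using pos
      proof eventually_elim
        case (elim z)
        then have "\<forall>\<^sub>F n in sequentially. in_box n z"
          by (auto intro!: eventually_conj eventually_box_set)
        then obtain n where "in_box n z"
          using eventually_happens'[OF sequentially_bot] by blast
        then show ?case by (auto simp: E_def mem_Times_iff)
      qed
    qed (auto simp: sets_P)
    finally show ?thesis by (simp add: Q_eq)
  qed
  let ?c = "measure P UNIV"
  have Q_le: "measure (Q n) A \<le> measure P A" if "A \<in> sets borel" for n A
    unfolding Q_eq[OF that] by (rule finite_measure_mono) (use that in \<open>simp_all add: sets_P\<close>)
  have q1: "AE h in leb_upto ?c. (\<lambda>n. quantile (Q.P1 n) h) \<longlonglongrightarrow> quantile P1 h"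
    unfolding mass_P1[symmetric]
    by (rule quantile_tendsto_AE[OF P1.finite_borel_measure_axioms Q.P1.finite_borel_measure_axioms])
      (simp_all add: cdf_def2 measure_distr space_P Q.space_P Q_le Q_lim measurable_sets_borel[of fst borel])
  have q2: "AE h in leb_upto ?c. (\<lambda>n. quantile (Q.P2 n) h) \<longlonglongrightarrow> quantile P2 h"
    unfolding mass_P2[symmetric]
    by (rule quantile_tendsto_AE[OF P2.finite_borel_measure_axioms Q.P2.finite_borel_measure_axioms])
      (simp_all add: cdf_def2 measure_distr space_P Q.space_P Q_le Q_lim measurable_sets_borel[of snd borel])
  define c where "c n = measure (Q n) UNIV" for n
  have c_le: "c n \<le> ?c" for n
    unfolding c_def by (rule Q_le) simp
  have c_lim: "c \<longlonglongrightarrow> ?c" unfolding c_def by (rule Q_lim) simp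
  have pos': "AE z in comonotone P. z \<in> ?D"
    using AE_comonotone[of "{0<..}" "{0<..}"] pos by (auto simp: mem_Times_iff)
  then have posq: "AE h in leb_upto ?c. (quantile P1 h, quantile P2 h) \<in> ?D"
    unfolding comonotone_def by (subst (asm) AE_distr_iff) auto
  \<comment> \<open>From the mass \<open>c n\<close> on, the quantile functions of
    \<open>Q n\<close> have their default value. The indicator removes these levels, and every level
    below \<open>?c\<close> is eventually kept.\<close>
  let ?g = "\<lambda>n h. indicator {0<..<c n} h * f (quantile (Q.P1 n) h, quantile (Q.P2 n) h)"
  have lim: "AE h in leb_upto ?c. f (quantile P1 h, quantile P2 h) = liminf (\<lambda>n. ?g n h)"
    using q1 q2 posq AE_leb_upto[of ?c]
  proof eventually_elim
    case (elim h)
    have "\<forall>\<^sub>F n in sequentially. h < c n"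
      using order_tendstoD(1)[OF c_lim] elim by simp
    then have "\<forall>\<^sub>F n in sequentially. ?g n h = f (quantile (Q.P1 n) h, quantile (Q.P2 n) h)"
      by eventually_elim (use elim in simp)
    moreover have "(\<lambda>n. f (quantile (Q.P1 n) h, quantile (Q.P2 n) h)) \<longlonglongrightarrow> f (quantile P1 h, quantile P2 h)"
      using elim by (intro f_lim tendsto_Pair) auto
    ultimately have "(\<lambda>n. ?g n h) \<longlonglongrightarrow> f (quantile P1 h, quantile P2 h)"
      by (simp add: tendsto_cong)
    then show ?case by (intro lim_imp_Liminf[symmetric]) simp_all
  qed
  have trunc: "(\<integral>\<^sup>+ h. ?g n h \<partial>leb_upto ?c) \<le> (\<integral>\<^sup>+ z. f z \<partial>P)" for n
  proof -
    have AEQ: "AE z in Q n. in_box n z"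
    proof -
      have "indicator (E n) \<in> borel_measurable P" by measurable
      then show ?thesis
        unfolding Q_def by (subst AE_density) (auto simp: E_def mem_Times_iff split: split_indicator)
    qed
    have AEQ': "AE z in comonotone (Q n). in_box n z"
      by (rule Q.AE_comonotone[OF AEQ]) (auto simp: box_set_def)
    have f_eq: "(\<integral>\<^sup>+ z. f z \<partial>M) = (\<integral>\<^sup>+ (x, y). ennreal (- k x y) \<partial>M)"
      if "AE z in M. in_box n z" for M
      using that
    proof (intro nn_integral_cong_AE, elim eventually_mono)
      fix z :: "real \<times> real" assume "in_box n z"
      then have "z \<in> ?D" using box_set_pos[of n] by (auto simp: mem_Times_iff)
      then show "f z = (case z of (x, y) \<Rightarrow> ennreal (- k x y))" by (rule f)
    qed
    have "(\<integral>\<^sup>+ h. ?g n h \<partial>leb_upto ?c)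
        = (\<integral>\<^sup>+ h. f (quantile (Q.P1 n) h, quantile (Q.P2 n) h) \<partial>leb_upto (c n))"
      using c_le[of n] by (subst (1 2) nn_integral_leb_upto)
        (auto intro!: nn_integral_cong split: split_indicator)
    also have "\<dots> = (\<integral>\<^sup>+ z. f z \<partial>comonotone (Q n))"
      unfolding comonotone_def c_def by (subst nn_integral_distr) auto
    also have "\<dots> \<le> (\<integral>\<^sup>+ z. f z \<partial>Q n)"
      unfolding f_eq[OF AEQ] f_eq[OF AEQ']
      by (rule Q.comonotone_bounded_cost[OF AEQ k neg])
    also have "\<dots> \<le> (\<integral>\<^sup>+ z. f z \<partial>P)"
      unfolding Q_def by (subst nn_integral_density) (auto intro!: nn_integral_mono split: split_indicator)
    finally show ?thesis .
  qed
  have "(\<integral>\<^sup>+ (x, y). ennreal (- k x y) \<partial>comonotone P) = (\<integral>\<^sup>+ z. f z \<partial>comonotone P)"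
    using pos' by (intro nn_integral_cong_AE) (auto simp: f)
  also have "\<dots> = (\<integral>\<^sup>+ h. f (quantile P1 h, quantile P2 h) \<partial>leb_upto ?c)"
    unfolding comonotone_def by (subst nn_integral_distr) auto
  also have "\<dots> = (\<integral>\<^sup>+ h. liminf (\<lambda>n. ?g n h) \<partial>leb_upto ?c)"
    by (rule nn_integral_cong_AE[OF lim])
  \<comment> \<open>Only an upper bound for the comonotone cost is wanted, so Fatou's lemma suffices
    and no dominating function has to be found.\<close>
  also have "\<dots> \<le> liminf (\<lambda>n. \<integral>\<^sup>+ h. ?g n h \<partial>leb_upto ?c)"
    by (rule nn_integral_liminf) measurable
  also have "\<dots> \<le> liminf (\<lambda>n. \<integral>\<^sup>+ z. f z \<partial>P)"
    by (intro Liminf_mono always_eventually allI trunc)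
  also have "\<dots> = (\<integral>\<^sup>+ z. f z \<partial>P)" by (simp add: Liminf_const)
  also have "\<dots> = (\<integral>\<^sup>+ (x, y). ennreal (- k x y) \<partial>P)"
    using pos by (intro nn_integral_cong_AE) (auto simp: f)
  finally show ?thesis .
qed

end

section \<open>The distributional transform\<close>

abbreviation unif01 :: "real measure" where
  "unif01 \<equiv> uniform_measure lborel {0..1}"

lemma prob_space_unif01: "prob_space unif01"
  by (rule prob_space_uniform_measure) auto

text \<open>The left end point is excluded because at an atom the transform must rise strictly above
  the left limit of the distribution function; \<open>AE_quantile_dtrans\<close> relies on
  this.\<close>

lemma AE_unif01: "AE u in unif01. 0 < u \<and> u \<le> 1"
proof (rule AE_uniform_measureI)
  have "AE u in lborel. u \<noteq> (0::real)" by (rule AE_lborel_singleton)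
  then show "AE u in lborel. u \<in> {0..1} \<longrightarrow> 0 < u \<and> u \<le> (1::real)"
    by eventually_elim auto
qed simp

text \<open>
  With \<open>u\<close> uniform, this is the distributional transform: it spreads the atoms of \<open>\<rho>\<close> uniformly
  over the jumps of its distribution function.
\<close>
definition dtrans :: "real measure \<Rightarrow> real \<Rightarrow> real \<Rightarrow> real" where
  "dtrans \<rho> x u = measure \<rho> {..<x} + (cdf \<rho> x - measure \<rho> {..<x}) * u"

lemma measure_eqI_lessThan':
  fixes M N :: "real measure"
  assumes sets: "sets M = sets borel" "sets N = sets borel"
    and fin: "\<And>x. emeasure M {..<x} \<noteq> \<infinity>"
    and eq: "\<And>x. emeasure M {..<x} = emeasure N {..<x}"
  shows "M = N"
proof (rule measure_eqI_generator_eq[where E = "range lessThan" and \<Omega> = UNIV and A = "\<lambda>i. {..<real i}"])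
  have "sets (borel :: real measure) = sigma_sets UNIV (range lessThan)"
    by (subst borel_Iio) (simp add: sets_measure_of)
  then show "sets M = sigma_sets UNIV (range lessThan)" "sets N = sigma_sets UNIV (range lessThan)"
    using sets by simp_all
  show "Int_stable (range (lessThan :: real \<Rightarrow> real set))"
  proof (rule Int_stableI)
    fix A B :: "real set" assume "A \<in> range lessThan" "B \<in> range lessThan"
    then obtain a b where "A = {..<a}" "B = {..<b}" by auto
    then have "A \<inter> B = {..<min a b}" by auto
    then show "A \<inter> B \<in> range lessThan" by blast
  qed
  show "(\<Union>i. {..<real i}) = UNIV"
    using reals_Archimedean2 by auto
qed (use fin eq in auto)

context finite_borel_measure
begin

abbreviation "MU \<equiv> M \<Otimes>\<^sub>M unif01"

lemma measure_lessThan_le_cdf: "measure M {..<x} \<le> cdf M x"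
  unfolding cdf_def by (intro finite_measure_mono) auto

lemma cdf_le_measure_lessThan: "y < x \<Longrightarrow> cdf M y \<le> measure M {..<x}"
  unfolding cdf_def by (intro finite_measure_mono) auto

lemma measurable_cdf [measurable]: "cdf M \<in> borel_measurable borel"
  by (intro borel_measurable_mono monoI cdf_nondecreasing)

lemma measurable_measure_lessThan [measurable]: "(\<lambda>x. measure M {..<x}) \<in> borel_measurable borel"
  by (intro borel_measurable_mono monoI finite_measure_mono) auto

lemma measurable_dtrans [measurable (raw)]:
  assumes [measurable]: "f \<in> borel_measurable N" "g \<in> borel_measurable N"
  shows "(\<lambda>\<omega>. dtrans M (f \<omega>) (g \<omega>)) \<in> borel_measurable N"
  unfolding dtrans_def by measurable

lemma measurable_dtrans_pair [measurable]:
  "(\<lambda>z. dtrans M (fst z) (snd z)) \<in> borel_measurable MU"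
proof (rule measurable_dtrans)
  show "fst \<in> borel_measurable MU"
    using measurable_fst[of M unif01] measurable_cong_sets[OF refl M_is_borel] by blast
  show "snd \<in> borel_measurable MU"
    using measurable_snd[of M unif01] by simp
qed

lemma sets_dtrans:
  "{z \<in> space MU. dtrans M (fst z) (snd z) < h} \<in> sets MU"
  "{z \<in> space MU. \<not> dtrans M (fst z) (snd z) < h} \<in> sets MU"
  using measurable_sets[OF measurable_dtrans_pair, of "{..<h}"]
    measurable_sets[OF measurable_dtrans_pair, of "{h..}"]
  by (auto simp: vimage_def Int_def conj_commute not_less)

lemma dtrans_bounds:
  assumes "0 \<le> u" "u \<le> 1"
  shows "measure M {..<x} \<le> dtrans M x u" "dtrans M x u \<le> cdf M x"
proof -
  have d: "0 \<le> cdf M x - measure M {..<x}" using measure_lessThan_le_cdf by simp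
  then show "measure M {..<x} \<le> dtrans M x u"
    using assms by (simp add: dtrans_def)
  have "(cdf M x - measure M {..<x}) * u \<le> (cdf M x - measure M {..<x}) * 1"
    using d assms by (intro mult_left_mono)
  then show "dtrans M x u \<le> cdf M x" by (simp add: dtrans_def)
qed

text \<open>Slice at \<open>?q\<close>. Points to the left of \<open>?q\<close> always have a
  transform below \<open>h\<close>, points to the right almost never. At \<open>?q\<close> itself
  the transform runs linearly from \<open>?a\<close> to \<open>?b\<close>, so a fraction
  \<open>(h - ?a) / (?b - ?a)\<close> of the atom counts, and the total is
  \<open>?a + (h - ?a)\<close>.\<close>

lemma emeasure_dtrans_less:
  assumes h: "0 < h" "h < measure M UNIV"
  shows "emeasure MU {z \<in> space MU. dtrans M (fst z) (snd z) < h} = ennreal h"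
proof -
  interpret U: prob_space unif01 by (rule prob_space_unif01)
  interpret prod: pair_sigma_finite M unif01 ..
  note [measurable_cong] = M_is_borel
  let ?q = "quantile M h"
  let ?a = "measure M {..<?q}" and ?b = "cdf M ?q"
  have hb: "h \<le> ?b" using quantile_le_iff[OF h] by auto
  have ah: "?a \<le> h"
  proof (rule tendsto_upperbound[OF cdf_at_left])
    show "\<forall>\<^sub>F x in at_left ?q. cdf M x \<le> h"
      unfolding eventually_at_filter
    proof (intro always_eventually allI impI)
      fix x assume "x \<noteq> ?q" "x \<in> {..<?q}"
      then show "cdf M x \<le> h" using quantile_le_iff[OF h, of x] by auto
    qed
  qed simp
  let ?p = "emeasure unif01 {u. ?a + (?b - ?a) * u < h}"
  have slice: "AE u in unif01. u \<in> {u. dtrans M x u < h} \<longleftrightarrow> u \<in> (if x < ?q then UNIV else if x = ?q then {u. ?a + (?b - ?a) * u < h} else {})" for x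
    using AE_unif01
  proof eventually_elim
    case (elim u)
    then have b: "measure M {..<x} \<le> dtrans M x u" "dtrans M x u \<le> cdf M x"
      using dtrans_bounds by auto
    consider "x < ?q" | "x = ?q" | "?q < x" by linarith
    then show ?case
    proof cases
      case 1
      then have "cdf M x < h" using quantile_le_iff[OF h, of x] by auto
      then show ?thesis using 1 b by simp
    next
      case 3
      then have "h \<le> measure M {..<x}" using cdf_le_measure_lessThan[OF 3] hb by linarith
      then show ?thesis using 3 b by simp
    qed (simp add: dtrans_def)
  qed
  have "emeasure MU {z \<in> space MU. dtrans M (fst z) (snd z) < h}
      = (\<integral>\<^sup>+ x. emeasure unif01 {u. dtrans M x u < h} \<partial>M)"
    by (subst U.emeasure_pair_measure_alt[OF sets_dtrans(1)])
      (auto intro!: nn_integral_cong arg_cong2[where f = emeasure] simp: space_pair_measure borel_UNIV)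
  also have "\<dots> = (\<integral>\<^sup>+ x. indicator {..<?q} x + ?p * indicator {?q} x \<partial>M)"
  proof (rule nn_integral_cong)
    fix x
    have "emeasure unif01 {u. dtrans M x u < h}
      = emeasure unif01 (if x < ?q then UNIV else if x = ?q then {u. ?a + (?b - ?a) * u < h} else {})"
      by (rule emeasure_eq_AE[OF slice]) auto
    also have "\<dots> = indicator {..<?q} x + ?p * indicator {?q} x"
      using U.emeasure_space_1 by (auto split: split_indicator)
    finally show "emeasure unif01 {u. dtrans M x u < h} = indicator {..<?q} x + ?p * indicator {?q} x" .
  qed
  also have "\<dots> = emeasure M {..<?q} + ?p * emeasure M {?q}"
    by (subst nn_integral_add) (auto simp: nn_integral_cmult_indicator)
  also have "emeasure M {?q} = ennreal (?b - ?a)"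
  proof -
    have "{..?q} = {..<?q} \<union> {?q}" by auto
    then have "?b = ?a + measure M {?q}"
      unfolding cdf_def by (simp only:) (rule finite_measure_Union; simp)
    then show ?thesis by (simp add: emeasure_eq_measure)
  qed
  also have "?p * ennreal (?b - ?a) = ennreal (h - ?a)"
  \<comment> \<open>Without an atom, \<open>?a \<le> h \<le> ?b\<close> forces
    \<open>?a = h = ?b\<close>, and both sides vanish.\<close>
  proof (cases "?a = ?b")
    case True
    then show ?thesis using ah hb by simp
  next
    case False
    then have ab: "?a < ?b" using ah hb by simp
    have "{0..1} \<inter> {u. ?a + (?b - ?a) * u < h} = {0..<(h - ?a) / (?b - ?a)}"
    proof (intro set_eqI)
      fix u
      have lt: "?a + (?b - ?a) * u < h \<longleftrightarrow> u < (h - ?a) / (?b - ?a)"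
        using ab by (simp add: pos_less_divide_eq mult.commute less_diff_eq add.commute)
      have "(h - ?a) / (?b - ?a) \<le> 1" using ab hb by simp
      then show "u \<in> {0..1} \<inter> {u. ?a + (?b - ?a) * u < h} \<longleftrightarrow> u \<in> {0..<(h - ?a) / (?b - ?a)}"
        unfolding Int_iff mem_Collect_eq lt by auto
    qed
    then have "?p = ennreal ((h - ?a) / (?b - ?a))"
      using ah ab by (subst emeasure_uniform_measure) (auto simp: divide_ennreal_def)
    then show ?thesis using ah ab by (simp flip: ennreal_mult'')
  qed
  also have "emeasure M {..<?q} + ennreal (h - ?a) = ennreal h"
    using ah by (simp add: emeasure_eq_measure flip: ennreal_plus)
  finally show ?thesis .
qed

lemma distr_dtrans:
  "distr MU borel (\<lambda>z. dtrans M (fst z) (snd z)) = leb_upto (measure M UNIV)"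
proof (rule measure_eqI_lessThan')
  interpret U: prob_space unif01 by (rule prob_space_unif01)
  interpret prod: pair_sigma_finite M unif01 ..
  note [measurable_cong] = M_is_borel
  let ?c = "measure M UNIV"
  let ?P = "MU"
  let ?V = "\<lambda>z. dtrans M (fst z) (snd z)"
  have mass: "emeasure ?P (space ?P) = ennreal ?c"
    unfolding space_pair_measure
    using U.emeasure_space_1 by (subst U.emeasure_pair_measure_Times) (auto simp: borel_UNIV emeasure_eq_measure)
  have dis: "emeasure (distr ?P borel ?V) {..<x} = emeasure ?P {z \<in> space ?P. ?V z < x}" for x
    by (subst emeasure_distr) (auto intro!: arg_cong2[where f = emeasure])
  have le: "emeasure ?P A \<le> ennreal ?c" for A
    using emeasure_space[of ?P A] unfolding mass .
  show "emeasure (distr ?P borel ?V) {..<x} \<noteq> \<infinity>" for x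
    using le[of "{z \<in> space ?P. ?V z < x}"] unfolding dis by (auto simp: top_unique)
  show "emeasure (distr ?P borel ?V) {..<x} = emeasure (leb_upto ?c) {..<x}" for x
  proof -
    consider "x \<le> 0" | "0 < x" "x < ?c" | "0 < x" "?c \<le> x" by linarith
    then show ?thesis
    proof cases
      case 1
      have "AE u in unif01. \<not> dtrans M y u < x" for y
        using AE_unif01
      proof eventually_elim
        case (elim u)
        then show ?case using dtrans_bounds(1)[of u y] measure_nonneg[of M "{..<y}"] 1 by linarith
      qed
      then have "AE z in ?P. \<not> ?V z < x"
        by (intro prod.AE_pair_measure sets_dtrans(2)) simp
      then have "emeasure ?P {z \<in> space ?P. ?V z < x} = 0"
        by (intro emeasure_eq_0_AE) auto
      moreover have "{0<..<?c} \<inter> {..<x} = {}" using 1 by auto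
      ultimately show ?thesis by (simp add: dis emeasure_leb_upto)
    next
      case 2
      then have "{0<..<?c} \<inter> {..<x} = {0<..<x}" by auto
      then show ?thesis unfolding dis using emeasure_dtrans_less[OF 2] 2 by (simp add: emeasure_leb_upto)
    next
      case 3
      then have "{0<..<?c} \<inter> {..<x} = {0<..<?c}" by auto
      then have "emeasure (leb_upto ?c) {..<x} = ennreal ?c" by (simp add: emeasure_leb_upto)
      \<comment> \<open>\<open>emeasure_dtrans_less\<close> stops short of the total mass, so the
        full mass is reached through the levels \<open>?c - e\<close>.\<close>
      moreover have "ennreal ?c \<le> emeasure ?P {z \<in> space ?P. ?V z < x}"
      proof (rule ennreal_le_epsilon)
        fix e :: real assume e: "0 < e"
        show "ennreal ?c \<le> emeasure ?P {z \<in> space ?P. ?V z < x} + ennreal e"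
        proof (cases "e < ?c")
          case True
          have "ennreal ?c = ennreal (?c - e) + ennreal e"
            using True e by (simp flip: ennreal_plus)
          also have "ennreal (?c - e) = emeasure ?P {z \<in> space ?P. ?V z < ?c - e}"
            using True e by (intro emeasure_dtrans_less[symmetric]) auto
          also have "\<dots> \<le> emeasure ?P {z \<in> space ?P. ?V z < x}"
            using 3 e by (intro emeasure_mono[OF _ sets_dtrans(1)]) auto
          finally show ?thesis by simp
        next
          case False
          then have "ennreal ?c \<le> ennreal e" by (intro ennreal_leI) simp
          then show ?thesis by (rule add_increasing[rotated]) simp
        qed
      qed
      ultimately show ?thesis unfolding dis using le by (intro antisym) auto
    qed
  qed
qed simp_all

text \<open>Almost no point is the right end of a flat piece of the distribution function with no
  jump at that end. Quantiles show this: if \<open>r < quantile M h\<close> then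
  \<open>cdf M r < h\<close>, while \<open>h\<close> is at most the value at the quantile. Rational
  \<open>r\<close> keep the predicate measurable.\<close>

lemma AE_cdf_strict: "AE x in M. \<forall>r::rat. of_rat r < x \<longrightarrow> cdf M (of_rat r) < cdf M x"
proof -
  let ?c = "measure M UNIV"
  have "AE h in leb_upto ?c. \<forall>r::rat. of_rat r < quantile M h \<longrightarrow> cdf M (of_rat r) < cdf M (quantile M h)"
    using AE_leb_upto[of ?c]
  proof eventually_elim
    case (elim h)
    have "h \<le> cdf M (quantile M h)" using quantile_le_iff[of h] elim by auto
    moreover have "cdf M (of_rat r) < h" if "of_rat r < quantile M h" for r
      using quantile_le_iff[of h "of_rat r"] elim that by auto
    ultimately show ?case by (auto intro: less_le_trans)
  qed
  then have "AE x in distr (leb_upto ?c) borel (quantile M). \<forall>r::rat. of_rat r < x \<longrightarrow> cdf M (of_rat r) < cdf M x"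
  proof (subst AE_distr_iff)
    have "Measurable.pred borel (\<lambda>x. \<forall>r::rat. of_rat r < x \<longrightarrow> cdf M (of_rat r) < cdf M x)"
      by measurable
    then show "{x \<in> space borel. \<forall>r::rat. of_rat r < x \<longrightarrow> cdf M (of_rat r) < cdf M x} \<in> sets borel"
      by (simp add: pred_def)
  qed simp_all
  then show ?thesis by (simp only: distr_quantile)
qed

text \<open>The transform determines the point from which it was computed, except for
  \<open>u = 0\<close> and for right ends of flat pieces, both negligible.\<close>

lemma AE_quantile_dtrans:
  "AE z in MU. 0 < dtrans M (fst z) (snd z) \<and> dtrans M (fst z) (snd z) < measure M UNIV
    \<and> quantile M (dtrans M (fst z) (snd z)) = fst z"
proof -
  interpret U: prob_space unif01 by (rule prob_space_unif01)
  interpret prod: pair_sigma_finite M unif01 ..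
  note [measurable_cong] = M_is_borel
  let ?c = "measure M UNIV"
  let ?V = "\<lambda>z. dtrans M (fst z) (snd z)"
  have "AE z in distr MU borel ?V. 0 < z \<and> z < ?c"
    unfolding distr_dtrans by (rule AE_leb_upto)
  then have range: "AE z in MU. 0 < ?V z \<and> ?V z < ?c"
    by (subst (asm) AE_distr_iff) auto
  have good: "AE z in MU. (\<forall>r::rat. of_rat r < fst z \<longrightarrow> cdf M (of_rat r) < cdf M (fst z))
      \<and> 0 < snd z \<and> snd z \<le> 1"
  proof (rule prod.AE_pair_measure)
    show "{z \<in> space MU. (\<forall>r::rat. of_rat r < fst z \<longrightarrow> cdf M (of_rat r) < cdf M (fst z))
        \<and> 0 < snd z \<and> snd z \<le> 1} \<in> sets MU"
    proof -
      have [measurable]: "fst \<in> borel_measurable MU"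
        using measurable_fst[of M unif01] measurable_cong_sets[OF refl M_is_borel] by blast
      have [measurable]: "snd \<in> borel_measurable MU"
        using measurable_snd[of M unif01] by simp
      show ?thesis by measurable
    qed
    show "AE x in M. AE u in unif01.
      (\<forall>r::rat. of_rat r < fst (x, u) \<longrightarrow> cdf M (of_rat r) < cdf M (fst (x, u)))
        \<and> 0 < snd (x, u) \<and> snd (x, u) \<le> 1"
      using AE_cdf_strict
    proof eventually_elim
      case (elim x)
      show ?case using AE_unif01 by eventually_elim (use elim in simp)
    qed
  qed
  from range good show ?thesis
  proof eventually_elim
    case (elim z)
    obtain x u where z: "z = (x, u)" by force
    let ?v = "dtrans M x u"
    have u: "0 < u" "u \<le> 1" and v: "0 < ?v" "?v < ?c"
      and strict: "\<And>r::rat. of_rat r < x \<Longrightarrow> cdf M (of_rat r) < cdf M x"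
      using elim by (auto simp: z)
    \<comment> \<open>For \<open>y < x\<close> the value \<open>?v\<close> exceeds
      \<open>cdf M y\<close> for one of two reasons: at a jump because \<open>u > 0\<close> lifts it
      above the left limit, and otherwise because \<open>cdf M\<close> has strictly increased on the
      way to \<open>x\<close>.\<close>
    have iff: "?v \<le> cdf M y \<longleftrightarrow> x \<le> y" for y
    proof
      assume "x \<le> y"
      then show "?v \<le> cdf M y"
        using dtrans_bounds(2)[of u x] u cdf_nondecreasing[of x y] by linarith
    next
      assume vy: "?v \<le> cdf M y"
      show "x \<le> y"
      proof (rule ccontr)
        assume "\<not> x \<le> y"
        then obtain r :: rat where r: "y < of_rat r" "of_rat r < x"
          using of_rat_dense[of y x] by auto
        have 1: "cdf M y < cdf M x"
          using cdf_nondecreasing[of y "of_rat r"] strict[OF r(2)] r by linarith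
        have 2: "cdf M y \<le> measure M {..<x}"
          using r by (intro cdf_le_measure_lessThan) simp
        show False
        proof (cases "measure M {..<x} < cdf M x")
          case True
          then have "measure M {..<x} < ?v" using u by (simp add: dtrans_def)
          then show False using vy 2 by linarith
        next
          case False
          then show False using vy 1 dtrans_bounds(1)[of u x] u by linarith
        qed
      qed
    qed
    have "quantile M ?v = x"
      using quantile_le_iff[OF v, of x] iff[of x]
        quantile_le_iff[OF v, of "quantile M ?v"] iff[of "quantile M ?v"] by simp
    then show ?case using v by (simp add: z)
  qed
qed

text \<open>Almost everywhere the point is the quantile of its transform, so the pair is a function
  of the transform alone, whose law is known.\<close>

lemma nn_integral_dtrans:
  assumes [measurable]: "f \<in> borel_measurable borel"
  shows "(\<integral>\<^sup>+ z. f (fst z, dtrans M (fst z) (snd z)) \<partial>MU)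
    = (\<integral>\<^sup>+ h. f (quantile M h, h) \<partial>leb_upto (measure M UNIV))"
proof -
  note [measurable_cong] = M_is_borel
  let ?V = "\<lambda>z. dtrans M (fst z) (snd z)"
  have "(\<integral>\<^sup>+ z. f (fst z, ?V z) \<partial>MU) = (\<integral>\<^sup>+ z. f (quantile M (?V z), ?V z) \<partial>MU)"
    using AE_quantile_dtrans by (intro nn_integral_cong_AE) auto
  also have "\<dots> = (\<integral>\<^sup>+ h. f (quantile M h, h) \<partial>distr MU borel ?V)"
    by (subst nn_integral_distr) measurable
  finally show ?thesis by (simp only: distr_dtrans)
qed

end

section \<open>The reciprocating function in terms of quantiles\<close>

text \<open>\<open>ennreal\<close> truncates negative numbers to \<open>0\<close>, so the density is \<open>x\<^sup>+\<close>.\<close>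
definition pos_part :: "real measure \<Rightarrow> real measure" where
  "pos_part \<mu> = density \<mu> ennreal"

text \<open>Everything on the negative half-line is reduced to the positive half-line of the
  reflected law.\<close>

definition reflect :: "real measure \<Rightarrow> real measure" where
  "reflect \<mu> = distr \<mu> borel uminus"

locale integrable_law =
  fixes \<mu> :: "real measure"
  assumes sets_law [measurable_cong]: "sets \<mu> = sets borel"
    and integrable_law: "integrable \<mu> (\<lambda>x. x)"
begin

abbreviation "pp \<equiv> pos_part \<mu>"

abbreviation "recip x u \<equiv> real_of_ereal (reciprocating \<mu> (ereal x) u)"

lemma sets_pp [simp, measurable_cong]: "sets pp = sets borel"
  by (simp add: pos_part_def sets_law)

lemma emeasure_pp: "A \<in> sets borel \<Longrightarrow> emeasure pp A = (\<integral>\<^sup>+ x. ennreal x * indicator A x \<partial>\<mu>)"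
  unfolding pos_part_def by (subst emeasure_density) (auto simp: sets_law)

sublocale pp: finite_borel_measure pp
  unfolding finite_borel_measure_def finite_borel_measure_axioms_def
proof (intro conjI finite_measureI)
  have "emeasure pp (space pp) \<le> (\<integral>\<^sup>+ x. ennreal (norm x) \<partial>\<mu>)"
    unfolding pos_part_def
    by (subst emeasure_density) (auto intro!: nn_integral_mono ennreal_leI split: split_indicator)
  also have "\<dots> < \<infinity>" using integrable_law by (simp add: integrable_iff_bounded)
  finally show "emeasure pp (space pp) \<noteq> \<infinity>" by simp
qed simp

lemma cdf_pp_nonpos: "x \<le> 0 \<Longrightarrow> cdf pp x = 0"
proof -
  assume "x \<le> 0"
  then have "ennreal z * indicator {..x} z = 0" for z
    by (auto split: split_indicator simp: ennreal_neg)
  then have "(\<integral>\<^sup>+ z. ennreal z * indicator {..x} z \<partial>\<mu>) = (\<integral>\<^sup>+ z. 0 \<partial>\<mu>)"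
    by (simp only:)
  then have "emeasure pp {..x} = 0"
    by (simp only: emeasure_pp[OF atMost_borel] nn_integral_const mult_zero_left)
  then show ?thesis by (simp add: cdf_def measure_def)
qed

lemma G_fun_eq_cdf: "0 \<le> x \<Longrightarrow> G_fun \<mu> (ereal x) = cdf pp x"
proof -
  assume x: "0 \<le> x"
  let ?S = "{z. 0 < z \<and> ereal z \<le> ereal x}"
  have "G_fun \<mu> (ereal x) = (\<integral>z. indicator ?S z * z \<partial>\<mu>)"
    using x by (simp add: G_fun_def set_lebesgue_integral_def)
  also have "\<dots> = enn2real (\<integral>\<^sup>+z. ennreal (indicator ?S z * z) \<partial>\<mu>)"
    by (rule integral_eq_nn_integral) (auto split: split_indicator)
  also have "(\<integral>\<^sup>+z. ennreal (indicator ?S z * z) \<partial>\<mu>) = emeasure pp {..x}"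
    by (subst emeasure_pp) (auto intro!: nn_integral_cong split: split_indicator simp: ennreal_neg)
  finally show ?thesis by (simp add: cdf_def measure_def)
qed

text \<open>For \<open>x > 0\<close> the filter on the extended line is the image of the real one,
  and near \<open>x\<close> only the first branch of \<open>G_fun\<close> is involved.\<close>

lemma Lim_at_left_G_fun:
  assumes "0 < x"
  shows "Lim (at_left (ereal x)) (G_fun \<mu>) = measure pp {..<x}"
proof (rule tendsto_Lim)
  have "\<forall>\<^sub>F y in at_left x. cdf pp y = G_fun \<mu> (ereal y)"
    using eventually_at_left[OF assms] assms
    by (intro eventually_at_leftI[of 0 x]) (auto simp: G_fun_eq_cdf)
  then have "((\<lambda>y. G_fun \<mu> (ereal y)) \<longlongrightarrow> measure pp {..<x}) (at_left x)"
    using pp.cdf_at_left[of x] by (simp add: tendsto_cong)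
  then show "(G_fun \<mu> \<longlongrightarrow> measure pp {..<x}) (at_left (ereal x))"
    by (simp add: at_left_ereal filterlim_filtermap)
qed (simp add: at_left_ereal filtermap_bot_iff)

lemma G_tilde_eq_dtrans: "0 < x \<Longrightarrow> G_tilde \<mu> (ereal x) u = dtrans pp x u"
  using Lim_at_left_G_fun[of x] by (simp add: G_tilde_def dtrans_def G_fun_eq_cdf)

lemma quantile_pp_pos: "0 < h \<Longrightarrow> h < measure pp UNIV \<Longrightarrow> 0 < quantile pp h"
  using pp.quantile_le_iff[of h 0] cdf_pp_nonpos[of 0] by auto

text \<open>Taking the infimum over nonnegative points only changes nothing, because
  \<open>pp\<close> has no mass on the nonpositive half-line and its quantiles are positive; the
  infimum is attained at a finite point.\<close>

lemma x_plus_eq_quantile: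
  assumes h: "0 < h" "h < measure pp UNIV"
  shows "x_plus \<mu> h = ereal (quantile pp h)"
  unfolding x_plus_def
proof (rule Inf_eqI)
  fix x assume "x \<in> {x. 0 \<le> x \<and> h \<le> G_fun \<mu> x}"
  then have x: "0 \<le> x" "h \<le> G_fun \<mu> x" by auto
  show "ereal (quantile pp h) \<le> x"
  proof (cases x)
    case (real y)
    then have "h \<le> cdf pp y" using x G_fun_eq_cdf[of y] by simp
    then show ?thesis using pp.quantile_le_iff[OF h, of y] real by simp
  qed (use x in auto)
next
  fix y assume "\<And>x. x \<in> {x. 0 \<le> x \<and> h \<le> G_fun \<mu> x} \<Longrightarrow> y \<le> x"
  moreover have "ereal (quantile pp h) \<in> {x. 0 \<le> x \<and> h \<le> G_fun \<mu> x}"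
    using quantile_pp_pos[OF h] pp.quantile_le_iff[OF h, of "quantile pp h"] by (simp add: G_fun_eq_cdf)
  ultimately show "y \<le> ereal (quantile pp h)" by blast
qed

section \<open>Reflection to the negative half-line\<close>

lemma integrable_law_reflect: "integrable_law (reflect \<mu>)"
proof
  show "integrable (reflect \<mu>) (\<lambda>x. x)"
    unfolding reflect_def by (subst integrable_distr_eq) (auto intro: integrable_law)
qed (simp add: reflect_def)

lemma G_fun_reflect:
  assumes "0 \<le> x"
  shows "G_fun (reflect \<mu>) x = G_fun \<mu> (- x)"
\<comment> \<open>At 0 both sides fall under the first branch of \<open>G_fun\<close>, so the change
  of variables covers only \<open>x > 0\<close>.\<close>
proof (cases "x = 0")
  case True
  moreover have "{z::real. 0 < z \<and> z \<le> 0} = {}" by auto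
  ultimately show ?thesis by (simp add: G_fun_def set_lebesgue_integral_def)
next
  case False
  then have neg: "\<not> 0 \<le> - x" using assms by (auto simp: ereal_uminus_le_reorder)
  let ?S = "{z. 0 < z \<and> ereal z \<le> x}"
  have [measurable]: "?S \<in> sets borel"
  proof -
    have "?S = {z \<in> space borel. 0 < z \<and> ereal z \<le> x}" by simp
    also have "\<dots> \<in> sets borel" by measurable
    finally show ?thesis .
  qed
  have "G_fun (reflect \<mu>) x = (\<integral>z. indicator ?S z * z \<partial>distr \<mu> borel uminus)"
    using assms by (simp add: G_fun_def set_lebesgue_integral_def reflect_def)
  also have "\<dots> = (\<integral>z. indicator ?S (- z) * (- z) \<partial>\<mu>)"
    by (rule integral_distr) measurable
  also have "\<dots> = (\<integral>z. indicator {z. - x \<le> ereal z \<and> z < 0} z * (- z) \<partial>\<mu>)"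
  proof (rule Bochner_Integration.integral_cong)
    fix z
    have "ereal (- z) \<le> x \<longleftrightarrow> - x \<le> ereal z"
      by (metis ereal_uminus_le_reorder uminus_ereal.simps(1))
    then show "indicator ?S (- z) * (- z) = indicator {z. - x \<le> ereal z \<and> z < 0} z * (- z)"
      by (auto split: split_indicator)
  qed simp
  also have "\<dots> = G_fun \<mu> (- x)"
    using neg by (simp add: G_fun_def set_lebesgue_integral_def)
  finally show ?thesis .
qed

lemma x_minus_reflect: "x_minus \<mu> h = - x_plus (reflect \<mu>) h"
proof -
  have "{x. x \<le> 0 \<and> G_fun \<mu> x \<ge> h} = uminus ` {x. 0 \<le> x \<and> G_fun (reflect \<mu>) x \<ge> h}"
  proof (intro set_eqI iffI)
    fix x assume "x \<in> {x. x \<le> 0 \<and> G_fun \<mu> x \<ge> h}"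
    then have "- x \<in> {x. 0 \<le> x \<and> G_fun (reflect \<mu>) x \<ge> h}"
      using G_fun_reflect[of "- x"] by (auto simp: ereal_uminus_le_reorder ereal_0_le_uminus_iff)
    then show "x \<in> uminus ` {x. 0 \<le> x \<and> G_fun (reflect \<mu>) x \<ge> h}"
      by (metis ereal_uminus_uminus imageI)
  next
    fix x assume "x \<in> uminus ` {x. 0 \<le> x \<and> G_fun (reflect \<mu>) x \<ge> h}"
    then show "x \<in> {x. x \<le> 0 \<and> G_fun \<mu> x \<ge> h}"
      using G_fun_reflect by auto
  qed
  then show ?thesis
    unfolding x_minus_def x_plus_def by (simp add: ereal_Sup_uminus_image_eq)
qed

lemma G_tilde_reflect:
  assumes "0 < x"
  shows "G_tilde \<mu> (ereal (- x)) u = dtrans (pos_part (reflect \<mu>)) x u"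
proof -
  interpret R: integrable_law "reflect \<mu>" by (rule integrable_law_reflect)
  have "((\<lambda>y. G_fun (reflect \<mu>) (ereal y)) \<longlongrightarrow> measure R.pp {..<x}) (at_left x)"
  proof -
    have "\<forall>\<^sub>F y in at_left x. cdf R.pp y = G_fun (reflect \<mu>) (ereal y)"
      using assms by (intro eventually_at_leftI[of 0 x]) (auto simp: R.G_fun_eq_cdf)
    then show ?thesis using R.pp.cdf_at_left[of x] by (simp add: tendsto_cong)
  qed
  then have "((\<lambda>y. G_fun (reflect \<mu>) (ereal (- y))) \<longlongrightarrow> measure R.pp {..<x}) (at_right (- x))"
    by (simp add: filterlim_at_left_to_right)
  moreover have "\<forall>\<^sub>F y in at_right (- x). G_fun (reflect \<mu>) (ereal (- y)) = G_fun \<mu> (ereal y)"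
    using assms by (intro eventually_at_rightI[of "- x" 0]) (auto simp: G_fun_reflect)
  ultimately have "((\<lambda>y. G_fun \<mu> (ereal y)) \<longlongrightarrow> measure R.pp {..<x}) (at_right (- x))"
    by (simp add: tendsto_cong)
  then have "(G_fun \<mu> \<longlongrightarrow> measure R.pp {..<x}) (at_right (ereal (- x)))"
    by (simp add: at_right_ereal filterlim_filtermap)
  then have "Lim (at_right (ereal (- x))) (G_fun \<mu>) = measure R.pp {..<x}"
    by (intro tendsto_Lim) (simp_all add: at_right_ereal filtermap_bot_iff)
  moreover have "G_fun \<mu> (ereal (- x)) = cdf R.pp x"
    using G_fun_reflect[of "ereal x"] R.G_fun_eq_cdf[of x] assms by simp
  ultimately show ?thesis using assms by (simp add: G_tilde_def dtrans_def)
qed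

text \<open>The transform is taken in the law of one side and the quantile in the law of the other.
  The upper bound therefore refers to the mass of the other side; for a centred variable the two
  masses agree.\<close>

lemma reciprocating_pos:
  assumes x: "0 < x" and V: "0 < dtrans pp x u" "dtrans pp x u < measure (pos_part (reflect \<mu>)) UNIV"
  shows "recip x u = - quantile (pos_part (reflect \<mu>)) (dtrans pp x u)"
proof -
  have "x_plus (reflect \<mu>) (dtrans pp x u) = ereal (quantile (pos_part (reflect \<mu>)) (dtrans pp x u))"
    by (rule integrable_law.x_plus_eq_quantile[OF integrable_law_reflect V])
  moreover have "reciprocating \<mu> (ereal x) u = - x_plus (reflect \<mu>) (dtrans pp x u)"
    using x by (simp add: reciprocating_def G_tilde_eq_dtrans x_minus_reflect)
  ultimately show ?thesis by simp
qed

lemma reciprocating_neg: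
  assumes x: "0 < x" and V: "0 < dtrans (pos_part (reflect \<mu>)) x u"
    "dtrans (pos_part (reflect \<mu>)) x u < measure pp UNIV"
  shows "recip (- x) u = quantile pp (dtrans (pos_part (reflect \<mu>)) x u)"
proof -
  have "\<not> 0 \<le> ereal (- x)" using x by simp
  then have "reciprocating \<mu> (ereal (- x)) u = x_plus \<mu> (dtrans (pos_part (reflect \<mu>)) x u)"
    unfolding reciprocating_def G_tilde_reflect[OF x] by (rule if_not_P)
  then show ?thesis using x_plus_eq_quantile[OF V] by simp
qed

end

section \<open>Laws of the reciprocated pairs\<close>

text \<open>A law for maps that agree with a measurable map only almost everywhere. The reciprocated
  variables are identified with quantiles only up to null sets, so \<open>distr\<close> is applied
  to the measurable version.\<close>

definition law_ae :: "'a measure \<Rightarrow> ('a \<Rightarrow> real \<times> real) \<Rightarrow> plane_measure \<Rightarrow> bool" where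
  "law_ae M Z Q \<longleftrightarrow>
     (\<exists>Z' \<in> borel_measurable M. (AE w in M. Z w = Z' w) \<and> distr M borel Z' = Q)"

lemma law_ae_AE:
  assumes "law_ae M Z Q" "AE z in Q. z \<in> D" and [measurable]: "D \<in> sets borel"
  shows "AE w in M. Z w \<in> D"
proof -
  obtain Z' where [measurable]: "Z' \<in> borel_measurable M" and Z': "AE w in M. Z w = Z' w" "distr M borel Z' = Q"
    using assms(1) by (auto simp: law_ae_def)
  have "AE w in M. Z' w \<in> D"
    using assms(2) unfolding Z'(2)[symmetric] by (subst (asm) AE_distr_iff) auto
  with Z'(1) show ?thesis by eventually_elim simp
qed

lemma law_ae_nn_integral:
  fixes f :: "real \<times> real \<Rightarrow> ennreal"
  assumes "law_ae M Z Q" and D: "AE z in Q. z \<in> D" and [measurable]: "D \<in> sets borel"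
    and [measurable]: "(\<lambda>z. indicator D z * f z) \<in> borel_measurable borel"
  shows "(\<integral>\<^sup>+ w. f (Z w) \<partial>M) = (\<integral>\<^sup>+ z. f z \<partial>Q)"
proof -
  obtain Z' where [measurable]: "Z' \<in> borel_measurable M" and Z': "AE w in M. Z w = Z' w" "distr M borel Z' = Q"
    using assms(1) by (auto simp: law_ae_def)
  have "(\<integral>\<^sup>+ w. f (Z w) \<partial>M) = (\<integral>\<^sup>+ w. indicator D (Z' w) * f (Z' w) \<partial>M)"
  proof (rule nn_integral_cong_AE)
    show "AE w in M. f (Z w) = indicator D (Z' w) * f (Z' w)"
      using Z'(1) law_ae_AE[OF assms(1-3)] by eventually_elim simp
  qed
  also have "\<dots> = (\<integral>\<^sup>+ z. indicator D z * f z \<partial>Q)"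
    unfolding Z'(2)[symmetric] by (subst nn_integral_distr) auto
  also have "\<dots> = (\<integral>\<^sup>+ z. f z \<partial>Q)"
  proof (rule nn_integral_cong_AE)
    show "AE z in Q. indicator D z * f z = f z"
      using D by eventually_elim simp
  qed
  finally show ?thesis .
qed

lemma emeasure_distr_eq_nn_integral:
  assumes [measurable]: "g \<in> M \<rightarrow>\<^sub>M N" "A \<in> sets N"
  shows "emeasure (distr M N g) A = (\<integral>\<^sup>+ x. indicator A (g x) \<partial>M)"
proof -
  have "emeasure (distr M N g) A = (\<integral>\<^sup>+ y. indicator A y \<partial>distr M N g)" by simp
  also have "\<dots> = (\<integral>\<^sup>+ x. indicator A (g x) \<partial>M)" by (rule nn_integral_distr) measurable
  finally show ?thesis .
qed

lemma uniform_measure_eq_scale: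
  assumes "0 < m"
  shows "uniform_measure lborel {0..m} = scale_measure (ennreal (1 / m)) (leb_upto m)"
proof (rule measure_eqI)
  fix A assume "A \<in> sets (uniform_measure lborel {0..m})"
  then have [measurable]: "A \<in> sets borel" by simp
  have "AE x in lborel. x \<in> {0..m} \<inter> A \<longleftrightarrow> x \<in> {0<..<m} \<inter> A"
    using AE_lborel_singleton[of "0::real"] AE_lborel_singleton[of m] by eventually_elim auto
  then have "emeasure lborel ({0..m} \<inter> A) = emeasure lborel ({0<..<m} \<inter> A)"
    by (rule emeasure_eq_AE) auto
  then show "emeasure (uniform_measure lborel {0..m}) A = emeasure (scale_measure (ennreal (1 / m)) (leb_upto m)) A"
    using assms by (simp add: emeasure_leb_upto divide_ennreal_def inverse_ennreal inverse_eq_divide mult.commute)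
qed (simp add: leb_upto_def)

lemma distr_scale_measure:
  assumes f: "f \<in> M \<rightarrow>\<^sub>M N"
  shows "distr (scale_measure r M) N f = scale_measure r (distr M N f)"
proof (rule measure_eqI)
  fix A assume "A \<in> sets (distr (scale_measure r M) N f)"
  moreover have "f \<in> scale_measure r M \<rightarrow>\<^sub>M N"
    using f by (simp add: measurable_cong_sets[OF sets_scale_measure refl])
  ultimately show "emeasure (distr (scale_measure r M) N f) A = emeasure (scale_measure r (distr M N f)) A"
    using f by (simp add: emeasure_distr space_scale_measure)
qed simp

text \<open>The law of \<open>(Y, U)\<close> on \<open>M\<close> is only tested against integrals, so that \<open>M\<close> may be a restriction of a probability space.\<close>
lemma distributional_transform:
  fixes Y U :: "'a \<Rightarrow> real"
  assumes F: "finite_borel_measure F" and F': "finite_borel_measure F'"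
    and [measurable]: "Y \<in> borel_measurable M" "U \<in> borel_measurable M"
    and law: "\<And>f :: real \<times> real \<Rightarrow> ennreal. f \<in> borel_measurable borel \<Longrightarrow>
      (\<integral>\<^sup>+ w. f (Y w, U w) \<partial>M) = a * (\<integral>\<^sup>+ z. f z \<partial>(F \<Otimes>\<^sub>M unif01))"
  shows "distr M borel (\<lambda>w. (Y w, quantile F' (dtrans F (Y w) (U w))))
      = scale_measure a (distr (leb_upto (measure F UNIV)) borel (\<lambda>h. (quantile F h, quantile F' h)))" (is ?law)
    and "AE w in M. 0 < dtrans F (Y w) (U w) \<and> dtrans F (Y w) (U w) < measure F UNIV
      \<and> quantile F (dtrans F (Y w) (U w)) = Y w" (is ?range)
proof -
  interpret F: finite_borel_measure F by fact
  interpret F': finite_borel_measure F' by fact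
  let ?V = "\<lambda>w. dtrans F (Y w) (U w)"
  show ?law
  proof (rule measure_eqI)
    fix A assume "A \<in> sets (distr M borel (\<lambda>w. (Y w, quantile F' (?V w))))"
    then have [measurable]: "A \<in> sets borel" by simp
    have "emeasure (distr M borel (\<lambda>w. (Y w, quantile F' (?V w)))) A
        = (\<integral>\<^sup>+ w. indicator A (Y w, quantile F' (?V w)) \<partial>M)"
      by (rule emeasure_distr_eq_nn_integral) measurable
    also have "\<dots> = a * (\<integral>\<^sup>+ z. indicator A (fst z, quantile F' (dtrans F (fst z) (snd z))) \<partial>(F \<Otimes>\<^sub>M unif01))"
      using law[of "\<lambda>z. indicator A (fst z, quantile F' (dtrans F (fst z) (snd z)))"] by simp
    also have "\<dots> = a * (\<integral>\<^sup>+ h. indicator A (quantile F h, quantile F' h) \<partial>leb_upto (measure F UNIV))"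
      using F.nn_integral_dtrans[of "\<lambda>z. indicator A (fst z, quantile F' (snd z))"] by simp
    also have "\<dots> = a * emeasure (distr (leb_upto (measure F UNIV)) borel (\<lambda>h. (quantile F h, quantile F' h))) A"
      by (subst emeasure_distr_eq_nn_integral) auto
    finally show "emeasure (distr M borel (\<lambda>w. (Y w, quantile F' (?V w)))) A
        = emeasure (scale_measure a (distr (leb_upto (measure F UNIV)) borel (\<lambda>h. (quantile F h, quantile F' h)))) A"
      by simp
  qed simp
  \<comment> \<open>Since \<open>law\<close> speaks of integrals, the almost sure statement is
    transferred by integrating the indicator of its exceptional set.\<close>
  let ?bad = "{z :: real \<times> real. \<not> (0 < dtrans F (fst z) (snd z) \<and> dtrans F (fst z) (snd z) < measure F UNIV
      \<and> quantile F (dtrans F (fst z) (snd z)) = fst z)}"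
  have [measurable]: "?bad \<in> sets borel"
  proof -
    have "?bad = {z \<in> space borel. \<not> (0 < dtrans F (fst z) (snd z) \<and> dtrans F (fst z) (snd z) < measure F UNIV
      \<and> quantile F (dtrans F (fst z) (snd z)) = fst z)}" by simp
    also have "\<dots> \<in> sets borel" by measurable
    finally show ?thesis .
  qed
  have "(\<integral>\<^sup>+ z. indicator ?bad z \<partial>(F \<Otimes>\<^sub>M unif01)) = (\<integral>\<^sup>+ z. 0 \<partial>(F \<Otimes>\<^sub>M unif01))"
    using F.AE_quantile_dtrans by (intro nn_integral_cong_AE) (auto split: split_indicator)
  then have "(\<integral>\<^sup>+ w. indicator ?bad (Y w, U w) \<partial>M) = 0"
    using law[of "indicator ?bad"] by simp
  then have "AE w in M. indicator ?bad (Y w, U w) = (0 :: ennreal)"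
    by (subst (asm) nn_integral_0_iff_AE) auto
  then show ?range by eventually_elim (auto split: split_indicator_asm)
qed

text \<open>The set \<open>B\<close> is the whole line for the one-sided variables. For
  \<open>Y\<close> and \<open>- Y\<close> it is the positive half-line, because their laws are
  multiples of \<open>pp\<close> and \<open>nn\<close> only after a cut according to sign.\<close>

lemma (in prob_space) nn_integral_indep_uniform:
  fixes Y U :: "'a \<Rightarrow> real" and f :: "real \<times> real \<Rightarrow> ennreal"
  assumes indep: "indep_var borel Y borel U" and U: "distr M borel U = unif01"
    and [measurable]: "B \<in> sets borel" "f \<in> borel_measurable borel"
    and F: "density (distr M borel Y) (indicator B) = scale_measure a F"
  shows "(\<integral>\<^sup>+ w. f (Y w, U w) \<partial>density M (\<lambda>w. indicator B (Y w))) = a * (\<integral>\<^sup>+ z. f z \<partial>(F \<Otimes>\<^sub>M unif01))"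
proof -
  interpret U: prob_space unif01 by (rule prob_space_unif01)
  have [measurable]: "Y \<in> borel_measurable M" "U \<in> borel_measurable M"
    using indep by (auto simp: indep_var_distribution_eq)
  have joint: "distr M borel Y \<Otimes>\<^sub>M unif01 = distr M (borel \<Otimes>\<^sub>M borel) (\<lambda>w. (Y w, U w))"
    using indep U by (simp add: indep_var_distribution_eq)
  have sets_F: "sets F = sets borel"
    using arg_cong[OF F, of sets] by simp
  have f2: "f \<in> borel_measurable (borel \<Otimes>\<^sub>M borel)"
    using assms(4) by (simp add: borel_prod)
  have f3: "f \<in> borel_measurable (F \<Otimes>\<^sub>M unif01)"
    using f2 by (subst measurable_cong_sets[OF sets_pair_measure_cong[of F borel unif01 borel] refl]) (auto simp: sets_F)
  have fx: "(\<lambda>x. \<integral>\<^sup>+ u. f (x, u) \<partial>unif01) \<in> borel_measurable borel"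
  proof -
    have "f \<in> borel_measurable (borel \<Otimes>\<^sub>M unif01)"
      using f2 by (subst measurable_cong_sets[OF sets_pair_measure_cong[of borel borel unif01 borel] refl]) auto
    then show ?thesis by (rule U.borel_measurable_nn_integral_fst)
  qed
  have g: "(\<lambda>z. indicator B (fst z) * f z) \<in> borel_measurable (borel \<Otimes>\<^sub>M borel)"
    unfolding borel_prod by measurable
  then have g': "(\<lambda>z. indicator B (fst z) * f z) \<in> borel_measurable (distr M borel Y \<Otimes>\<^sub>M unif01)"
    by (subst measurable_cong_sets[OF sets_pair_measure_cong[of _ borel unif01 borel] refl]) auto
  have "(\<integral>\<^sup>+ w. f (Y w, U w) \<partial>density M (\<lambda>w. indicator B (Y w)))
      = (\<integral>\<^sup>+ w. indicator B (fst (Y w, U w)) * f (Y w, U w) \<partial>M)"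
    by (subst nn_integral_density) auto
  also have "\<dots> = (\<integral>\<^sup>+ z. indicator B (fst z) * f z \<partial>(distr M borel Y \<Otimes>\<^sub>M unif01))"
    unfolding joint by (subst nn_integral_distr) (use g in auto)
  also have "\<dots> = (\<integral>\<^sup>+ x. \<integral>\<^sup>+ u. indicator B x * f (x, u) \<partial>unif01 \<partial>distr M borel Y)"
    using U.nn_integral_fst[OF g'] by simp
  also have "\<dots> = (\<integral>\<^sup>+ x. indicator B x * (\<integral>\<^sup>+ u. f (x, u) \<partial>unif01) \<partial>distr M borel Y)"
    by (intro nn_integral_cong) (auto split: split_indicator)
  also have "\<dots> = (\<integral>\<^sup>+ x. (\<integral>\<^sup>+ u. f (x, u) \<partial>unif01) \<partial>density (distr M borel Y) (indicator B))"
    using fx by (subst nn_integral_density) auto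
  also have "\<dots> = a * (\<integral>\<^sup>+ x. (\<integral>\<^sup>+ u. f (x, u) \<partial>unif01) \<partial>F)"
    unfolding F using fx by (subst nn_integral_scale_measure) (simp_all add: measurable_cong_sets[OF sets_F refl])
  also have "\<dots> = a * (\<integral>\<^sup>+ z. f z \<partial>(F \<Otimes>\<^sub>M unif01))"
    using U.nn_integral_fst[OF f3] by simp
  finally show ?thesis .
qed

text \<open>Equal masses express that the mean is zero. They give \<open>G\<close> the same range on
  both half-lines, so a level attained on one side is a legitimate level on the other.\<close>

locale balanced_law = integrable_law +
  fixes m :: real
  assumes m_pos: "0 < m"
    and mass_pp: "measure (pos_part \<mu>) UNIV = m"
    and mass_nn: "measure (pos_part (reflect \<mu>)) UNIV = m"
begin

sublocale R: integrable_law "reflect \<mu>"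
  by (rule integrable_law_reflect)

abbreviation "nn \<equiv> pos_part (reflect \<mu>)"

text \<open>The comonotone coupling built from the marginals alone, with mass \<open>m\<close>; it
  is defined without any plane measure, so it does not depend on a mixture representation.\<close>

definition coupling :: "plane_measure" where
  "coupling = distr (leb_upto m) borel (\<lambda>h. (quantile pp h, quantile nn h))"

lemma sets_coupling [simp, measurable_cong]: "sets coupling = sets borel"
  and space_coupling [simp]: "space coupling = UNIV"
  by (auto simp: coupling_def)

lemma quantile_nn_pos: "0 < h \<Longrightarrow> h < m \<Longrightarrow> 0 < quantile nn h"
  using R.quantile_pp_pos[of h] mass_nn by simp

lemma AE_coupling: "AE z in coupling. z \<in> {0<..} \<times> {0<..}"
  unfolding coupling_def
proof (subst AE_distr_iff)
  show "AE h in leb_upto m. (quantile pp h, quantile nn h) \<in> {0<..} \<times> {0<..}"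
    using AE_leb_upto[of m] by eventually_elim (simp add: quantile_nn_pos quantile_pp_pos mass_pp)
qed auto

lemma law_ae_uniform:
  assumes [measurable]: "H \<in> borel_measurable L" and H: "distr L borel H = uniform_measure lborel {0..m}"
  shows "law_ae L (\<lambda>w. (real_of_ereal (x_plus \<mu> (H w)), - real_of_ereal (x_minus \<mu> (H w))))
    (scale_measure (ennreal (1 / m)) coupling)"
  unfolding law_ae_def
proof (intro bexI[where x = "\<lambda>w. (quantile pp (H w), quantile nn (H w))"] conjI)
  have "AE h in distr L borel H. 0 < h \<and> h < m"
    unfolding H
  proof (rule AE_uniform_measureI)
    show "AE x in lborel. x \<in> {0..m} \<longrightarrow> 0 < x \<and> x < m"
      using AE_lborel_singleton[of "0::real"] AE_lborel_singleton[of m] by eventually_elim auto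
  qed simp
  then have "AE w in L. 0 < H w \<and> H w < m"
    by (subst (asm) AE_distr_iff) auto
  then show "AE w in L. (real_of_ereal (x_plus \<mu> (H w)), - real_of_ereal (x_minus \<mu> (H w)))
      = (quantile pp (H w), quantile nn (H w))"
    by eventually_elim (simp add: x_plus_eq_quantile x_minus_reflect R.x_plus_eq_quantile mass_pp mass_nn)
  have "distr L borel (\<lambda>w. (quantile pp (H w), quantile nn (H w)))
      = distr (distr L borel H) borel (\<lambda>h. (quantile pp h, quantile nn h))"
    by (subst distr_distr) (auto simp: comp_def)
  also have "\<dots> = scale_measure (ennreal (1 / m)) coupling"
    unfolding H uniform_measure_eq_scale[OF m_pos] coupling_def by (rule distr_scale_measure) measurable
  finally show "distr L borel (\<lambda>w. (quantile pp (H w), quantile nn (H w))) = scale_measure (ennreal (1 / m)) coupling" .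
qed measurable

lemma law_ae_reciprocating_pos:
  fixes Y U :: "'a \<Rightarrow> real"
  assumes [measurable]: "Y \<in> borel_measurable M" "U \<in> borel_measurable M"
    and law: "\<And>f :: real \<times> real \<Rightarrow> ennreal. f \<in> borel_measurable borel \<Longrightarrow>
      (\<integral>\<^sup>+ w. f (Y w, U w) \<partial>M) = a * (\<integral>\<^sup>+ z. f z \<partial>(pp \<Otimes>\<^sub>M unif01))"
  shows "law_ae M (\<lambda>w. (Y w, - recip (Y w) (U w))) (scale_measure a coupling)"
  unfolding law_ae_def
proof (intro bexI[where x = "\<lambda>w. (Y w, quantile nn (dtrans pp (Y w) (U w)))"] conjI)
  have law_range: "distr M borel (\<lambda>w. (Y w, quantile nn (dtrans pp (Y w) (U w))))
      = scale_measure a (distr (leb_upto (measure pp UNIV)) borel (\<lambda>h. (quantile pp h, quantile nn h)))"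
    "AE w in M. 0 < dtrans pp (Y w) (U w) \<and> dtrans pp (Y w) (U w) < measure pp UNIV
      \<and> quantile pp (dtrans pp (Y w) (U w)) = Y w"
    by (rule distributional_transform[OF pp.finite_borel_measure_axioms R.pp.finite_borel_measure_axioms
        assms(1,2)], erule law)+
  show "distr M borel (\<lambda>w. (Y w, quantile nn (dtrans pp (Y w) (U w)))) = scale_measure a coupling"
    using law_range(1) by (simp only: mass_pp coupling_def)
  show "AE w in M. (Y w, - recip (Y w) (U w))
      = (Y w, quantile nn (dtrans pp (Y w) (U w)))"
    using law_range(2)
  proof eventually_elim
    case (elim w)
    then have "0 < Y w" using quantile_pp_pos[of "dtrans pp (Y w) (U w)"] by simp
    then show ?case using reciprocating_pos[of "Y w" "U w"] elim by (simp add: mass_pp mass_nn)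
  qed
qed measurable

lemma law_ae_reciprocating_neg:
  fixes Y U :: "'a \<Rightarrow> real"
  assumes [measurable]: "Y \<in> borel_measurable M" "U \<in> borel_measurable M"
    and law: "\<And>f :: real \<times> real \<Rightarrow> ennreal. f \<in> borel_measurable borel \<Longrightarrow>
      (\<integral>\<^sup>+ w. f (- Y w, U w) \<partial>M) = a * (\<integral>\<^sup>+ z. f z \<partial>(nn \<Otimes>\<^sub>M unif01))"
  shows "law_ae M (\<lambda>w. (recip (Y w) (U w), - Y w)) (scale_measure a coupling)"
  unfolding law_ae_def
proof (intro bexI[where x = "\<lambda>w. (quantile pp (dtrans nn (- Y w) (U w)), - Y w)"] conjI)
  have Ym: "(\<lambda>w. - Y w) \<in> borel_measurable M" by measurable
  have law_range: "distr M borel (\<lambda>w. (- Y w, quantile pp (dtrans nn (- Y w) (U w))))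
      = scale_measure a (distr (leb_upto (measure nn UNIV)) borel (\<lambda>h. (quantile nn h, quantile pp h)))"
    "AE w in M. 0 < dtrans nn (- Y w) (U w) \<and> dtrans nn (- Y w) (U w) < measure nn UNIV
      \<and> quantile nn (dtrans nn (- Y w) (U w)) = - Y w"
    by (rule distributional_transform[OF R.pp.finite_borel_measure_axioms pp.finite_borel_measure_axioms
        Ym assms(2)], erule law)+
  \<comment> \<open>The transform starts from the negative side, so the pair arrives with its
    coordinates exchanged.\<close>
  let ?swap = "\<lambda>z :: real \<times> real. (snd z, fst z)"
  have "distr M borel (\<lambda>w. (quantile pp (dtrans nn (- Y w) (U w)), - Y w))
      = distr (distr M borel (\<lambda>w. (- Y w, quantile pp (dtrans nn (- Y w) (U w))))) borel ?swap"
    by (subst distr_distr) (auto simp: comp_def)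
  also have "\<dots> = scale_measure a (distr (distr (leb_upto m) borel (\<lambda>h. (quantile nn h, quantile pp h))) borel ?swap)"
    unfolding law_range(1) mass_nn by (rule distr_scale_measure) measurable
  also have "distr (distr (leb_upto m) borel (\<lambda>h. (quantile nn h, quantile pp h))) borel ?swap = coupling"
    unfolding coupling_def by (subst distr_distr) (auto simp: comp_def)
  finally show "distr M borel (\<lambda>w. (quantile pp (dtrans nn (- Y w) (U w)), - Y w)) = scale_measure a coupling" .
  show "AE w in M. (recip (Y w) (U w), - Y w)
      = (quantile pp (dtrans nn (- Y w) (U w)), - Y w)"
    using law_range(2)
  proof eventually_elim
    case (elim w)
    then have "0 < - Y w" using R.quantile_pp_pos[of "dtrans nn (- Y w) (U w)"] by simp
    then show ?case using reciprocating_neg[of "- Y w" "U w"] elim by (simp add: mass_pp mass_nn)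
  qed
qed measurable

end

section \<open>Weighted laws of a centred variable\<close>

lemma emeasure_pos_part_distr:
  assumes [measurable]: "X \<in> borel_measurable M" "A \<in> sets borel"
  shows "emeasure (pos_part (distr M borel X)) A = (\<integral>\<^sup>+ w. ennreal (X w) * indicator A (X w) \<partial>M)"
  unfolding pos_part_def
  by (subst emeasure_density) (simp_all add: nn_integral_distr)

lemma reflect_distr:
  assumes [measurable]: "X \<in> borel_measurable M"
  shows "reflect (distr M borel X) = distr M borel (\<lambda>w. - X w)"
  unfolding reflect_def by (subst distr_distr) (auto simp: comp_def)

lemma measure_pos_part_distr:
  assumes X: "integrable M X" and [measurable]: "A \<in> sets borel"
  shows "measure (pos_part (distr M borel X)) A = (\<integral>w. \<bar>max 0 (X w)\<bar> * indicator A (X w) \<partial>M)"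
proof -
  have [measurable]: "X \<in> borel_measurable M" using X by auto
  have "(\<integral>w. \<bar>max 0 (X w)\<bar> * indicator A (X w) \<partial>M)
      = enn2real (\<integral>\<^sup>+ w. ennreal (\<bar>max 0 (X w)\<bar> * indicator A (X w)) \<partial>M)"
    by (rule integral_eq_nn_integral) auto
  also have "(\<integral>\<^sup>+ w. ennreal (\<bar>max 0 (X w)\<bar> * indicator A (X w)) \<partial>M) = emeasure (pos_part (distr M borel X)) A"
    by (subst emeasure_pos_part_distr)
      (auto intro!: nn_integral_cong split: split_indicator simp: max_def ennreal_neg)
  finally show ?thesis by (simp add: measure_def)
qed

lemma measure_pos_part_reflect_distr:
  assumes X: "integrable M X" and [measurable]: "A \<in> sets borel"
  shows "measure (pos_part (reflect (distr M borel X))) A = (\<integral>w. \<bar>min 0 (X w)\<bar> * indicator A (- X w) \<partial>M)"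
proof -
  have [measurable]: "X \<in> borel_measurable M" using X by auto
  have "measure (pos_part (distr M borel (\<lambda>w. - X w))) A
      = (\<integral>w. \<bar>max 0 (- X w)\<bar> * indicator A (- X w) \<partial>M)"
    using X by (intro measure_pos_part_distr) auto
  also have "\<dots> = (\<integral>w. \<bar>min 0 (X w)\<bar> * indicator A (- X w) \<partial>M)"
    by (intro Bochner_Integration.integral_cong) (auto simp: max_def min_def)
  finally show ?thesis by (simp add: reflect_distr)
qed

lemma pos_part_nonpos_null:
  assumes [measurable_cong]: "sets \<mu> = sets borel" and [measurable]: "A \<in> sets borel"
  shows "emeasure (pos_part \<mu>) (A \<inter> {0<..}) = emeasure (pos_part \<mu>) A"
proof -
  have "(\<lambda>x::real. ennreal x * indicator (A \<inter> {0<..}) x) = (\<lambda>x. ennreal x * indicator A x)"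
    by (auto simp: fun_eq_iff ennreal_neg split: split_indicator)
  then show ?thesis
    unfolding pos_part_def by (simp add: emeasure_density assms(1))
qed

lemma (in prob_space) density_distr_eq_scale_measure:
  assumes [measurable]: "Y \<in> borel_measurable M" "B \<in> sets borel"
    and \<rho>: "finite_borel_measure \<rho>" and a: "0 \<le> a"
    and eq: "\<And>A. A \<in> sets borel \<Longrightarrow> prob {w \<in> space M. Y w \<in> A \<inter> B} = a * measure \<rho> A"
  shows "density (distr M borel Y) (indicator B) = scale_measure (ennreal a) \<rho>"
proof -
  interpret \<rho>: finite_borel_measure \<rho> by fact
  show ?thesis
  proof (rule measure_eqI)
    fix A assume "A \<in> sets (density (distr M borel Y) (indicator B))"
    then have [measurable]: "A \<in> sets borel" by simp
    then show "emeasure (density (distr M borel Y) (indicator B)) A = emeasure (scale_measure (ennreal a) \<rho>) A"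
      using eq[of A] a by (simp add: emeasure_restricted emeasure_distr emeasure_eq_measure
          \<rho>.emeasure_eq_measure vimage_def Int_def conj_commute ennreal_mult'[symmetric])
  qed (simp add: \<rho>.M_is_borel)
qed

locale centered_variable = prob_space M for M :: "'a measure" +
  fixes X :: "'a \<Rightarrow> real" and m :: real
  assumes integrable_X: "integrable M X" and mean_X: "(\<integral>w. X w \<partial>M) = 0"
    and nonzero_X: "measure M {w \<in> space M. X w = 0} < 1"
    and m_def: "m = 1 / 2 * (\<integral>w. \<bar>X w\<bar> \<partial>M)"
begin

abbreviation "\<mu> \<equiv> distr M borel X"

lemma measurable_X [measurable]: "X \<in> borel_measurable M"
  using integrable_X by auto

text \<open>The mean 0 and the absolute mean \<open>2 * m\<close> are two linear equations for the
  integrals of the positive and the negative part.\<close>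

lemma integral_pos_neg: "(\<integral>w. \<bar>max 0 (X w)\<bar> \<partial>M) = m" "(\<integral>w. \<bar>min 0 (X w)\<bar> \<partial>M) = m"
proof -
  let ?p = "\<integral>w. max 0 (X w) \<partial>M" and ?n = "\<integral>w. min 0 (X w) \<partial>M"
  have [simp]: "integrable M (\<lambda>w. max 0 (X w))" "integrable M (\<lambda>w. min 0 (X w))"
    by (intro integrable_max integrable_min integrable_X integrable_zero)+
  have "?p + ?n = (\<integral>w. X w \<partial>M)"
    by (subst Bochner_Integration.integral_add[symmetric])
      (simp, simp, intro Bochner_Integration.integral_cong, auto simp: max_def min_def)
  moreover have "?p - ?n = (\<integral>w. \<bar>X w\<bar> \<partial>M)"
    by (subst Bochner_Integration.integral_diff[symmetric])
      (simp, simp, intro Bochner_Integration.integral_cong, auto simp: max_def min_def)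
  ultimately have pn: "?p = m" "- ?n = m" using mean_X m_def by auto
  have "(\<integral>w. \<bar>max 0 (X w)\<bar> \<partial>M) = ?p" by (intro Bochner_Integration.integral_cong) auto
  then show "(\<integral>w. \<bar>max 0 (X w)\<bar> \<partial>M) = m" using pn by simp
  have "(\<integral>w. \<bar>min 0 (X w)\<bar> \<partial>M) = (\<integral>w. - min 0 (X w) \<partial>M)"
    by (intro Bochner_Integration.integral_cong) auto
  then show "(\<integral>w. \<bar>min 0 (X w)\<bar> \<partial>M) = m" using pn by simp
qed

lemma m_positive: "0 < m"
proof (rule ccontr)
  assume "\<not> 0 < m"
  moreover have "0 \<le> (\<integral>w. \<bar>X w\<bar> \<partial>M)" by simp
  ultimately have "(\<integral>w. \<bar>X w\<bar> \<partial>M) = 0" using m_def by simp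
  then have "AE w in M. \<bar>X w\<bar> = 0"
    using integrable_X by (subst (asm) integral_nonneg_eq_0_iff_AE) auto
  then have "AE w in M. X w = 0" by eventually_elim simp
  then have "measure M {w \<in> space M. X w = 0} = 1"
    by (intro prob_eq_1[THEN iffD2]) (auto elim!: eventually_mono)
  then show False using nonzero_X by simp
qed

sublocale balanced_law \<mu> m
proof
  show "integrable \<mu> (\<lambda>x. x)" using integrable_X by (subst integrable_distr_eq) auto
  show "measure (pos_part \<mu>) UNIV = m"
    using integral_pos_neg by (simp add: measure_pos_part_distr[OF integrable_X])
  show "measure (pos_part (reflect \<mu>)) UNIV = m"
    using integral_pos_neg by (simp add: measure_pos_part_reflect_distr[OF integrable_X])
qed (simp_all add: m_positive)

lemma weighted_law_pos:
  assumes N: "prob_space N" and Y: "has_weighted_law M X (\<lambda>x. max 0 x) N Y"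
  shows "density (distr N borel Y) (indicator UNIV) = scale_measure (ennreal (1 / m)) pp"
proof (rule prob_space.density_distr_eq_scale_measure[OF N _ _ pp.finite_borel_measure_axioms])
  fix A :: "real set" assume "A \<in> sets borel"
  then show "measure N {w \<in> space N. Y w \<in> A \<inter> UNIV} = 1 / m * measure pp A"
    using Y integral_pos_neg by (simp add: has_weighted_law_def measure_pos_part_distr[OF integrable_X])
qed (use Y m_positive in \<open>simp_all add: has_weighted_law_def\<close>)

lemma weighted_law_neg:
  assumes N: "prob_space N" and Y: "has_weighted_law M X (\<lambda>x. min 0 x) N Y"
  shows "density (distr N borel (\<lambda>w. - Y w)) (indicator UNIV) = scale_measure (ennreal (1 / m)) nn"
proof (rule prob_space.density_distr_eq_scale_measure[OF N _ _ R.pp.finite_borel_measure_axioms])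
  fix A :: "real set" assume A: "A \<in> sets borel"
  have A': "uminus -` A \<in> sets borel"
    using measurable_sets[of uminus "borel :: real measure" borel A] A by simp
  have "\<forall>A\<in>sets borel. measure N {w \<in> space N. Y w \<in> A}
      = (\<integral>w. \<bar>min 0 (X w)\<bar> * indicator A (X w) \<partial>M) / (\<integral>w. \<bar>min 0 (X w)\<bar> \<partial>M)"
    using Y unfolding has_weighted_law_def by blast
  then have "measure N {w \<in> space N. Y w \<in> uminus -` A}
      = (\<integral>w. \<bar>min 0 (X w)\<bar> * indicator (uminus -` A) (X w) \<partial>M) / m"
    using A' unfolding integral_pos_neg by blast
  also have "(\<integral>w. \<bar>min 0 (X w)\<bar> * indicator (uminus -` A) (X w) \<partial>M) = measure nn A"
    using A by (subst measure_pos_part_reflect_distr[OF integrable_X])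
      (auto intro!: Bochner_Integration.integral_cong split: split_indicator)
  finally show "measure N {w \<in> space N. - Y w \<in> A \<inter> UNIV} = 1 / m * measure nn A" by simp
qed (use Y m_positive in \<open>simp_all add: has_weighted_law_def\<close>)

text \<open>The weight \<open>|X|\<close> has total mass \<open>2 * m\<close>, shared equally by the
  two signs, and gives no mass to 0; on each side it coincides with the one-sided weight.\<close>

lemma weighted_law_abs:
  assumes N: "prob_space N" and Y: "has_weighted_law M X (\<lambda>x. x) N Y"
  shows "density (distr N borel Y) (indicator {0<..}) = scale_measure (ennreal (1 / (2 * m))) pp" (is ?pos)
    and "density (distr N borel (\<lambda>w. - Y w)) (indicator {0<..}) = scale_measure (ennreal (1 / (2 * m))) nn" (is ?neg)
    and "AE w in N. Y w \<noteq> 0"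
proof -
  interpret N: prob_space N by fact
  have [measurable]: "Y \<in> borel_measurable N" using Y by (simp add: has_weighted_law_def)
  have abs_X: "(\<integral>w. \<bar>X w\<bar> \<partial>M) = 2 * m" by (simp add: m_def)
  have Y': "measure N {w \<in> space N. Y w \<in> A} = (\<integral>w. \<bar>X w\<bar> * indicator A (X w) \<partial>M) / (2 * m)"
    if "A \<in> sets borel" for A
    using Y that abs_X by (simp add: has_weighted_law_def)
  show ?pos
  proof (rule N.density_distr_eq_scale_measure[OF _ _ pp.finite_borel_measure_axioms])
    fix A :: "real set" assume [measurable]: "A \<in> sets borel"
    have "measure N {w \<in> space N. Y w \<in> A \<inter> {0<..}} = measure pp (A \<inter> {0<..}) / (2 * m)"
      by (subst Y', simp, subst measure_pos_part_distr[OF integrable_X])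
        (auto intro!: arg_cong2[where f = divide] Bochner_Integration.integral_cong split: split_indicator)
    then show "measure N {w \<in> space N. Y w \<in> A \<inter> {0<..}} = 1 / (2 * m) * measure pp A"
      using pos_part_nonpos_null[of \<mu> A] by (simp add: measure_def)
  qed (use m_positive in simp_all)
  show ?neg
  proof (rule N.density_distr_eq_scale_measure[OF _ _ R.pp.finite_borel_measure_axioms])
    fix A :: "real set" assume [measurable]: "A \<in> sets borel"
    have A': "uminus -` (A \<inter> {0<..}) \<in> sets borel"
      using measurable_sets[of uminus "borel :: real measure" borel "A \<inter> {0<..}"] by simp
    have "\<bar>X w\<bar> * indicator (uminus -` (A \<inter> {0<..})) (X w)
        = \<bar>min 0 (X w)\<bar> * indicator (A \<inter> {0<..}) (- X w)" for w
      by (auto split: split_indicator)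
    then have "measure N {w \<in> space N. Y w \<in> uminus -` (A \<inter> {0<..})} = measure nn (A \<inter> {0<..}) / (2 * m)"
      by (subst Y'[OF A'], subst measure_pos_part_reflect_distr[OF integrable_X]) simp_all
    then show "measure N {w \<in> space N. - Y w \<in> A \<inter> {0<..}} = 1 / (2 * m) * measure nn A"
      using pos_part_nonpos_null[of "reflect \<mu>" A] by (simp add: measure_def R.sets_law)
  qed (use m_positive in simp_all)
  have "\<bar>X w\<bar> * indicator {0} (X w) = 0" for w
    by (auto split: split_indicator)
  then have "measure N {w \<in> space N. Y w \<in> {0}} = (\<integral>w. 0 \<partial>M) / (2 * m)"
    by (subst Y') (simp_all only: borel_singleton sets.empty_sets)
  then have "AE w in N. \<not> Y w \<in> {0}"
    by (subst AE_iff_measurable[of "{w \<in> space N. Y w \<in> {0}}"]) (auto simp: N.emeasure_eq_measure)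
  then show "AE w in N. Y w \<noteq> 0" by eventually_elim simp
qed

end

lemma integral_two_point:
  fixes g :: "real \<Rightarrow> real"
  assumes "0 < a" "b < 0"
  shows "measure_pmf.expectation (two_point a b) g = (b * g a - a * g b) / (b - a)"
proof -
  have p: "0 \<le> b / (b - a)" "b / (b - a) \<le> 1" using assms by (auto simp: divide_simps)
  have "1 - b / (b - a) = - a / (b - a)" using assms by (simp add: field_simps)
  moreover have "measure_pmf.expectation (two_point a b) g = g a * (b / (b - a)) + g b * (1 - b / (b - a))"
    unfolding two_point_def using p by simp
  ultimately show ?thesis by (simp add: diff_divide_distrib mult.commute)
qed

section \<open>Superadditivity of powers and extended expectations\<close>

text \<open>The inner points \<open>a + d\<close> and \<open>b + c\<close> are convex combinations
  of the outer ones with complementary weights, \<open>t\<close> and \<open>1 - t\<close> at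
  \<open>b + d\<close>. Adding the two convexity inequalities makes the weights disappear.\<close>

lemma convex_on_four_points:
  fixes \<phi> :: "real \<Rightarrow> real"
  assumes \<phi>: "convex_on I \<phi>" and "a < b" "c < d" "a + c \<in> I" "b + d \<in> I"
  shows "\<phi> (a + d) + \<phi> (b + c) \<le> \<phi> (a + c) + \<phi> (b + d)"
proof -
  define t where "t = (d - c) / ((b - a) + (d - c))"
  have t: "0 \<le> t" "t \<le> 1" using assms by (auto simp: t_def divide_simps)
  have t': "t * ((b - a) + (d - c)) = d - c" using assms by (simp add: t_def)
  have 1: "\<phi> ((1 - t) *\<^sub>R (a + c) + t *\<^sub>R (b + d)) \<le> (1 - t) * \<phi> (a + c) + t * \<phi> (b + d)"
    by (rule convex_onD[OF \<phi> t assms(4,5)])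
  have 2: "\<phi> ((1 - (1 - t)) *\<^sub>R (a + c) + (1 - t) *\<^sub>R (b + d)) \<le> (1 - (1 - t)) * \<phi> (a + c) + (1 - t) * \<phi> (b + d)"
    by (rule convex_onD[OF \<phi> _ _ assms(4,5)]) (use t in auto)
  have e1: "(1 - t) *\<^sub>R (a + c) + t *\<^sub>R (b + d) = a + d"
    using t' by (simp add: algebra_simps)
  have e2: "(1 - (1 - t)) *\<^sub>R (a + c) + (1 - t) *\<^sub>R (b + d) = b + c"
    using t' by (simp add: algebra_simps)
  have "(1 - t) * \<phi> (a + c) + t * \<phi> (b + d) + ((1 - (1 - t)) * \<phi> (a + c) + (1 - t) * \<phi> (b + d)) = \<phi> (a + c) + \<phi> (b + d)"
    by (simp add: algebra_simps)
  then show ?thesis using 1 2 unfolding e1 e2 by linarith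
qed

lemma convex_on_abs_powr:
  assumes p: "1 \<le> (p::real)"
  shows "convex_on UNIV (\<lambda>x. \<bar>x\<bar> powr p)"
proof (rule convex_onI)
  fix t x y :: real assume t: "0 < t" "t < 1"
  have pos: "((1 - t) * u + t * v) powr p \<le> (1 - t) * u powr p + t * v powr p" if "0 \<le> u" "0 \<le> v" for u v
  proof -
    note uv = that
    \<comment> \<open>If one argument vanishes, convexity reduces to this inequality, which rests on
      \<open>s powr p \<le> s\<close>; positive arguments are left to
      \<open>powr_convex\<close>.\<close>
    have scale: "(s * w) powr p \<le> s * w powr p" if "0 \<le> s" "s \<le> 1" "0 \<le> w" for s w
    proof -
      have "s powr p \<le> s"
        using powr_le_one_le[of s p] p that by (cases "s = 0") auto
      then show ?thesis using that by (simp add: powr_mult mult_right_mono)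
    qed
    consider "u = 0" | "v = 0" | "0 < u" "0 < v" using uv by fastforce
    then show ?thesis
    proof cases
      case 3
      then show ?thesis
        using convex_onD[OF powr_convex[OF p], of t u v] t by simp
    qed (use scale[of t v] scale[of "1 - t" u] t that in auto)
  qed
  have "\<bar>(1 - t) *\<^sub>R x + t *\<^sub>R y\<bar> \<le> (1 - t) * \<bar>x\<bar> + t * \<bar>y\<bar>"
    using abs_triangle_ineq[of "(1 - t) * x" "t * y"] t by (simp add: abs_mult)
  then have "\<bar>(1 - t) *\<^sub>R x + t *\<^sub>R y\<bar> powr p \<le> ((1 - t) * \<bar>x\<bar> + t * \<bar>y\<bar>) powr p"
    using p by (intro powr_mono2) auto
  also have "\<dots> \<le> (1 - t) * \<bar>x\<bar> powr p + t * \<bar>y\<bar> powr p" by (rule pos) auto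
  finally show "\<bar>(1 - t) *\<^sub>R x + t *\<^sub>R y\<bar> powr p \<le> (1 - t) * \<bar>x\<bar> powr p + t * \<bar>y\<bar> powr p" .
qed simp

lemma convex_on_powr_nonpos:
  assumes p: "p \<le> (0::real)"
  shows "convex_on {0<..} (\<lambda>x. x powr p)"
proof (rule convex_on_realI)
  show "connected {0::real<..}" by simp
  show "((\<lambda>x. x powr p) has_real_derivative p * x powr (p - 1)) (at x)" if "x \<in> {0<..}" for x
    using that by (auto intro!: derivative_eq_intros)
  show "p * x powr (p - 1) \<le> p * y powr (p - 1)" if "x \<in> {0<..}" "y \<in> {0<..}" "x \<le> y" for x y
    using that p powr_mono2'[of "p - 1" x y] by (intro mult_left_mono_neg) auto
qed

lemma superadditive_on_abs_sum_powr: "1 \<le> p \<Longrightarrow> superadditive_on I J (\<lambda>x y. \<bar>x + y\<bar> powr p)"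
  unfolding superadditive_on_def
  using convex_on_four_points[OF convex_on_abs_powr] by blast

text \<open>Replacing the second variable by its negative reverses the order of its two values and
  so reverses the four-point inequality; the minus sign restores it.\<close>

lemma superadditive_on_abs_diff_powr: "1 \<le> p \<Longrightarrow> superadditive_on I J (\<lambda>x y. - (\<bar>x - y\<bar> powr p))"
  unfolding superadditive_on_def
proof (intro ballI impI)
  fix a b c d :: real assume "1 \<le> p" "a < b" "c < d"
  then show "- (\<bar>a - d\<bar> powr p) + - (\<bar>b - c\<bar> powr p) \<le> - (\<bar>a - c\<bar> powr p) + - (\<bar>b - d\<bar> powr p)"
    using convex_on_four_points[OF convex_on_abs_powr[of p], of a b "- d" "- c"] by simp
qed

lemma superadditive_on_sum_powr_nonpos:
  assumes "p \<le> 0" "0 < e"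
  shows "superadditive_on {0..} {0..} (\<lambda>x y. (x + y + e) powr p)"
  unfolding superadditive_on_def
proof (intro ballI impI)
  fix a b c d :: real assume "a \<in> {0..}" "b \<in> {0..}" "c \<in> {0..}" "d \<in> {0..}" "a < b" "c < d"
  then show "(a + d + e) powr p + (b + c + e) powr p \<le> (a + c + e) powr p + (b + d + e) powr p"
    using convex_on_four_points[OF convex_on_powr_nonpos[OF assms(1)], of a b "c + e" "d + e"] assms(2)
    by (simp add: add.assoc)
qed

text \<open>For a product of a function of one variable and a function of the other, the mixed
  difference is the product of the two increments. Here one factor increases and the other
  decreases.\<close>

lemma superadditive_on_quotient_powr:
  assumes "0 < p"
  shows "superadditive_on {0<..} {0<..} (\<lambda>x y. - (\<bar>x / y\<bar> powr p))"
    and "superadditive_on {0<..} {0<..} (\<lambda>x y. - (\<bar>y / x\<bar> powr p))"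
proof -
  have key: "x powr p / y' powr p + x' powr p / y powr p \<ge> x powr p / y powr p + x' powr p / y' powr p"
    if "0 < x'" "x' < x" "0 < y'" "y' < y" for x x' y y'
  proof -
    have "x' powr p \<le> x powr p" "1 / y powr p \<le> 1 / y' powr p"
      using that assms by (intro powr_mono2 frac_le; simp)+
    then have "0 \<le> (x powr p - x' powr p) * (1 / y' powr p - 1 / y powr p)"
      by (intro mult_nonneg_nonneg) auto
    then show ?thesis by (simp add: algebra_simps)
  qed
  show "superadditive_on {0<..} {0<..} (\<lambda>x y. - (\<bar>x / y\<bar> powr p))"
    unfolding superadditive_on_def
  proof (intro ballI impI)
    fix a b c d :: real assume "a \<in> {0<..}" "b \<in> {0<..}" "c \<in> {0<..}" "d \<in> {0<..}" "a < b" "c < d"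
    then show "- (\<bar>a / d\<bar> powr p) + - (\<bar>b / c\<bar> powr p) \<le> - (\<bar>a / c\<bar> powr p) + - (\<bar>b / d\<bar> powr p)"
      using key[of a b c d] by (simp add: powr_divide)
  qed
  show "superadditive_on {0<..} {0<..} (\<lambda>x y. - (\<bar>y / x\<bar> powr p))"
    unfolding superadditive_on_def
  proof (intro ballI impI)
    fix a b c d :: real assume "a \<in> {0<..}" "b \<in> {0<..}" "c \<in> {0<..}" "d \<in> {0<..}" "a < b" "c < d"
    then show "- (\<bar>d / a\<bar> powr p) + - (\<bar>c / b\<bar> powr p) \<le> - (\<bar>c / a\<bar> powr p) + - (\<bar>d / b\<bar> powr p)"
      using key[of c d a b] by (simp add: powr_divide)
  qed
qed

section \<open>Reducing extended expectations to nonnegative integrals\<close>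

lemma ext_expectation_nonneg:
  "(\<And>w. 0 \<le> f w) \<Longrightarrow> ext_expectation M f = enn2ereal (\<integral>\<^sup>+ w. ennreal (f w) \<partial>M)"
  by (simp add: ext_expectation_def ennreal_neg zero_ennreal.rep_eq)

lemma ext_expectation_cong_AE:
  "AE w in M. f w = g w \<Longrightarrow> ext_expectation M f = ext_expectation M g"
  unfolding ext_expectation_def
  by (intro arg_cong2[where f = minus] arg_cong[where f = enn2ereal] nn_integral_cong_AE)
    (auto elim!: eventually_mono)

text \<open>After a shift by the bound a single nonnegative integral remains, so an inequality
  between \<open>nn_integral\<close>s carries over to extended expectations, infinite ones
  included.\<close>

lemma ext_expectation_bounded_below:
  assumes "prob_space M" and [measurable]: "f \<in> borel_measurable M"
    and C: "0 \<le> C" "AE w in M. - C \<le> f w"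
  shows "ext_expectation M f = enn2ereal (\<integral>\<^sup>+ w. ennreal (f w + C) \<partial>M) - ereal C"
proof -
  interpret prob_space M by fact
  let ?p = "\<integral>\<^sup>+ w. ennreal (f w) \<partial>M" and ?n = "\<integral>\<^sup>+ w. ennreal (- f w) \<partial>M"
    and ?c = "\<integral>\<^sup>+ w. ennreal (f w + C) \<partial>M"
  \<comment> \<open>With positive part \<open>p\<close> and negative part \<open>n\<close> of
    \<open>f\<close>, the pointwise identity \<open>(f + C) + n = p + C\<close> has only nonnegative
    terms. Among the integrals, that of \<open>n\<close> is at most \<open>C\<close>, so it can be
    cancelled.\<close>
  have "?c + ?n = (\<integral>\<^sup>+ w. ennreal (f w + C) + ennreal (- f w) \<partial>M)"
    by (rule nn_integral_add[symmetric]) auto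
  also have "\<dots> = (\<integral>\<^sup>+ w. ennreal (f w) + ennreal C \<partial>M)"
    using C(2)
  proof (intro nn_integral_cong_AE, elim eventually_mono)
    fix w assume f: "- C \<le> f w"
    show "ennreal (f w + C) + ennreal (- f w) = ennreal (f w) + ennreal C"
    proof (cases "0 \<le> f w")
      case True
      then show ?thesis using C by (simp add: ennreal_neg)
    next
      case False
      then have "ennreal (f w + C) + ennreal (- f w) = ennreal ((f w + C) + - f w)"
        using f by (intro ennreal_plus[symmetric]) auto
      then show ?thesis using False by (simp add: ennreal_neg)
    qed
  qed
  also have "\<dots> = ?p + ennreal C" by (subst nn_integral_add) (auto simp: emeasure_space_1)
  finally have eq: "?c + ?n = ?p + ennreal C" .
  have "?n \<le> (\<integral>\<^sup>+ w. ennreal C \<partial>M)"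
    using C(2) by (intro nn_integral_mono_AE) (auto elim!: eventually_mono intro!: ennreal_leI)
  then have "?n \<le> ennreal C" by (simp add: emeasure_space_1)
  then obtain n where n: "0 \<le> n" "?n = ennreal n"
    by (cases ?n rule: ennreal_cases) (auto simp: top_unique)
  show ?thesis
  proof (cases "?p = \<infinity>")
    case True
    then have "?c = \<infinity>" using eq n by (metis ennreal_add_eq_top ennreal_neq_top infinity_ennreal_def)
    then show ?thesis using True n by (simp add: ext_expectation_def)
  next
    case False
    then obtain p where p: "0 \<le> p" "?p = ennreal p"
      by (cases ?p rule: ennreal_cases) auto
    have "?c \<noteq> \<infinity>" using eq p C by (metis ennreal_add_eq_top ennreal_neq_top infinity_ennreal_def)
    then obtain c where c: "0 \<le> c" "?c = ennreal c"
      by (cases ?c rule: ennreal_cases) auto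
    have "ennreal (c + n) = ennreal (p + C)" using eq n p c C by simp
    then have "c + n = p + C" using n p c C by (subst (asm) ennreal_inj) auto
    then show ?thesis using n p c by (simp add: ext_expectation_def)
  qed
qed

text \<open>The integral of the positive part is finite, so negation commutes with the difference of
  extended reals and the lower-bound case applies to \<open>- f\<close>.\<close>

lemma ext_expectation_bounded_above:
  assumes "prob_space M" and [measurable]: "f \<in> borel_measurable M"
    and C: "0 \<le> C" "AE w in M. f w \<le> C"
  shows "ext_expectation M f = ereal C - enn2ereal (\<integral>\<^sup>+ w. ennreal (C - f w) \<partial>M)"
proof -
  interpret prob_space M by fact
  have "(\<integral>\<^sup>+ w. ennreal (f w) \<partial>M) \<le> (\<integral>\<^sup>+ w. ennreal C \<partial>M)"
    using C(2) by (intro nn_integral_mono_AE) (auto elim!: eventually_mono intro!: ennreal_leI)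
  then have "(\<integral>\<^sup>+ w. ennreal (f w) \<partial>M) \<le> ennreal C" by (simp add: emeasure_space_1)
  then obtain n where n: "0 \<le> n" "(\<integral>\<^sup>+ w. ennreal (f w) \<partial>M) = ennreal n"
    by (cases "\<integral>\<^sup>+ w. ennreal (f w) \<partial>M" rule: ennreal_cases) (auto simp: top_unique)
  have "ext_expectation M f = - ext_expectation M (\<lambda>w. - f w)"
    using n by (simp add: ext_expectation_def ereal_minus_diff_eq)
  also have "ext_expectation M (\<lambda>w. - f w) = enn2ereal (\<integral>\<^sup>+ w. ennreal (- f w + C) \<partial>M) - ereal C"
    by (rule ext_expectation_bounded_below[OF assms(1) _ C(1)]) (use C in auto)
  finally show ?thesis by (simp add: ereal_minus_diff_eq)
qed

lemma ennreal_powr_mono: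
  assumes "0 < a" "x \<le> y"
  shows "ennreal_powr x a \<le> ennreal_powr y a"
proof (cases "y = \<infinity>")
  case False
  then have "x \<noteq> \<infinity>" using assms(2) by (auto simp: top_unique)
  moreover have "enn2real x \<le> enn2real y" using False assms(2) by (intro enn2real_mono) (auto simp: less_top)
  ultimately show ?thesis
    using False assms(1) by (auto simp: ennreal_powr_def intro!: ennreal_leI powr_mono2)
qed (simp add: ennreal_powr_def)

lemma ennreal_powr_powr_inverse:
  assumes "0 < p"
  shows "ennreal_powr (ennreal_powr x (1 / p)) p = x"
  using assms by (cases x rule: ennreal_cases) (auto simp: ennreal_powr_def powr_powr)

section \<open>The two-point mixture\<close>

abbreviation quadrant :: "(real \<times> real) set" where
  "quadrant \<equiv> {0<..} \<times> {0<..}"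

text \<open>A cost function may be arbitrary off the open quadrant, and all plane laws compared here
  are concentrated on it.\<close>

abbreviation quadrant_measurable :: "(real \<times> real \<Rightarrow> 'b :: {topological_space, semiring_1}) \<Rightarrow> bool" where
  "quadrant_measurable f \<equiv> (\<lambda>z. indicator quadrant z * f z) \<in> borel_measurable borel"

lemma nn_integral_scale_measure_AE:
  fixes f :: "real \<times> real \<Rightarrow> ennreal"
  assumes D: "AE z in M. z \<in> D" and M: "sets M = sets borel"
    and f: "(\<lambda>z. indicator D z * f z) \<in> borel_measurable borel"
  shows "(\<integral>\<^sup>+ z. f z \<partial>scale_measure r M) = r * (\<integral>\<^sup>+ z. f z \<partial>M)"
proof -
  have D': "AE z in scale_measure r M. z \<in> D"
    using D by (auto simp: eventually_ae_filter null_sets_def space_scale_measure)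
  have fM: "(\<lambda>z. indicator D z * f z) \<in> borel_measurable M"
    using f by (simp add: measurable_cong_sets[OF M refl])
  have "(\<integral>\<^sup>+ z. f z \<partial>scale_measure r M) = (\<integral>\<^sup>+ z. indicator D z * f z \<partial>scale_measure r M)"
    using D' by (intro nn_integral_cong_AE) (auto elim!: eventually_mono)
  also have "\<dots> = r * (\<integral>\<^sup>+ z. indicator D z * f z \<partial>M)"
    by (rule nn_integral_scale_measure[OF fM])
  also have "(\<integral>\<^sup>+ z. indicator D z * f z \<partial>M) = (\<integral>\<^sup>+ z. f z \<partial>M)"
    using D by (intro nn_integral_cong_AE) (auto elim!: eventually_mono)
  finally show ?thesis .
qed

lemma AE_scale_measure:
  assumes "AE z in M. P z"
  shows "AE z in scale_measure r M. P z"
  using assms by (auto simp: eventually_ae_filter null_sets_def space_scale_measure)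

lemma measurable_quadrant_right_continuous:
  assumes "right_continuous_on2 {0..} {0..} k"
  shows "quadrant_measurable (\<lambda>z. k (fst z) (snd z))"
proof -
  have "(\<lambda>z. indicator quadrant z * k (fst z) (snd z))
      = (\<lambda>z. indicator quadrant z * k (max 0 (fst z)) (max 0 (snd z)))"
    by (auto simp: fun_eq_iff split: split_indicator)
  moreover have "\<dots> \<in> borel_measurable borel"
    using measurable_right_continuous[OF assms] by (intro borel_measurable_times) auto
  ultimately show ?thesis by simp
qed

lemma measurable_quadrant_ennreal:
  assumes "quadrant_measurable f"
  shows "quadrant_measurable (\<lambda>z. ennreal (f z))"
    and "quadrant_measurable (\<lambda>z. ennreal (- f z))"
proof -
  have "(\<lambda>z. ennreal (indicator quadrant z * f z)) \<in> borel_measurable borel"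
    "(\<lambda>z. ennreal (- (indicator quadrant z * f z))) \<in> borel_measurable borel"
    using assms by measurable
  moreover have "(\<lambda>z. ennreal (indicator quadrant z * f z)) = (\<lambda>z. indicator quadrant z * ennreal (f z))"
    "(\<lambda>z. ennreal (- (indicator quadrant z * f z))) = (\<lambda>z. indicator quadrant z * ennreal (- f z))"
    by (auto simp: fun_eq_iff split: split_indicator)
  ultimately show "quadrant_measurable (\<lambda>z. ennreal (f z))"
    "quadrant_measurable (\<lambda>z. ennreal (- f z))"
    by simp_all
qed

lemma law_ae_ext_expectation:
  fixes f :: "real \<times> real \<Rightarrow> real"
  assumes "law_ae M Z Q" "AE z in Q. z \<in> quadrant"
    and "quadrant_measurable f"
  shows "ext_expectation M (\<lambda>w. f (Z w)) = ext_expectation Q f"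
  unfolding ext_expectation_def
  using law_ae_nn_integral[OF assms(1,2) sets_quadrant measurable_quadrant_ennreal(1)[OF assms(3)]]
    law_ae_nn_integral[OF assms(1,2) sets_quadrant measurable_quadrant_ennreal(2)[OF assms(3)]]
  by simp

section \<open>The comonotone law and the variables that follow it\<close>

context centered_variable
begin

definition Q :: "plane_measure" where
  "Q = scale_measure (ennreal (1 / m)) coupling"

definition Q_half :: "plane_measure" where
  "Q_half = scale_measure (ennreal (1 / (2 * m))) coupling"

lemma sets_Q [simp, measurable_cong]: "sets Q = sets borel"
  and sets_Q_half [simp, measurable_cong]: "sets Q_half = sets borel"
  by (simp_all add: Q_def Q_half_def)

lemma AE_Q: "AE z in Q. z \<in> quadrant" and AE_Q_half: "AE z in Q_half. z \<in> quadrant"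
  unfolding Q_def Q_half_def by (intro AE_scale_measure AE_coupling)+

lemma prob_space_Q: "prob_space Q"
proof
  have "emeasure coupling UNIV = ennreal m"
    unfolding coupling_def using m_positive
    by (subst emeasure_distr) (auto simp: emeasure_leb_upto_UNIV)
  then show "emeasure Q (space Q) = 1"
    using m_positive by (simp add: Q_def space_scale_measure ennreal_mult'[symmetric])
qed

lemma nn_integral_Q_half:
  assumes "quadrant_measurable f"
  shows "2 * (\<integral>\<^sup>+ z. f z \<partial>Q_half) = (\<integral>\<^sup>+ z. f z \<partial>Q)"
proof -
  have "2 * ennreal (1 / (2 * m)) = ennreal (1 / m)"
    using m_positive by (simp add: ennreal_mult''[symmetric] flip: ennreal_numeral)
  then show ?thesis
    unfolding Q_def Q_half_def
    by (simp add: nn_integral_scale_measure_AE[OF AE_coupling sets_coupling assms] mult.assoc[symmetric])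
qed

lemma law_plus:
  fixes N :: "'b measure"
  assumes N: "prob_space N" and U: "distr N borel U = unif01"
    and Y: "has_weighted_law M X (\<lambda>x. max 0 x) N Y" "prob_space.indep_var N borel Y borel U"
  shows "law_ae N (\<lambda>w. (Y w, - recip (Y w) (U w))) Q"
proof -
  interpret N: prob_space N by fact
  have m: "Y \<in> borel_measurable N" "U \<in> borel_measurable N"
    using Y(2) by (auto simp: N.indep_var_distribution_eq)
  show ?thesis
    unfolding Q_def
  proof (rule law_ae_reciprocating_pos[OF m])
    fix f :: "real \<times> real \<Rightarrow> ennreal" assume "f \<in> borel_measurable borel"
    from N.nn_integral_indep_uniform[OF Y(2) U _ this weighted_law_pos[OF N Y(1)]]
    show "(\<integral>\<^sup>+ w. f (Y w, U w) \<partial>N) = ennreal (1 / m) * (\<integral>\<^sup>+ z. f z \<partial>(pp \<Otimes>\<^sub>M unif01))"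
      by (simp add: density_1)
  qed
qed

lemma indep_var_uminus:
  fixes N :: "'b measure" and Y U :: "'b \<Rightarrow> real"
  assumes "prob_space N" "prob_space.indep_var N borel Y borel U"
  shows "prob_space.indep_var N borel (\<lambda>w. - Y w) borel U"
proof -
  interpret N: prob_space N by fact
  have "N.indep_var borel (uminus \<circ> Y) borel (id \<circ> U)"
    by (rule N.indep_var_compose[OF assms(2)]) auto
  then show ?thesis by (simp add: comp_def)
qed

lemma law_minus:
  fixes N :: "'b measure"
  assumes N: "prob_space N" and U: "distr N borel U = unif01"
    and Y: "has_weighted_law M X (\<lambda>x. min 0 x) N Y" "prob_space.indep_var N borel Y borel U"
  shows "law_ae N (\<lambda>w. (recip (Y w) (U w), - Y w)) Q"
proof -
  interpret N: prob_space N by fact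
  have m: "Y \<in> borel_measurable N" "U \<in> borel_measurable N"
    using Y(2) by (auto simp: N.indep_var_distribution_eq)
  show ?thesis
    unfolding Q_def
  proof (rule law_ae_reciprocating_neg[OF m])
    fix f :: "real \<times> real \<Rightarrow> ennreal" assume "f \<in> borel_measurable borel"
    from N.nn_integral_indep_uniform[OF indep_var_uminus[OF N Y(2)] U _ this weighted_law_neg[OF N Y(1)]]
    show "(\<integral>\<^sup>+ w. f (- Y w, U w) \<partial>N) = ennreal (1 / m) * (\<integral>\<^sup>+ z. f z \<partial>(nn \<Otimes>\<^sub>M unif01))"
      by (simp add: density_1)
  qed
qed

lemma law_abs:
  fixes N :: "'b measure"
  assumes N: "prob_space N" and U: "distr N borel U = unif01"
    and Y: "has_weighted_law M X (\<lambda>x. x) N Y" "prob_space.indep_var N borel Y borel U"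
  shows "law_ae (density N (\<lambda>w. indicator {0<..} (Y w)))
      (\<lambda>w. (Y w, - recip (Y w) (U w))) Q_half" (is ?pos)
    and "law_ae (density N (\<lambda>w. indicator {0<..} (- Y w)))
      (\<lambda>w. (recip (Y w) (U w), - Y w)) Q_half" (is ?neg)
proof -
  interpret N: prob_space N by fact
  have m: "Y \<in> borel_measurable N" "U \<in> borel_measurable N"
    using Y(2) by (auto simp: N.indep_var_distribution_eq)
  show ?pos
    unfolding Q_half_def
  proof (rule law_ae_reciprocating_pos)
    fix f :: "real \<times> real \<Rightarrow> ennreal" assume "f \<in> borel_measurable borel"
    from N.nn_integral_indep_uniform[OF Y(2) U _ this weighted_law_abs(1)[OF N Y(1)]]
    show "(\<integral>\<^sup>+ w. f (Y w, U w) \<partial>density N (\<lambda>w. indicator {0<..} (Y w)))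
        = ennreal (1 / (2 * m)) * (\<integral>\<^sup>+ z. f z \<partial>(pp \<Otimes>\<^sub>M unif01))"
      by simp
  qed (use m in auto)
  show ?neg
    unfolding Q_half_def
  proof (rule law_ae_reciprocating_neg)
    fix f :: "real \<times> real \<Rightarrow> ennreal" assume "f \<in> borel_measurable borel"
    from N.nn_integral_indep_uniform[OF indep_var_uminus[OF N Y(2)] U _ this weighted_law_abs(2)[OF N Y(1)]]
    show "(\<integral>\<^sup>+ w. f (- Y w, U w) \<partial>density N (\<lambda>w. indicator {0<..} (- Y w)))
        = ennreal (1 / (2 * m)) * (\<integral>\<^sup>+ z. f z \<partial>(nn \<Otimes>\<^sub>M unif01))"
      by simp
  qed (use m in auto)
qed

text \<open>
  On \<open>{Y > 0}\<close> and on \<open>{Y < 0}\<close> separately, the pair of \<open>Y\<close> and its reciprocal has half of the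
  common law \<open>Q\<close>.
\<close>
lemma nn_integral_symmetrized:
  fixes N :: "'b measure" and f g :: "real \<times> real \<Rightarrow> ennreal" and Y U :: "'b \<Rightarrow> real"
  defines "r \<equiv> \<lambda>w. recip (Y w) (U w)"
  assumes N: "prob_space N" and U: "distr N borel U = unif01"
    and Y: "has_weighted_law M X (\<lambda>x. x) N Y" "prob_space.indep_var N borel Y borel U"
    and [measurable]: "quadrant_measurable f"
      "quadrant_measurable g"
    and F: "\<And>w. 0 < Y w \<Longrightarrow> r w < 0 \<Longrightarrow> F w = f (Y w, - r w)"
      "\<And>w. Y w < 0 \<Longrightarrow> 0 < r w \<Longrightarrow> F w = g (r w, - Y w)"
  shows "2 * (\<integral>\<^sup>+ w. F w \<partial>N) = (\<integral>\<^sup>+ z. f z \<partial>Q) + (\<integral>\<^sup>+ z. g z \<partial>Q)"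
proof -
  have [measurable]: "Y \<in> borel_measurable N" using Y(1) by (simp add: has_weighted_law_def)
  let ?N1 = "density N (\<lambda>w. indicator {0<..} (Y w))" and ?N2 = "density N (\<lambda>w. indicator {0<..} (- Y w))"
  note laws = law_abs[OF N U Y, folded r_def]
  \<comment> \<open>No measurability of \<open>r\<close> has been established, so the integrand is
    replaced by measurable versions \<open>Z1\<close> and \<open>Z2\<close> before the integral is
    split into two.\<close>
  obtain Z1 where [measurable]: "Z1 \<in> borel_measurable ?N1"
    and Z1: "AE w in ?N1. (Y w, - r w) = Z1 w" "distr ?N1 borel Z1 = Q_half"
    using laws(1) unfolding law_ae_def r_def by blast
  obtain Z2 where [measurable]: "Z2 \<in> borel_measurable ?N2"
    and Z2: "AE w in ?N2. (r w, - Y w) = Z2 w" "distr ?N2 borel Z2 = Q_half"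
    using laws(2) unfolding law_ae_def r_def by blast
  have [measurable]: "Z1 \<in> borel_measurable N" "Z2 \<in> borel_measurable N"
    using \<open>Z1 \<in> borel_measurable ?N1\<close> \<open>Z2 \<in> borel_measurable ?N2\<close>
    by (simp_all add: measurable_cong_sets[OF sets_density refl])
  have in1: "AE w in ?N1. (Y w, - r w) \<in> quadrant"
    using law_ae_AE[OF laws(1) AE_Q_half sets_quadrant] unfolding r_def .
  have in2: "AE w in ?N2. (r w, - Y w) \<in> quadrant"
    using law_ae_AE[OF laws(2) AE_Q_half sets_quadrant] unfolding r_def .
  have Y1: "AE w in N. 0 < Y w \<longrightarrow> (Y w, - r w) \<in> quadrant \<and> (Y w, - r w) = Z1 w"
    using AE_conjI[OF in1 Z1(1)] by (subst (asm) AE_density) (auto elim!: eventually_mono)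
  have Y2: "AE w in N. Y w < 0 \<longrightarrow> (r w, - Y w) \<in> quadrant \<and> (r w, - Y w) = Z2 w"
    using AE_conjI[OF in2 Z2(1)] by (subst (asm) AE_density) (auto elim!: eventually_mono)
  let ?f = "\<lambda>z. indicator quadrant z * f z" and ?g = "\<lambda>z. indicator quadrant z * g z"
  have "(\<integral>\<^sup>+ w. F w \<partial>N)
      = (\<integral>\<^sup>+ w. indicator {0<..} (Y w) * ?f (Z1 w) + indicator {0<..} (- Y w) * ?g (Z2 w) \<partial>N)"
  proof (rule nn_integral_cong_AE)
    show "AE w in N. F w = indicator {0<..} (Y w) * ?f (Z1 w) + indicator {0<..} (- Y w) * ?g (Z2 w)"
      using weighted_law_abs(3)[OF N Y(1)] Y1 Y2
    proof eventually_elim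
      case (elim w)
      show ?case
      proof (cases "0 < Y w")
        case True
        then have q: "(Y w, - r w) \<in> quadrant" and Z: "(Y w, - r w) = Z1 w" using elim by blast+
        then have "F w = f (Z1 w)" using F(1)[of w] True by auto
        moreover have "Z1 w \<in> quadrant" using q unfolding Z .
        ultimately show ?thesis using True by simp
      next
        case False
        then have Y0: "Y w < 0" using elim by simp
        then have q: "(r w, - Y w) \<in> quadrant" and Z: "(r w, - Y w) = Z2 w" using elim by blast+
        then have "F w = g (Z2 w)" using F(2)[of w] Y0 by auto
        moreover have "Z2 w \<in> quadrant" using q unfolding Z .
        ultimately show ?thesis using Y0 by simp
      qed
    qed
  qed
  also have "\<dots> = (\<integral>\<^sup>+ w. indicator {0<..} (Y w) * ?f (Z1 w) \<partial>N) + (\<integral>\<^sup>+ w. indicator {0<..} (- Y w) * ?g (Z2 w) \<partial>N)"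
    by (rule nn_integral_add) measurable
  also have "(\<integral>\<^sup>+ w. indicator {0<..} (Y w) * ?f (Z1 w) \<partial>N) = (\<integral>\<^sup>+ w. ?f (Z1 w) \<partial>?N1)"
    by (subst nn_integral_density) auto
  also have "\<dots> = (\<integral>\<^sup>+ z. ?f z \<partial>Q_half)"
    unfolding Z1(2)[symmetric] by (rule nn_integral_distr[symmetric]) measurable
  also have "\<dots> = (\<integral>\<^sup>+ z. f z \<partial>Q_half)"
    using AE_Q_half by (intro nn_integral_cong_AE) (auto elim!: eventually_mono)
  also have "(\<integral>\<^sup>+ w. indicator {0<..} (- Y w) * ?g (Z2 w) \<partial>N) = (\<integral>\<^sup>+ w. ?g (Z2 w) \<partial>?N2)"
    by (subst nn_integral_density) auto
  also have "\<dots> = (\<integral>\<^sup>+ z. ?g z \<partial>Q_half)"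
    unfolding Z2(2)[symmetric] by (rule nn_integral_distr[symmetric]) measurable
  also have "\<dots> = (\<integral>\<^sup>+ z. g z \<partial>Q_half)"
    using AE_Q_half by (intro nn_integral_cong_AE) (auto elim!: eventually_mono)
  finally have "2 * (\<integral>\<^sup>+ w. F w \<partial>N) = 2 * ((\<integral>\<^sup>+ z. f z \<partial>Q_half) + (\<integral>\<^sup>+ z. g z \<partial>Q_half))"
    by simp
  then show ?thesis
    by (simp only: distrib_left nn_integral_Q_half[OF assms(6)] nn_integral_Q_half[OF assms(7)])
qed

end

section \<open>The joint law produced by the mixture\<close>

locale two_point_mixture = centered_variable M X m
  for M :: "'a measure" and X m +
  fixes \<nu> :: "'s measure" and yp ym :: "'s \<Rightarrow> real"
  assumes prob_\<nu>: "prob_space \<nu>"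
    and measurable_y [measurable]: "yp \<in> borel_measurable \<nu>" "ym \<in> borel_measurable \<nu>"
    and y_sign: "\<And>s. s \<in> space \<nu> \<Longrightarrow> yp s > 0" "\<And>s. s \<in> space \<nu> \<Longrightarrow> ym s < 0"
    and mixture: "\<And>g :: real \<Rightarrow> real. g \<in> borel_measurable borel \<Longrightarrow>
        bdd_below (range g) \<or> bdd_above (range g) \<Longrightarrow>
        ext_expectation M (\<lambda>w. g (X w)) =
          ext_expectation \<nu> (\<lambda>s. measure_pmf.expectation (two_point (yp s) (ym s)) g)"
begin

text \<open>The expectation of the positive part of the two-point variable, and equally of the
  absolute value of its negative part. Their equality lets one weight produce both
  marginals.\<close>

definition wt :: "'s \<Rightarrow> real" where
  "wt s = yp s * ym s / (ym s - yp s)"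

lemma measurable_wt [measurable]: "wt \<in> borel_measurable \<nu>"
  unfolding wt_def by measurable

definition \<nu>w :: "'s measure" where
  "\<nu>w = density \<nu> (\<lambda>s. ennreal (wt s))"

lemma sets_\<nu>w [simp, measurable_cong]: "sets \<nu>w = sets \<nu>" and space_\<nu>w [simp]: "space \<nu>w = space \<nu>"
  by (simp_all add: \<nu>w_def)

lemma nn_integral_mixture:
  assumes [measurable]: "g \<in> borel_measurable borel" and g: "\<And>x. 0 \<le> g x"
  shows "(\<integral>\<^sup>+ w. ennreal (g (X w)) \<partial>M)
    = (\<integral>\<^sup>+ s. ennreal ((ym s * g (yp s) - yp s * g (ym s)) / (ym s - yp s)) \<partial>\<nu>)"
proof -
  have "bdd_below (range g)" using g by (auto intro: bdd_belowI[of _ 0])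
  then have "enn2ereal (\<integral>\<^sup>+ w. ennreal (g (X w)) \<partial>M)
      = enn2ereal (\<integral>\<^sup>+ s. ennreal (measure_pmf.expectation (two_point (yp s) (ym s)) g) \<partial>\<nu>)"
    using mixture[of g] g
    by (simp add: ext_expectation_nonneg Bochner_Integration.integral_nonneg)
  then have "(\<integral>\<^sup>+ w. ennreal (g (X w)) \<partial>M)
      = (\<integral>\<^sup>+ s. ennreal (measure_pmf.expectation (two_point (yp s) (ym s)) g) \<partial>\<nu>)"
    by (simp add: enn2ereal_inject)
  also have "\<dots> = (\<integral>\<^sup>+ s. ennreal ((ym s * g (yp s) - yp s * g (ym s)) / (ym s - yp s)) \<partial>\<nu>)"
    by (intro nn_integral_cong) (simp add: integral_two_point y_sign)
  finally show ?thesis .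
qed

text \<open>A test function \<open>x \<mapsto> max 0 x * indicator A x\<close>, or its reflection,
  sees just one of the two atoms of each two-point law, with weight \<open>wt\<close>.\<close>

lemma distr_\<nu>w: "distr \<nu>w borel yp = pp" "distr \<nu>w borel (\<lambda>s. - ym s) = nn"
proof -
  show "distr \<nu>w borel yp = pp"
  proof (rule measure_eqI)
    fix A assume "A \<in> sets (distr \<nu>w borel yp)"
    then have [measurable]: "A \<in> sets borel" by simp
    have "emeasure pp A = (\<integral>\<^sup>+ w. ennreal (max 0 (X w) * indicator A (X w)) \<partial>M)"
      by (subst emeasure_pos_part_distr)
        (auto intro!: nn_integral_cong simp: ennreal_neg max_def split: split_indicator)
    also have "\<dots> = (\<integral>\<^sup>+ s. ennreal ((ym s * (max 0 (yp s) * indicator A (yp s))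
        - yp s * (max 0 (ym s) * indicator A (ym s))) / (ym s - yp s)) \<partial>\<nu>)"
      by (rule nn_integral_mixture) auto
    also have "\<dots> = (\<integral>\<^sup>+ s. ennreal (wt s) * indicator A (yp s) \<partial>\<nu>)"
    proof (rule nn_integral_cong)
      fix s assume "s \<in> space \<nu>"
      then have "0 < yp s" "ym s < 0" using y_sign by auto
      then show "ennreal ((ym s * (max 0 (yp s) * indicator A (yp s))
        - yp s * (max 0 (ym s) * indicator A (ym s))) / (ym s - yp s)) = ennreal (wt s) * indicator A (yp s)"
        by (simp add: wt_def max_def mult.commute split: split_indicator)
    qed
    also have "\<dots> = emeasure (distr \<nu>w borel yp) A"
      by (subst emeasure_distr_eq_nn_integral) (auto simp: \<nu>w_def nn_integral_density)
    finally show "emeasure (distr \<nu>w borel yp) A = emeasure pp A" by simp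
  qed simp
  show "distr \<nu>w borel (\<lambda>s. - ym s) = nn"
  proof (rule measure_eqI)
    fix A assume "A \<in> sets (distr \<nu>w borel (\<lambda>s. - ym s))"
    then have [measurable]: "A \<in> sets borel" by simp
    have "emeasure nn A = (\<integral>\<^sup>+ w. ennreal (max 0 (- X w) * indicator A (- X w)) \<partial>M)"
      unfolding reflect_distr[OF measurable_X]
      by (subst emeasure_pos_part_distr)
        (auto intro!: nn_integral_cong simp: ennreal_neg max_def split: split_indicator)
    also have "\<dots> = (\<integral>\<^sup>+ s. ennreal ((ym s * (max 0 (- yp s) * indicator A (- yp s))
        - yp s * (max 0 (- ym s) * indicator A (- ym s))) / (ym s - yp s)) \<partial>\<nu>)"
      by (rule nn_integral_mixture) auto
    also have "\<dots> = (\<integral>\<^sup>+ s. ennreal (wt s) * indicator A (- ym s) \<partial>\<nu>)"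
    proof (rule nn_integral_cong)
      fix s assume "s \<in> space \<nu>"
      then have "0 < yp s" "ym s < 0" using y_sign by auto
      then show "ennreal ((ym s * (max 0 (- yp s) * indicator A (- yp s))
        - yp s * (max 0 (- ym s) * indicator A (- ym s))) / (ym s - yp s)) = ennreal (wt s) * indicator A (- ym s)"
        by (simp add: wt_def max_def split: split_indicator)
    qed
    also have "\<dots> = emeasure (distr \<nu>w borel (\<lambda>s. - ym s)) A"
      by (subst emeasure_distr_eq_nn_integral) (auto simp: \<nu>w_def nn_integral_density)
    finally show "emeasure (distr \<nu>w borel (\<lambda>s. - ym s)) A = emeasure nn A" by simp
  qed simp
qed

definition P' :: "plane_measure" where
  "P' = distr \<nu>w borel (\<lambda>s. (yp s, - ym s))"

lemma sets_P' [simp, measurable_cong]: "sets P' = sets borel" and space_P' [simp]: "space P' = UNIV"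
  by (simp_all add: P'_def)

lemma marginals_P': "distr P' borel fst = pp" "distr P' borel snd = nn"
  unfolding P'_def using distr_\<nu>w by (subst distr_distr; simp add: comp_def)+

lemma emeasure_\<nu>w: "emeasure \<nu>w (space \<nu>) = ennreal m"
proof -
  have "emeasure (distr \<nu>w borel yp) UNIV = emeasure \<nu>w (space \<nu>)"
    by (subst emeasure_distr) auto
  then show ?thesis
    unfolding distr_\<nu>w by (simp add: pp.emeasure_eq_measure mass_pp)
qed

lemma emeasure_P': "emeasure P' UNIV = ennreal m"
  unfolding P'_def using emeasure_\<nu>w by (subst emeasure_distr) auto

sublocale P': finite_plane_measure P'
  unfolding finite_plane_measure_def finite_plane_measure_axioms_def
  by (intro conjI finite_measureI) (simp_all add: emeasure_P')

lemma comonotone_P': "comonotone P' = coupling"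
  using m_positive by (simp add: comonotone_def coupling_def marginals_P' emeasure_P' measure_def)

lemma AE_P': "AE z in P'. z \<in> quadrant"
  unfolding P'_def by (subst AE_distr_iff) (auto simp: y_sign)

definition P :: "plane_measure" where
  "P = scale_measure (ennreal (1 / m)) P'"

lemma sets_P [simp, measurable_cong]: "sets P = sets borel"
  by (simp add: P_def)

lemma AE_P: "AE z in P. z \<in> quadrant"
  unfolding P_def by (intro AE_scale_measure AE_P')

lemma prob_space_P: "prob_space P"
proof
  show "emeasure P (space P) = 1"
    using m_positive by (simp add: P_def space_scale_measure emeasure_P' ennreal_mult'[symmetric])
qed

abbreviation "\<nu>t \<equiv> nu_tilde \<nu> m yp ym"

lemma nu_tilde_eq: "\<nu>t = scale_measure (ennreal (1 / m)) \<nu>w"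
proof (rule measure_eqI)
  fix A assume "A \<in> sets (\<nu>t)"
  then have [measurable]: "A \<in> sets \<nu>" by (simp add: nu_tilde_def)
  have eq: "ennreal (1 / m * measure_pmf.expectation (two_point (yp s) (ym s)) (\<lambda>x. max 0 x))
      = ennreal (1 / m) * ennreal (wt s)" if "s \<in> space \<nu>" for s
  proof -
    have "0 < yp s" "ym s < 0" using y_sign that by auto
    then show ?thesis
      using m_positive by (simp add: integral_two_point wt_def max_def mult.commute flip: ennreal_mult')
  qed
  \<comment> \<open>The signs of \<open>yp\<close> and \<open>ym\<close> are known only on the space
    of \<open>\<nu>\<close>, where alone the densities agree; unfolding \<open>density\<close>
    leaves only integrals over this space to compare.\<close>
  have "\<nu>t = density \<nu> (\<lambda>s. ennreal (1 / m) * ennreal (wt s))"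
    unfolding nu_tilde_def density_def using eq
    by (intro arg_cong[where f = "measure_of _ _"] ext) (auto intro!: nn_integral_cong)
  then show "emeasure (\<nu>t) A = emeasure (scale_measure (ennreal (1 / m)) \<nu>w) A"
    by (simp add: emeasure_density \<nu>w_def nn_integral_cmult mult.assoc)
qed (simp add: nu_tilde_def)

lemma prob_space_nu_tilde: "prob_space (\<nu>t)"
proof
  show "emeasure (\<nu>t) (space (\<nu>t)) = 1"
    unfolding nu_tilde_eq using m_positive
    by (simp add: space_scale_measure emeasure_\<nu>w ennreal_mult'[symmetric])
qed

lemma distr_nu_tilde:
  "distr (\<nu>t) borel yp = scale_measure (ennreal (1 / m)) pp"
  "distr (\<nu>t) borel (\<lambda>s. - ym s) = scale_measure (ennreal (1 / m)) nn"
  unfolding nu_tilde_eq distr_\<nu>w[symmetric] by (intro distr_scale_measure; measurable)+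

lemma law_nu_tilde: "law_ae (\<nu>t) (\<lambda>s. (yp s, - ym s)) P"
  unfolding law_ae_def
proof (intro bexI[where x = "\<lambda>s. (yp s, - ym s)"] conjI)
  show "distr (\<nu>t) borel (\<lambda>s. (yp s, - ym s)) = P"
    unfolding nu_tilde_eq P_def P'_def by (rule distr_scale_measure) measurable
  show "(\<lambda>s. (yp s, - ym s)) \<in> borel_measurable (\<nu>t)"
    by (simp add: nu_tilde_def borel_measurable_Pair)
qed simp

lemma maximal_P_Q:
  assumes k: "superadditive_on {0..} {0..} k" "right_continuous_on2 {0..} {0..} k"
    and k0: "\<And>x y. 0 \<le> x \<Longrightarrow> 0 \<le> y \<Longrightarrow> 0 \<le> k x y"
  shows "(\<integral>\<^sup>+ z. ennreal (k (fst z) (snd z)) \<partial>P) \<le> (\<integral>\<^sup>+ z. ennreal (k (fst z) (snd z)) \<partial>Q)"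
proof -
  note meas = measurable_quadrant_ennreal(1)[OF measurable_quadrant_right_continuous[OF k(2)]]
  have pos: "AE z in P'. 0 \<le> fst z \<and> 0 \<le> snd z"
    using AE_P' by eventually_elim auto
  show ?thesis
    unfolding P_def Q_def nn_integral_scale_measure_AE[OF AE_P' sets_P' meas]
      nn_integral_scale_measure_AE[OF AE_coupling sets_coupling meas]
    using P'.comonotone_maximal[OF pos k k0] comonotone_P'
    by (intro mult_left_mono) (simp_all add: case_prod_beta')
qed

lemma minimal_cost_Q_P:
  assumes k: "superadditive_on {0<..} {0<..} k" "continuous_on quadrant (\<lambda>(x, y). k x y)"
    and neg: "\<And>x y. 0 < x \<Longrightarrow> 0 < y \<Longrightarrow> k x y \<le> 0"
  shows "(\<integral>\<^sup>+ z. ennreal (- k (fst z) (snd z)) \<partial>Q) \<le> (\<integral>\<^sup>+ z. ennreal (- k (fst z) (snd z)) \<partial>P)"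
proof -
  note meas = measurable_quadrant_ennreal(2)[OF measurable_continuous_quadrant[OF k(2)]]
  have pos: "AE z in P'. 0 < fst z \<and> 0 < snd z"
    using AE_P' by eventually_elim auto
  show ?thesis
    unfolding P_def Q_def nn_integral_scale_measure_AE[OF AE_P' sets_P' meas]
      nn_integral_scale_measure_AE[OF AE_coupling sets_coupling meas]
    using P'.comonotone_minimal_cost[OF pos k neg] comonotone_P'
    by (intro mult_left_mono) (simp_all add: case_prod_beta')
qed

end

section \<open>The main result\<close>

lemma ennreal_double_eqD: "2 * a = b + b \<Longrightarrow> a = (b :: ennreal)"
  by (simp add: mult_2[symmetric] ennreal_mult_cancel_left)

text \<open>Only absolute values have to match, because passing from the negative variable to its
  positive reflection changes the sign of a quotient.\<close>

lemma law_ae_lp_norm: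
  assumes "law_ae M Z R" and [measurable]: "f \<in> borel_measurable borel"
    and F: "\<And>w. \<bar>F w\<bar> = \<bar>f (Z w)\<bar>"
  shows "lp_norm M p F = lp_norm R p f"
  unfolding lp_norm_def F
  by (subst law_ae_nn_integral[OF assms(1), where D = UNIV and f = "\<lambda>z. ennreal (\<bar>f z\<bar> powr p)"]) auto

lemma lp_norm_mono:
  assumes "0 < p" "(\<integral>\<^sup>+ w. ennreal (\<bar>f w\<bar> powr p) \<partial>M) \<le> (\<integral>\<^sup>+ w. ennreal (\<bar>g w\<bar> powr p) \<partial>N)"
  shows "lp_norm M p f \<le> lp_norm N p g"
  unfolding lp_norm_def using assms by (intro ennreal_powr_mono) auto

lemma ennreal_powr_lp_norm:
  "0 < p \<Longrightarrow> ennreal_powr (lp_norm M p f) p = (\<integral>\<^sup>+ w. ennreal (\<bar>f w\<bar> powr p) \<partial>M)"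
  by (simp add: lp_norm_def ennreal_powr_powr_inverse)

lemma law_ae_ext_expectation_powr:
  assumes "law_ae M Z R" and F: "\<And>w. F w = fst (Z w) + snd (Z w)"
  shows "ext_expectation M (\<lambda>w. F w powr p) = enn2ereal (\<integral>\<^sup>+ z. ennreal ((fst z + snd z) powr p) \<partial>R)"
  unfolding F
  by (subst ext_expectation_nonneg, simp,
      subst law_ae_nn_integral[OF assms(1), where D = UNIV and f = "\<lambda>z. ennreal ((fst z + snd z) powr p)"]) auto

context centered_variable
begin

text \<open>One \<open>f\<close> serves both signs of \<open>Y\<close> when \<open>|F|\<close> is
  unchanged by exchanging \<open>Y\<close> with its reciprocal, as for sums and differences.
  Quotients lack this symmetry.\<close>

lemma symmetrized_lp_norm:
  fixes N :: "'b measure" and Y U :: "'b \<Rightarrow> real"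
  defines "r \<equiv> \<lambda>w. recip (Y w) (U w)"
  assumes N: "prob_space N" "distr N borel U = unif01" "has_weighted_law M X (\<lambda>x. x) N Y"
      "prob_space.indep_var N borel Y borel U"
    and [measurable]: "f \<in> borel_measurable borel"
    and F: "\<And>w. \<bar>F w\<bar> = \<bar>f (Y w, - r w)\<bar>" "\<And>w. \<bar>F w\<bar> = \<bar>f (r w, - Y w)\<bar>"
  shows "lp_norm N p F = lp_norm Q p f"
proof -
  have "2 * (\<integral>\<^sup>+ w. ennreal (\<bar>F w\<bar> powr p) \<partial>N)
      = (\<integral>\<^sup>+ z. ennreal (\<bar>f z\<bar> powr p) \<partial>Q) + (\<integral>\<^sup>+ z. ennreal (\<bar>f z\<bar> powr p) \<partial>Q)"
    by (rule nn_integral_symmetrized[OF N]) (use F in \<open>auto simp: r_def\<close>)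
  then show ?thesis unfolding lp_norm_def by (subst ennreal_double_eqD) auto
qed

end

section \<open>Comparing the mixture with the comonotone law\<close>

context two_point_mixture
begin

lemma ext_expectation_P_le_Q:
  assumes "(superadditive_on {0..} {0..} k \<and> right_continuous_on2 {0..} {0..} k \<and>
          bdd_below ((\<lambda>(x, y). k x y) ` ({0..} \<times> {0..}))) \<or>
       (superadditive_on {0<..} {0<..} k \<and> continuous_on quadrant (\<lambda>(x, y). k x y) \<and>
          bdd_above ((\<lambda>(x, y). k x y) ` quadrant))"
  shows "quadrant_measurable (\<lambda>z. k (fst z) (snd z))"
    and "ext_expectation P (\<lambda>z. k (fst z) (snd z)) \<le> ext_expectation Q (\<lambda>z. k (fst z) (snd z))"
proof -
  show meas: "quadrant_measurable (\<lambda>z. k (fst z) (snd z))"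
    using assms measurable_quadrant_right_continuous measurable_continuous_quadrant by blast
  \<comment> \<open>Cutting \<open>k\<close> off outside the quadrant makes it measurable
    everywhere. The value 0 there respects the bounds \<open>- C\<close> and \<open>C\<close>
    because \<open>C\<close> is chosen nonnegative.\<close>
  let ?k = "\<lambda>z. indicator quadrant z * k (fst z) (snd z)"
  have measP: "?k \<in> borel_measurable P" and measQ: "?k \<in> borel_measurable Q"
    using meas by (simp_all add: measurable_cong_sets[OF sets_P refl] measurable_cong_sets[OF sets_Q refl])
  have P_k: "AE z in P. ?k z = k (fst z) (snd z)" and Q_k: "AE z in Q. ?k z = k (fst z) (snd z)"
    using AE_P AE_Q by (auto elim!: eventually_mono)
  have ext: "ext_expectation P (\<lambda>z. k (fst z) (snd z)) = ext_expectation P ?k"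
    "ext_expectation Q (\<lambda>z. k (fst z) (snd z)) = ext_expectation Q ?k"
    using P_k Q_k by (auto intro!: ext_expectation_cong_AE elim!: eventually_mono)
  from assms show "ext_expectation P (\<lambda>z. k (fst z) (snd z)) \<le> ext_expectation Q (\<lambda>z. k (fst z) (snd z))"
  proof
    assume k: "superadditive_on {0..} {0..} k \<and> right_continuous_on2 {0..} {0..} k \<and>
          bdd_below ((\<lambda>(x, y). k x y) ` ({0..} \<times> {0..}))"
    then obtain c where c: "\<And>x y. 0 \<le> x \<Longrightarrow> 0 \<le> y \<Longrightarrow> c \<le> k x y"
      unfolding bdd_below_def by fastforce
    define C where "C = \<bar>c\<bar>"
    let ?I = "\<lambda>R. \<integral>\<^sup>+ z. ennreal (k (fst z) (snd z) + C) \<partial>R" and ?J = "\<lambda>R. \<integral>\<^sup>+ z. ennreal (?k z + C) \<partial>R"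
    have C: "0 \<le> C" and kC: "\<And>x y. 0 \<le> x \<Longrightarrow> 0 \<le> y \<Longrightarrow> 0 \<le> k x y + C"
      using c unfolding C_def by (simp, smt (verit))
    have lower: "- C \<le> ?k z" for z
      using kC[of "fst z" "snd z"] C by (auto split: split_indicator)
    have "superadditive_on {0..} {0..} (\<lambda>x y. k x y + C)"
      using k by (simp add: superadditive_on_def)
    moreover have "right_continuous_on2 {0..} {0..} (\<lambda>x y. k x y + C)"
      using k by (auto simp: right_continuous_on2_def case_prod_beta' intro!: tendsto_intros)
    ultimately have le: "?I P \<le> ?I Q"
      by (rule maximal_P_Q) (rule kC)
    have "?J P = ?I P"
      "?J Q = ?I Q"
      using P_k Q_k by (auto intro!: nn_integral_cong_AE elim!: eventually_mono)
    with le have "enn2ereal (?J P) \<le> enn2ereal (?J Q)"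
      by (simp add: less_eq_ennreal.rep_eq)
    then show ?thesis
      unfolding ext ext_expectation_bounded_below[OF prob_space_P measP C AE_I2[OF lower]]
        ext_expectation_bounded_below[OF prob_space_Q measQ C AE_I2[OF lower]]
      by (rule ereal_minus_mono) simp
  next
    assume k: "superadditive_on {0<..} {0<..} k \<and> continuous_on quadrant (\<lambda>(x, y). k x y) \<and>
          bdd_above ((\<lambda>(x, y). k x y) ` quadrant)"
    then obtain c where c: "\<And>x y. 0 < x \<Longrightarrow> 0 < y \<Longrightarrow> k x y \<le> c"
      unfolding bdd_above_def by fastforce
    define C where "C = \<bar>c\<bar>"
    let ?I = "\<lambda>R. \<integral>\<^sup>+ z. ennreal (C - k (fst z) (snd z)) \<partial>R" and ?J = "\<lambda>R. \<integral>\<^sup>+ z. ennreal (C - ?k z) \<partial>R"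
    have C: "0 \<le> C" and kC: "\<And>x y. 0 < x \<Longrightarrow> 0 < y \<Longrightarrow> k x y - C \<le> 0"
      using c unfolding C_def by (simp, smt (verit))
    have upper: "?k z \<le> C" for z
      using kC[of "fst z" "snd z"] C by (auto split: split_indicator)
    have "superadditive_on {0<..} {0<..} (\<lambda>x y. k x y - C)"
      using k by (simp add: superadditive_on_def)
    moreover have "continuous_on quadrant (\<lambda>(x, y). k x y - C)"
      using k by (auto simp: case_prod_beta' intro!: continuous_intros)
    ultimately have "(\<integral>\<^sup>+ z. ennreal (- (k (fst z) (snd z) - C)) \<partial>Q) \<le> (\<integral>\<^sup>+ z. ennreal (- (k (fst z) (snd z) - C)) \<partial>P)"
      by (rule minimal_cost_Q_P) (rule kC)
    then have le: "?I Q \<le> ?I P"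
      by simp
    have "?J P = ?I P"
      "?J Q = ?I Q"
      using P_k Q_k by (auto intro!: nn_integral_cong_AE elim!: eventually_mono)
    with le have "enn2ereal (?J Q) \<le> enn2ereal (?J P)"
      by (simp add: less_eq_ennreal.rep_eq)
    then show ?thesis
      unfolding ext ext_expectation_bounded_above[OF prob_space_P measP C AE_I2[OF upper]]
        ext_expectation_bounded_above[OF prob_space_Q measQ C AE_I2[OF upper]]
      by (intro ereal_minus_mono) simp_all
  qed
qed

lemma quotient_powr_Q_le_P:
  assumes "0 < p"
  shows "(\<integral>\<^sup>+ z. ennreal (\<bar>fst z / snd z\<bar> powr p) \<partial>Q) \<le> (\<integral>\<^sup>+ z. ennreal (\<bar>fst z / snd z\<bar> powr p) \<partial>P)" (is ?first)
    and "(\<integral>\<^sup>+ z. ennreal (\<bar>snd z / fst z\<bar> powr p) \<partial>Q) \<le> (\<integral>\<^sup>+ z. ennreal (\<bar>snd z / fst z\<bar> powr p) \<partial>P)" (is ?second)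
proof -
  have 1: "continuous_on quadrant (\<lambda>(x, y). - (\<bar>x / y\<bar> powr p))"
    unfolding case_prod_beta' by (intro continuous_intros) auto
  have 2: "continuous_on quadrant (\<lambda>(x, y). - (\<bar>y / x\<bar> powr p))"
    unfolding case_prod_beta' by (intro continuous_intros) auto
  show ?first
    using minimal_cost_Q_P[OF superadditive_on_quotient_powr(1)[OF assms] 1] by simp
  show ?second
    using minimal_cost_Q_P[OF superadditive_on_quotient_powr(2)[OF assms] 2] by simp
qed

lemma diff_powr_Q_le_P:
  assumes "1 \<le> p"
  shows "(\<integral>\<^sup>+ z. ennreal (\<bar>fst z - snd z\<bar> powr p) \<partial>Q) \<le> (\<integral>\<^sup>+ z. ennreal (\<bar>fst z - snd z\<bar> powr p) \<partial>P)"
proof -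
  have "continuous_on quadrant (\<lambda>(x, y). - (\<bar>x - y\<bar> powr p))"
    unfolding case_prod_beta' using assms by (intro continuous_on_minus continuous_on_powr' continuous_intros) auto
  from minimal_cost_Q_P[OF superadditive_on_abs_diff_powr[OF assms] this] show ?thesis by simp
qed

lemma sum_powr_P_le_Q:
  assumes "1 \<le> p"
  shows "(\<integral>\<^sup>+ z. ennreal (\<bar>fst z + snd z\<bar> powr p) \<partial>P) \<le> (\<integral>\<^sup>+ z. ennreal (\<bar>fst z + snd z\<bar> powr p) \<partial>Q)"
proof -
  have "continuous_on ({0..} \<times> {0..}) (\<lambda>(x, y). \<bar>x + y\<bar> powr p)"
    unfolding case_prod_beta' using assms by (intro continuous_on_powr' continuous_intros) auto
  from maximal_P_Q[OF superadditive_on_abs_sum_powr[OF assms] right_continuous_on2_continuous[OF this]]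
  show ?thesis by simp
qed

text \<open>
  For \<open>p < 0\<close> the function \<open>(x + y) powr p\<close> is unbounded near the origin, so the shifted functions
  \<open>(x + y + \<epsilon>) powr p\<close> are used.
\<close>
lemma sum_powr_nonpos_P_le_Q:
  assumes p: "p \<le> 0"
  shows "(\<integral>\<^sup>+ z. ennreal ((fst z + snd z) powr p) \<partial>P) \<le> (\<integral>\<^sup>+ z. ennreal ((fst z + snd z) powr p) \<partial>Q)"
proof -
  define e where "e n = 1 / real (Suc n)" for n
  have e: "0 < e n" for n by (simp add: e_def)
  let ?I = "\<lambda>R. \<integral>\<^sup>+ z. ennreal ((fst z + snd z) powr p) \<partial>R"
    and ?J = "\<lambda>n R. \<integral>\<^sup>+ z. ennreal ((fst z + snd z + e n) powr p) \<partial>R"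
  have e_lim: "e \<longlonglongrightarrow> 0"
    using LIMSEQ_inverse_real_of_nat unfolding e_def by (simp add: inverse_eq_divide)
  have le: "?J n P \<le> ?I Q" for n
  proof -
    have "continuous_on ({0..} \<times> {0..}) (\<lambda>(x, y). (x + y + e n) powr p)"
      unfolding case_prod_beta' using e[of n] by (intro continuous_on_powr' continuous_intros) auto
    from maximal_P_Q[OF superadditive_on_sum_powr_nonpos[OF p e] right_continuous_on2_continuous[OF this]]
    have "?J n P \<le> ?J n Q"
      by simp
    also have "\<dots> \<le> ?I Q"
    proof (rule nn_integral_mono_AE)
      show "AE z in Q. ennreal ((fst z + snd z + e n) powr p) \<le> ennreal ((fst z + snd z) powr p)"
        using AE_Q
      proof eventually_elim
        case (elim z)
        then show ?case using p e[of n] by (intro ennreal_leI powr_mono2') auto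
      qed
    qed
    finally show ?thesis .
  qed
  \<comment> \<open>On the \<open>Q\<close> side monotonicity in the shift has already removed
    \<open>e n\<close>; on the \<open>P\<close> side Fatou's lemma does so.\<close>
  have "?I P
      = (\<integral>\<^sup>+ z. liminf (\<lambda>n. ennreal ((fst z + snd z + e n) powr p)) \<partial>P)"
  proof (rule nn_integral_cong_AE)
    show "AE z in P. ennreal ((fst z + snd z) powr p) = liminf (\<lambda>n. ennreal ((fst z + snd z + e n) powr p))"
      using AE_P
    proof eventually_elim
      case (elim z)
      then have "0 < fst z + snd z" by auto
      then have "(\<lambda>n. (fst z + snd z + e n) powr p) \<longlonglongrightarrow> (fst z + snd z + 0) powr p"
        by (intro tendsto_intros e_lim) auto
      then have "(\<lambda>n. ennreal ((fst z + snd z + e n) powr p)) \<longlonglongrightarrow> ennreal ((fst z + snd z) powr p)"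
        by (intro tendsto_ennrealI) simp
      then show ?case by (intro lim_imp_Liminf[symmetric]) simp_all
    qed
  qed
  also have "\<dots> \<le> liminf (\<lambda>n. ?J n P)"
    by (rule nn_integral_liminf) measurable
  also have "\<dots> \<le> liminf (\<lambda>n. ?I Q)"
    by (intro Liminf_mono always_eventually allI le)
  also have "\<dots> = ?I Q" by (simp add: Liminf_const)
  finally show ?thesis .
qed

end

theorem proposition3p23:
  fixes M :: "'a measure" and X :: "'a \<Rightarrow> real"
    and \<nu> :: "'s measure" and yp ym :: "'s \<Rightarrow> real"
    and N :: "'b measure" and U Y Yp Ym :: "'b \<Rightarrow> real"
    and L :: "'c measure" and H :: "'c \<Rightarrow> real"
  defines "\<mu> \<equiv> distr M borel X"
    and "m \<equiv> 1 / 2 * (\<integral>\<omega>. \<bar>X \<omega>\<bar> \<partial>M)"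
  defines "\<nu>t \<equiv> nu_tilde \<nu> m yp ym"
    (* real-valued versions of the extended-real variables x_+(H), x_-(H), r(Y,U), r(Y_+,U), r(Y_-,U),
       which are almost surely finite *)
    and "xp \<equiv> \<lambda>\<omega>. real_of_ereal (x_plus \<mu> (H \<omega>))"
    and "xm \<equiv> \<lambda>\<omega>. real_of_ereal (x_minus \<mu> (H \<omega>))"
    and "r \<equiv> \<lambda>\<omega>. real_of_ereal (reciprocating \<mu> (ereal (Y \<omega>)) (U \<omega>))"
    and "rp \<equiv> \<lambda>\<omega>. real_of_ereal (reciprocating \<mu> (ereal (Yp \<omega>)) (U \<omega>))"
    and "rm \<equiv> \<lambda>\<omega>. real_of_ereal (reciprocating \<mu> (ereal (Ym \<omega>)) (U \<omega>))"
  assumes M: "prob_space M" "integrable M X" "(\<integral>\<omega>. X \<omega> \<partial>M) = 0"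
      "measure M {\<omega>\<in>space M. X \<omega> = 0} < 1"
    and \<nu>: "prob_space \<nu>" "yp \<in> borel_measurable \<nu>" "ym \<in> borel_measurable \<nu>"
      "\<And>s. s \<in> space \<nu> \<Longrightarrow> yp s > 0" "\<And>s. s \<in> space \<nu> \<Longrightarrow> ym s < 0"
    and mixture: "\<And>g :: real \<Rightarrow> real. g \<in> borel_measurable borel \<Longrightarrow>
        bdd_below (range g) \<or> bdd_above (range g) \<Longrightarrow>
        ext_expectation M (\<lambda>\<omega>. g (X \<omega>)) =
          ext_expectation \<nu> (\<lambda>s. measure_pmf.expectation (two_point (yp s) (ym s)) g)"
    and N: "prob_space N"
    and U: "U \<in> borel_measurable N" "distr N borel U = uniform_measure lborel {0..1}"
    and Y: "has_weighted_law M X (\<lambda>x. x) N Y" "prob_space.indep_var N borel Y borel U"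
    and Yp: "has_weighted_law M X (\<lambda>x. max 0 x) N Yp" "prob_space.indep_var N borel Yp borel U"
    and Ym: "has_weighted_law M X (\<lambda>x. min 0 x) N Ym" "prob_space.indep_var N borel Ym borel U"
    and H: "prob_space L" "H \<in> borel_measurable L" "distr L borel H = uniform_measure lborel {0..m}"
  shows "
     (prob_space \<nu>t)
   \<and> (distr \<nu>t borel yp = distr N borel Yp \<and> distr \<nu>t borel ym = distr N borel Ym)
   \<and> (\<forall>k :: real \<Rightarrow> real \<Rightarrow> real.
       (superadditive_on {0..} {0..} k \<and> right_continuous_on2 {0..} {0..} k \<and>
          bdd_below ((\<lambda>(x, y). k x y) ` ({0..} \<times> {0..}))) \<or>
       (superadditive_on {0<..} {0<..} k \<and> continuous_on ({0<..} \<times> {0<..}) (\<lambda>(x, y). k x y) \<and>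
          bdd_above ((\<lambda>(x, y). k x y) ` ({0<..} \<times> {0<..}))) \<longrightarrow>
       ext_expectation \<nu>t (\<lambda>s. k (yp s) (- ym s)) \<le> ext_expectation L (\<lambda>\<omega>. k (xp \<omega>) (- xm \<omega>)) \<and>
       ext_expectation L (\<lambda>\<omega>. k (xp \<omega>) (- xm \<omega>)) = ext_expectation N (\<lambda>\<omega>. k (Yp \<omega>) (- rp \<omega>)) \<and>
       ext_expectation N (\<lambda>\<omega>. k (Yp \<omega>) (- rp \<omega>)) = ext_expectation N (\<lambda>\<omega>. k (rm \<omega>) (- Ym \<omega>)) \<and>
       ((\<forall>x t. x * t < 0 \<longrightarrow> k x (- t) = k t (- x)) \<longrightarrow>
         ext_expectation N (\<lambda>\<omega>. k (rm \<omega>) (- Ym \<omega>)) = ext_expectation N (\<lambda>\<omega>. k (r \<omega>) (- Y \<omega>))))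
   \<and> (\<forall>p>0.
       lp_norm \<nu>t p (\<lambda>s. yp s / ym s) \<ge> lp_norm L p (\<lambda>\<omega>. xp \<omega> / xm \<omega>) \<and>
       lp_norm L p (\<lambda>\<omega>. xp \<omega> / xm \<omega>) = lp_norm N p (\<lambda>\<omega>. Yp \<omega> / rp \<omega>) \<and>
       lp_norm N p (\<lambda>\<omega>. Yp \<omega> / rp \<omega>) = lp_norm N p (\<lambda>\<omega>. rm \<omega> / Ym \<omega>))
   \<and> (\<forall>p>0.
       lp_norm \<nu>t p (\<lambda>s. ym s / yp s) \<ge> lp_norm L p (\<lambda>\<omega>. xm \<omega> / xp \<omega>) \<and>
       lp_norm L p (\<lambda>\<omega>. xm \<omega> / xp \<omega>) = lp_norm N p (\<lambda>\<omega>. Ym \<omega> / rm \<omega>) \<and>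
       lp_norm N p (\<lambda>\<omega>. Ym \<omega> / rm \<omega>) = lp_norm N p (\<lambda>\<omega>. rp \<omega> / Yp \<omega>))
   \<and> (\<forall>p>0.
       ennreal_powr (lp_norm \<nu>t p (\<lambda>s. yp s / ym s)) p + ennreal_powr (lp_norm \<nu>t p (\<lambda>s. ym s / yp s)) p
         \<ge> ennreal_powr (lp_norm L p (\<lambda>\<omega>. xp \<omega> / xm \<omega>)) p + ennreal_powr (lp_norm L p (\<lambda>\<omega>. xm \<omega> / xp \<omega>)) p \<and>
       ennreal_powr (lp_norm L p (\<lambda>\<omega>. xp \<omega> / xm \<omega>)) p + ennreal_powr (lp_norm L p (\<lambda>\<omega>. xm \<omega> / xp \<omega>)) p
         = ennreal_powr (lp_norm N p (\<lambda>\<omega>. Yp \<omega> / rp \<omega>)) p + ennreal_powr (lp_norm N p (\<lambda>\<omega>. rp \<omega> / Yp \<omega>)) p \<and>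
       ennreal_powr (lp_norm N p (\<lambda>\<omega>. Yp \<omega> / rp \<omega>)) p + ennreal_powr (lp_norm N p (\<lambda>\<omega>. rp \<omega> / Yp \<omega>)) p
         = ennreal_powr (lp_norm N p (\<lambda>\<omega>. rm \<omega> / Ym \<omega>)) p + ennreal_powr (lp_norm N p (\<lambda>\<omega>. Ym \<omega> / rm \<omega>)) p \<and>
       ennreal_powr (lp_norm N p (\<lambda>\<omega>. rm \<omega> / Ym \<omega>)) p + ennreal_powr (lp_norm N p (\<lambda>\<omega>. Ym \<omega> / rm \<omega>)) p
         = 2 * ennreal_powr (lp_norm N p (\<lambda>\<omega>. r \<omega> / Y \<omega>)) p \<and>
       2 * ennreal_powr (lp_norm N p (\<lambda>\<omega>. r \<omega> / Y \<omega>)) p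
         = 2 * ennreal_powr (lp_norm N p (\<lambda>\<omega>. Y \<omega> / r \<omega>)) p)
   \<and> (\<forall>p\<ge>1.
       lp_norm \<nu>t p (\<lambda>s. yp s + ym s) \<ge> lp_norm L p (\<lambda>\<omega>. xp \<omega> + xm \<omega>) \<and>
       lp_norm L p (\<lambda>\<omega>. xp \<omega> + xm \<omega>) = lp_norm N p (\<lambda>\<omega>. Yp \<omega> + rp \<omega>) \<and>
       lp_norm N p (\<lambda>\<omega>. Yp \<omega> + rp \<omega>) = lp_norm N p (\<lambda>\<omega>. rm \<omega> + Ym \<omega>) \<and>
       lp_norm N p (\<lambda>\<omega>. rm \<omega> + Ym \<omega>) = lp_norm N p (\<lambda>\<omega>. r \<omega> + Y \<omega>))
   \<and> (\<forall>p\<ge>1.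
       lp_norm \<nu>t p (\<lambda>s. yp s - ym s) \<le> lp_norm L p (\<lambda>\<omega>. xp \<omega> - xm \<omega>) \<and>
       lp_norm L p (\<lambda>\<omega>. xp \<omega> - xm \<omega>) = lp_norm N p (\<lambda>\<omega>. Yp \<omega> - rp \<omega>) \<and>
       lp_norm N p (\<lambda>\<omega>. Yp \<omega> - rp \<omega>) = lp_norm N p (\<lambda>\<omega>. rm \<omega> - Ym \<omega>) \<and>
       lp_norm N p (\<lambda>\<omega>. rm \<omega> - Ym \<omega>) = lp_norm N p (\<lambda>\<omega>. r \<omega> - Y \<omega>))
   \<and> (\<forall>p\<le>0.
       ext_expectation \<nu>t (\<lambda>s. (yp s - ym s) powr p) \<le> ext_expectation L (\<lambda>\<omega>. (xp \<omega> - xm \<omega>) powr p) \<and>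
       ext_expectation L (\<lambda>\<omega>. (xp \<omega> - xm \<omega>) powr p) = ext_expectation N (\<lambda>\<omega>. (Yp \<omega> - rp \<omega>) powr p) \<and>
       ext_expectation N (\<lambda>\<omega>. (Yp \<omega> - rp \<omega>) powr p) = ext_expectation N (\<lambda>\<omega>. (rm \<omega> - Ym \<omega>) powr p) \<and>
       ext_expectation N (\<lambda>\<omega>. (rm \<omega> - Ym \<omega>) powr p) = ext_expectation N (\<lambda>\<omega>. \<bar>r \<omega> - Y \<omega>\<bar> powr p))"
proof -
  interpret two_point_mixture M X m \<nu> yp ym
    unfolding two_point_mixture_def two_point_mixture_axioms_def centered_variable_def centered_variable_axioms_def
    using M \<nu> mixture by (simp add: m_def)
  have law_\<nu>: "law_ae \<nu>t (\<lambda>s. (yp s, - ym s)) P"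
    using law_nu_tilde unfolding \<nu>t_def .
  have law_L: "law_ae L (\<lambda>w. (xp w, - xm w)) Q"
    using law_ae_uniform[OF H(2,3)] unfolding Q_def xp_def xm_def \<mu>_def .
  have law_p: "law_ae N (\<lambda>w. (Yp w, - rp w)) Q"
    using law_plus[OF N U(2) Yp] unfolding rp_def \<mu>_def .
  have law_m: "law_ae N (\<lambda>w. (rm w, - Ym w)) Q"
    using law_minus[OF N U(2) Ym] unfolding rm_def \<mu>_def .
  have sym: "2 * (\<integral>\<^sup>+ w. F w \<partial>N) = (\<integral>\<^sup>+ z. f z \<partial>Q) + (\<integral>\<^sup>+ z. g z \<partial>Q)"
    if "quadrant_measurable f"
      "quadrant_measurable g"
      "\<And>w. 0 < Y w \<Longrightarrow> r w < 0 \<Longrightarrow> F w = f (Y w, - r w)"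
      "\<And>w. Y w < 0 \<Longrightarrow> 0 < r w \<Longrightarrow> F w = g (r w, - Y w)"
    for F :: "'b \<Rightarrow> ennreal" and f g :: "real \<times> real \<Rightarrow> ennreal"
    by (rule nn_integral_symmetrized[OF N U(2) Y that(1,2)])
      (use that(3,4) in \<open>simp_all only: r_def \<mu>_def\<close>)
  have sym_lp: "lp_norm N p F = lp_norm Q p f"
    if "f \<in> borel_measurable borel" "\<And>w. \<bar>F w\<bar> = \<bar>f (Y w, - r w)\<bar>" "\<And>w. \<bar>F w\<bar> = \<bar>f (r w, - Y w)\<bar>"
    for F :: "'b \<Rightarrow> real" and f :: "real \<times> real \<Rightarrow> real" and p
    by (rule symmetrized_lp_norm[OF N U(2) Y that(1)])
      (use that(2,3) in \<open>simp_all only: r_def \<mu>_def\<close>)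

  \<comment> \<open>Marginal laws of the mixture\<close>
  have part_ii: "distr \<nu>t borel yp = distr N borel Yp" "distr \<nu>t borel ym = distr N borel Ym"
  proof -
    have [measurable]: "Ym \<in> borel_measurable N" "ym \<in> borel_measurable \<nu>t"
      using Ym(1) \<nu> by (simp_all add: has_weighted_law_def \<nu>t_def nu_tilde_def)
    show "distr \<nu>t borel yp = distr N borel Yp"
      using weighted_law_pos[OF N Yp(1)] distr_nu_tilde(1) by (simp add: density_1 \<nu>t_def)
    have "distr \<nu>t borel (\<lambda>s. - ym s) = distr N borel (\<lambda>w. - Ym w)"
      using weighted_law_neg[OF N Ym(1)] distr_nu_tilde(2) by (simp add: density_1 \<nu>t_def)
    then have "distr (distr \<nu>t borel (\<lambda>s. - ym s)) borel uminus = distr (distr N borel (\<lambda>w. - Ym w)) borel uminus"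
      by simp
    then show "distr \<nu>t borel ym = distr N borel Ym"
      by (simp add: distr_distr comp_def)
  qed

  \<comment> \<open>Norms and powers as integrals over \<open>P\<close> and \<open>Q\<close>\<close>
  let ?q = "\<lambda>z :: real \<times> real. fst z / snd z" and ?q' = "\<lambda>z :: real \<times> real. snd z / fst z"
    and ?d = "\<lambda>z :: real \<times> real. fst z - snd z" and ?s = "\<lambda>z :: real \<times> real. fst z + snd z"
  have lp_q: "lp_norm \<nu>t p (\<lambda>s. yp s / ym s) = lp_norm P p ?q" "lp_norm L p (\<lambda>w. xp w / xm w) = lp_norm Q p ?q"
    "lp_norm N p (\<lambda>w. Yp w / rp w) = lp_norm Q p ?q" "lp_norm N p (\<lambda>w. rm w / Ym w) = lp_norm Q p ?q"
    "lp_norm \<nu>t p (\<lambda>s. ym s / yp s) = lp_norm P p ?q'" "lp_norm L p (\<lambda>w. xm w / xp w) = lp_norm Q p ?q'"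
    "lp_norm N p (\<lambda>w. rp w / Yp w) = lp_norm Q p ?q'" "lp_norm N p (\<lambda>w. Ym w / rm w) = lp_norm Q p ?q'" for p
    by (rule law_ae_lp_norm[OF law_\<nu>] law_ae_lp_norm[OF law_L] law_ae_lp_norm[OF law_p] law_ae_lp_norm[OF law_m];
        simp)+
  \<comment> \<open>The second coordinate is the negated variable, so sums in the statement become
    differences of coordinates, and differences become sums.\<close>
  have lp_d: "lp_norm \<nu>t p (\<lambda>s. yp s + ym s) = lp_norm P p ?d" "lp_norm L p (\<lambda>w. xp w + xm w) = lp_norm Q p ?d"
    "lp_norm N p (\<lambda>w. Yp w + rp w) = lp_norm Q p ?d" "lp_norm N p (\<lambda>w. rm w + Ym w) = lp_norm Q p ?d" for p
    by (rule law_ae_lp_norm[OF law_\<nu>] law_ae_lp_norm[OF law_L] law_ae_lp_norm[OF law_p] law_ae_lp_norm[OF law_m];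
        simp)+
  have lp_d_sym: "lp_norm N p (\<lambda>w. r w + Y w) = lp_norm Q p ?d" for p
    by (rule sym_lp) (simp_all add: add.commute)
  have lp_s: "lp_norm \<nu>t p (\<lambda>s. yp s - ym s) = lp_norm P p ?s" "lp_norm L p (\<lambda>w. xp w - xm w) = lp_norm Q p ?s"
    "lp_norm N p (\<lambda>w. Yp w - rp w) = lp_norm Q p ?s" "lp_norm N p (\<lambda>w. rm w - Ym w) = lp_norm Q p ?s" for p
    by (rule law_ae_lp_norm[OF law_\<nu>] law_ae_lp_norm[OF law_L] law_ae_lp_norm[OF law_p] law_ae_lp_norm[OF law_m];
        simp)+
  have lp_s_sym: "lp_norm N p (\<lambda>w. r w - Y w) = lp_norm Q p ?s" for p
    by (rule sym_lp) (simp_all add: abs_minus_commute)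
  let ?E = "\<lambda>R p. enn2ereal (\<integral>\<^sup>+ z. ennreal (?s z powr p) \<partial>R)"
  have powr_s: "ext_expectation \<nu>t (\<lambda>s. (yp s - ym s) powr p) = ?E P p"
    "ext_expectation L (\<lambda>w. (xp w - xm w) powr p) = ?E Q p"
    "ext_expectation N (\<lambda>w. (Yp w - rp w) powr p) = ?E Q p"
    "ext_expectation N (\<lambda>w. (rm w - Ym w) powr p) = ?E Q p" for p
    by (rule law_ae_ext_expectation_powr[OF law_\<nu>] law_ae_ext_expectation_powr[OF law_L]
        law_ae_ext_expectation_powr[OF law_p] law_ae_ext_expectation_powr[OF law_m]; simp)+
  have powr_s_sym: "ext_expectation N (\<lambda>w. \<bar>r w - Y w\<bar> powr p) = ?E Q p" for p
  proof -
    have "(\<integral>\<^sup>+ w. ennreal (\<bar>r w - Y w\<bar> powr p) \<partial>N) = (\<integral>\<^sup>+ z. ennreal (?s z powr p) \<partial>Q)"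
      by (rule ennreal_double_eqD, rule sym) simp_all
    then show ?thesis
      by (subst ext_expectation_nonneg) simp_all
  qed
  \<comment> \<open>For positive \<open>Y\<close> the quotient of \<open>r\<close> and
    \<open>Y\<close> is second over first coordinate in modulus, for negative \<open>Y\<close> it is
    first over second. Twice its integral is thus the sum over both quotients, which explains the
    factor 2 in the statement.\<close>
  have quot_sym: "2 * (\<integral>\<^sup>+ w. ennreal (\<bar>r w / Y w\<bar> powr p) \<partial>N)
      = (\<integral>\<^sup>+ z. ennreal (\<bar>?q' z\<bar> powr p) \<partial>Q) + (\<integral>\<^sup>+ z. ennreal (\<bar>?q z\<bar> powr p) \<partial>Q)"
    "2 * (\<integral>\<^sup>+ w. ennreal (\<bar>Y w / r w\<bar> powr p) \<partial>N)
      = (\<integral>\<^sup>+ z. ennreal (\<bar>?q z\<bar> powr p) \<partial>Q) + (\<integral>\<^sup>+ z. ennreal (\<bar>?q' z\<bar> powr p) \<partial>Q)" for p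
    by (rule sym; simp)+

  \<comment> \<open>Quotient inequalities and the conclusion\<close>
  have quot_le: "lp_norm Q p ?q \<le> lp_norm P p ?q" "lp_norm Q p ?q' \<le> lp_norm P p ?q'" if "0 < p" for p
    by (intro lp_norm_mono quotient_powr_Q_le_P that)+
  have quot_sum: "ennreal_powr (lp_norm Q p ?q) p + ennreal_powr (lp_norm Q p ?q') p
      \<le> ennreal_powr (lp_norm P p ?q) p + ennreal_powr (lp_norm P p ?q') p"
    "ennreal_powr (lp_norm Q p ?q) p + ennreal_powr (lp_norm Q p ?q') p
      = 2 * ennreal_powr (lp_norm N p (\<lambda>w. r w / Y w)) p"
    "2 * ennreal_powr (lp_norm N p (\<lambda>w. r w / Y w)) p = 2 * ennreal_powr (lp_norm N p (\<lambda>w. Y w / r w)) p"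
    if "0 < p" for p
    unfolding ennreal_powr_lp_norm[OF that] quot_sym
    by (intro add_mono quotient_powr_Q_le_P that) (rule add.commute)+
  show ?thesis
    \<comment> \<open>Written over \<open>P\<close> and \<open>Q\<close>, the equalities between the
      norms become reflexive, except those for quotients with \<open>Y\<close>, which
      \<open>quot_sum\<close> supplies.\<close>
    unfolding lp_q lp_d lp_d_sym lp_s lp_s_sym powr_s powr_s_sym
  proof (intro conjI, goal_cases)
    case 1
    show ?case unfolding \<nu>t_def by (rule prob_space_nu_tilde)
  next
    case 4
    show ?case
    proof (rule allI, rule impI, goal_cases)
      case k: (1 k)
      note meas = ext_expectation_P_le_Q(1)[OF k]
      let ?f = "\<lambda>z. k (fst z) (snd z)"
      have eqs: "ext_expectation \<nu>t (\<lambda>s. k (yp s) (- ym s)) = ext_expectation P ?f"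
        "ext_expectation L (\<lambda>w. k (xp w) (- xm w)) = ext_expectation Q ?f"
        "ext_expectation N (\<lambda>w. k (Yp w) (- rp w)) = ext_expectation Q ?f"
        "ext_expectation N (\<lambda>w. k (rm w) (- Ym w)) = ext_expectation Q ?f"
        using law_ae_ext_expectation[OF law_\<nu> AE_P meas] law_ae_ext_expectation[OF law_L AE_Q meas]
          law_ae_ext_expectation[OF law_p AE_Q meas] law_ae_ext_expectation[OF law_m AE_Q meas] by simp_all
      have "ext_expectation N (\<lambda>w. k (r w) (- Y w)) = ext_expectation Q ?f"
        if symm: "\<forall>x t. x * t < 0 \<longrightarrow> k x (- t) = k t (- x)"
      proof -
        \<comment> \<open>\<open>sym\<close> is applied with the same function for both signs of
          \<open>Y\<close>. For negative \<open>Y\<close> the pair \<open>(r w, - Y w)\<close> is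
          already in the right order; for positive \<open>Y\<close> the symmetry condition exchanges
          the roles.\<close>
        have swap: "k (r w) (- Y w) = k (Y w) (- r w)" if "0 < Y w" "r w < 0" for w
        proof -
          have "k (Y w) (- r w) = k (r w) (- Y w)"
            using symm mult_pos_neg[OF that] by blast
          then show ?thesis ..
        qed
        have "(\<integral>\<^sup>+ w. ennreal (k (r w) (- Y w)) \<partial>N) = (\<integral>\<^sup>+ z. ennreal (?f z) \<partial>Q)"
          by (rule ennreal_double_eqD, rule sym[OF measurable_quadrant_ennreal(1)[OF meas] measurable_quadrant_ennreal(1)[OF meas]])
            (simp_all only: fst_conv snd_conv swap)
        moreover have "(\<integral>\<^sup>+ w. ennreal (- k (r w) (- Y w)) \<partial>N) = (\<integral>\<^sup>+ z. ennreal (- ?f z) \<partial>Q)"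
          by (rule ennreal_double_eqD, rule sym[OF measurable_quadrant_ennreal(2)[OF meas] measurable_quadrant_ennreal(2)[OF meas]])
            (simp_all only: fst_conv snd_conv swap)
        ultimately show ?thesis
          unfolding ext_expectation_def by (simp only:)
      qed
      then show ?case using eqs ext_expectation_P_le_Q(2)[OF k] by simp
    qed
  next
    case 7
    show ?case using quot_sum by simp
  next
    case 8
    show ?case by (simp add: lp_norm_mono diff_powr_Q_le_P)
  next
    case 9
    show ?case by (simp add: lp_norm_mono sum_powr_P_le_Q)
  next
    case 10
    show ?case by (simp add: less_eq_ennreal.rep_eq[symmetric] sum_powr_nonpos_P_le_Q)
  qed (simp_all add: part_ii quot_le)
qed

end
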